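(* Let $G$ be a finite group with subgroups $H_1,H_2<G$ such that $|G:H_1|=|G:H_2|=2$, let $\varphi:H_1\to H_2$ be an isomorphism such that no non-trivial subgroup of $H_1\cap H_2$ is preserved by $\varphi$, and let $\Gamma=G*_\varphi$ be the corresponding HNN extension. Then $\Gamma$ is isomorphic to one of the HNN extensions $\Gamma_{n,k,\vec\epsilon}$. In particular, every element of $G$ has order at most $4$.
   Context: $G*_\varphi=(G*\langle x\rangle)/(\varphi(u)=xux^{-1},\ u\in H_1)$. A subgroup $K$ is preserved by $\varphi$ if $\varphi(K)=K$. The HNN extensions $\Gamma_{n,k,\vec\epsilon}$: let $n\ge1$, $0\le k\le\lfloor n/3\rfloor$, and let $\epsilon(j,l)\in\{0,1\}$ for $n-k\le j\le n-1$, $k\le l\le j-k$, with $\sum_l\epsilon(n-k,l)>0$ (there are no parameters, and no condition, when $k=0$). Let $G_{n,k,\vec\epsilon}$ be the group with generators $t_1,\dots,t_n$ and relations $t_i^2=1$ for all $i$; $[t_i,t_{i+j}]=1$ for $0<j<n-k$; and $[t_i,t_{i+j}]=t_{i+k}^{\epsilon(j,k)}t_{i+k+1}^{\epsilon(j,k+1)}\cdots t_{i+j-k}^{\epsilon(j,j-k)}$ for $n-k\le j\le n-1$, where always $1\le i<i+j\le n$. In particular $G_{n,0,\varnothing}\cong(C_2)^n$. Then $\Gamma_{n,k,\vec\epsilon}$ is the HNN extension of $G_{n,k,\vec\epsilon}$ over the isomorphism $\langle t_1,\dots,t_{n-1}\rangle\to\langle t_2,\dots,t_n\rangle$, $t_i\mapsto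 t_{i+1}$. *)

theory Defs
  imports "HOL-Algebra.Algebra"
begin

section \<open>Monoids presented by generators and relations\<close>

text \<open>The congruence on the words over the alphabet \<open>A\<close> generated by the pairs in
  \<open>R \<subseteq> lists A \<times> lists A\<close>.\<close>

inductive word_cong :: "'a set \<Rightarrow> ('a list \<times> 'a list) set \<Rightarrow> 'a list \<Rightarrow> 'a list \<Rightarrow> bool"
  for A R where
  refl: "w \<in> lists A \<Longrightarrow> word_cong A R w w"
| sym: "word_cong A R v w \<Longrightarrow> word_cong A R w v"
| trans: "word_cong A R u v \<Longrightarrow> word_cong A R v w \<Longrightarrow> word_cong A R u w"
| rel: "(r, s) \<in> R \<Longrightarrow> u \<in> lists A \<Longrightarrow> v \<in> lists A \<Longrightarrow> word_cong A R (u @ r @ v) (u @ s @ v)"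

definition word_class :: "'a set \<Rightarrow> ('a list \<times> 'a list) set \<Rightarrow> 'a list \<Rightarrow> 'a list set" where
  "word_class A R w = {v. word_cong A R w v}"

definition presented_monoid :: "'a set \<Rightarrow> ('a list \<times> 'a list) set \<Rightarrow> 'a list set monoid" where
  "presented_monoid A R =
    \<lparr>carrier = word_class A R ` lists A,
     monoid.mult = (\<lambda>U V. \<Union>u\<in>U. \<Union>v\<in>V. word_class A R (u @ v)),
     one = word_class A R []\<rparr>"


section \<open>Free groups, free products, normal closures\<close>

text \<open>In the free group on \<open>S\<close>, the letter \<open>(s, True)\<close> stands for the generator \<open>s\<close> and
  \<open>(s, False)\<close> for its inverse.\<close>

definition free_group_rels :: "'s set \<Rightarrow> (('s \<times> bool) list \<times> ('s \<times> bool) list) set" where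
  "free_group_rels S = {([(s, b), (s, \<not> b)], []) | s b. s \<in> S}"

definition free_group :: "'s set \<Rightarrow> ('s \<times> bool) list set monoid" where
  "free_group S = presented_monoid (S \<times> UNIV) (free_group_rels S)"

definition free_gen :: "'s set \<Rightarrow> 's \<Rightarrow> ('s \<times> bool) list set" where
  "free_gen S s = word_class (S \<times> UNIV) (free_group_rels S) [(s, True)]"

definition free_product_rels ::
    "('a, 'm) monoid_scheme \<Rightarrow> ('b, 'n) monoid_scheme \<Rightarrow> (('a + 'b) list \<times> ('a + 'b) list) set" where
  "free_product_rels G H =
     {([Inl \<one>\<^bsub>G\<^esub>], []), ([Inr \<one>\<^bsub>H\<^esub>], [])}
     \<union> {([Inl a, Inl b], [Inl (a \<otimes>\<^bsub>G\<^esub> b)]) | a b. a \<in> carrier G \<and> b \<in> carrier G}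
     \<union> {([Inr a, Inr b], [Inr (a \<otimes>\<^bsub>H\<^esub> b)]) | a b. a \<in> carrier H \<and> b \<in> carrier H}"

definition free_product ::
    "('a, 'm) monoid_scheme \<Rightarrow> ('b, 'n) monoid_scheme \<Rightarrow> ('a + 'b) list set monoid" where
  "free_product G H = presented_monoid (carrier G <+> carrier H) (free_product_rels G H)"

definition free_product_inl ::
    "('a, 'm) monoid_scheme \<Rightarrow> ('b, 'n) monoid_scheme \<Rightarrow> 'a \<Rightarrow> ('a + 'b) list set" where
  "free_product_inl G H a = word_class (carrier G <+> carrier H) (free_product_rels G H) [Inl a]"

definition free_product_inr ::
    "('a, 'm) monoid_scheme \<Rightarrow> ('b, 'n) monoid_scheme \<Rightarrow> 'b \<Rightarrow> ('a + 'b) list set" where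
  "free_product_inr G H b = word_class (carrier G <+> carrier H) (free_product_rels G H) [Inr b]"

definition normal_closure :: "('a, 'm) monoid_scheme \<Rightarrow> 'a set \<Rightarrow> 'a set" where
  "normal_closure G R = \<Inter>{N. N \<lhd> G \<and> R \<subseteq> N}"

text \<open>For the involutions it is applied to below, the convention
  \<open>inv a \<otimes> inv b \<otimes> a \<otimes> b\<close> gives the same relations.\<close>

definition commutator :: "('a, 'm) monoid_scheme \<Rightarrow> 'a \<Rightarrow> 'a \<Rightarrow> 'a" where
  "commutator G a b = a \<otimes>\<^bsub>G\<^esub> b \<otimes>\<^bsub>G\<^esub> inv\<^bsub>G\<^esub> a \<otimes>\<^bsub>G\<^esub> inv\<^bsub>G\<^esub> b"


section \<open>HNN extensions\<close>

text \<open>\<open>integer_group\<close> plays the role of the infinite cyclic group on the stable letter \<open>x\<close>,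
  the element \<open>1\<close> being \<open>x\<close>. Only the values of \<open>\<phi>\<close> on \<open>H\<^sub>1\<close> matter.\<close>

definition hnn_relators ::
    "('a, 'm) monoid_scheme \<Rightarrow> 'a set \<Rightarrow> ('a \<Rightarrow> 'a) \<Rightarrow> ('a + int) list set set" where
  "hnn_relators G H\<^sub>1 \<phi> =
    (let F = free_product G integer_group;
         \<iota> = free_product_inl G integer_group;
         x = free_product_inr G integer_group 1
     in {\<iota> (\<phi> u) \<otimes>\<^bsub>F\<^esub> inv\<^bsub>F\<^esub> (x \<otimes>\<^bsub>F\<^esub> \<iota> u \<otimes>\<^bsub>F\<^esub> inv\<^bsub>F\<^esub> x) | u. u \<in> H\<^sub>1})"

definition hnn_extension ::
    "('a, 'm) monoid_scheme \<Rightarrow> 'a set \<Rightarrow> ('a \<Rightarrow> 'a) \<Rightarrow> ('a + int) list set set monoid" where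
  "hnn_extension G H\<^sub>1 \<phi> =
    free_product G integer_group Mod
      normal_closure (free_product G integer_group) (hnn_relators G H\<^sub>1 \<phi>)"


section \<open>The groups \<open>G\<^bsub>n,k,\<epsilon>\<^esub>\<close> and the extensions \<open>\<Gamma>\<^bsub>n,k,\<epsilon>\<^esub>\<close>\<close>

text \<open>Values of \<open>\<epsilon>\<close> outside the index range are irrelevant. None of the truncated subtractions
  below truncates, since \<open>1 \<le> n\<close> and \<open>3 k \<le> n\<close>.\<close>

definition gamma_params :: "nat \<Rightarrow> nat \<Rightarrow> (nat \<Rightarrow> nat \<Rightarrow> nat) \<Rightarrow> bool" where
  "gamma_params n k \<epsilon> \<longleftrightarrow>
     1 \<le> n \<and> k \<le> n div 3 \<and>
     (\<forall>j\<in>{n - k..n - 1}. \<forall>l\<in>{k..j - k}. \<epsilon> j l \<in> {0, 1}) \<and>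
     (k > 0 \<longrightarrow> (\<Sum>l = k..(n - k) - k. \<epsilon> (n - k) l) > 0)"

definition Gnk_relators ::
    "nat \<Rightarrow> nat \<Rightarrow> (nat \<Rightarrow> nat \<Rightarrow> nat) \<Rightarrow> (nat \<times> bool) list set set" where
  "Gnk_relators n k \<epsilon> =
    (let F = free_group {1..n}; t = free_gen {1..n}
     in {t i [^]\<^bsub>F\<^esub> (2::nat) | i. 1 \<le> i \<and> i \<le> n}
      \<union> {commutator F (t i) (t (i + j)) | i j. 1 \<le> i \<and> i + j \<le> n \<and> 0 < j \<and> j < n - k}
      \<union> {commutator F (t i) (t (i + j)) \<otimes>\<^bsub>F\<^esub>
           inv\<^bsub>F\<^esub> (foldr (\<lambda>l p. t (i + l) [^]\<^bsub>F\<^esub> \<epsilon> j l \<otimes>\<^bsub>F\<^esub> p) [k..<Suc (j - k)] \<one>\<^bsub>F\<^esub>)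
         | i j. 1 \<le> i \<and> i < i + j \<and> i + j \<le> n \<and> n - k \<le> j \<and> j \<le> n - 1})"

definition Gnk :: "nat \<Rightarrow> nat \<Rightarrow> (nat \<Rightarrow> nat \<Rightarrow> nat) \<Rightarrow> (nat \<times> bool) list set set monoid" where
  "Gnk n k \<epsilon> = free_group {1..n} Mod normal_closure (free_group {1..n}) (Gnk_relators n k \<epsilon>)"

definition Gnk_gen ::
    "nat \<Rightarrow> nat \<Rightarrow> (nat \<Rightarrow> nat \<Rightarrow> nat) \<Rightarrow> nat \<Rightarrow> (nat \<times> bool) list set set" where
  "Gnk_gen n k \<epsilon> i =
    normal_closure (free_group {1..n}) (Gnk_relators n k \<epsilon>) #>\<^bsub>free_group {1..n}\<^esub> free_gen {1..n} i"

definition Gnk_dom :: "nat \<Rightarrow> nat \<Rightarrow> (nat \<Rightarrow> nat \<Rightarrow> nat) \<Rightarrow> (nat \<times> bool) list set set set" where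
  "Gnk_dom n k \<epsilon> = generate (Gnk n k \<epsilon>) (Gnk_gen n k \<epsilon> ` {i. 1 \<le> i \<and> i \<le> n - 1})"

definition Gnk_ran :: "nat \<Rightarrow> nat \<Rightarrow> (nat \<Rightarrow> nat \<Rightarrow> nat) \<Rightarrow> (nat \<times> bool) list set set set" where
  "Gnk_ran n k \<epsilon> = generate (Gnk n k \<epsilon>) (Gnk_gen n k \<epsilon> ` {i. 2 \<le> i \<and> i \<le> n})"

text \<open>\<open>\<psi>\<close> is the isomorphism \<open>t\<^sub>i \<mapsto> t\<^bsub>i+1\<^esub>\<close>; it is determined on \<open>Gnk_dom n k \<epsilon>\<close>.\<close>

definition Gnk_shift :: "nat \<Rightarrow> nat \<Rightarrow> (nat \<Rightarrow> nat \<Rightarrow> nat) \<Rightarrow>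
    ((nat \<times> bool) list set set \<Rightarrow> (nat \<times> bool) list set set) \<Rightarrow> bool" where
  "Gnk_shift n k \<epsilon> \<psi> \<longleftrightarrow>
     \<psi> \<in> iso ((Gnk n k \<epsilon>)\<lparr>carrier := Gnk_dom n k \<epsilon>\<rparr>) ((Gnk n k \<epsilon>)\<lparr>carrier := Gnk_ran n k \<epsilon>\<rparr>) \<and>
     (\<forall>i. 1 \<le> i \<and> i \<le> n - 1 \<longrightarrow> \<psi> (Gnk_gen n k \<epsilon> i) = Gnk_gen n k \<epsilon> (i + 1))"

definition Gamma_ext :: "nat \<Rightarrow> nat \<Rightarrow> (nat \<Rightarrow> nat \<Rightarrow> nat) \<Rightarrow>
    ((nat \<times> bool) list set set \<Rightarrow> (nat \<times> bool) list set set) \<Rightarrow>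
    ((nat \<times> bool) list set set + int) list set set monoid" where
  "Gamma_ext n k \<epsilon> \<psi> = hnn_extension (Gnk n k \<epsilon>) (Gnk_dom n k \<epsilon>) \<psi>"

end

theory Submission
  imports Defs
begin

text \<open>Let \<open>D\<^sub>i\<close> be the subgroup of \<open>G\<close> on which the \<open>i\<close>-th power of \<open>\<phi>\<close> is defined. As \<open>H\<^sub>1\<close> has index
  two, the indices in the chain \<open>G = D\<^sub>0 \<supseteq> D\<^sub>1 \<supseteq> \<dots>\<close> are at most two. The first \<open>D\<^sub>n\<close> with
  \<open>D\<^sub>n = D\<^bsub>n+1\<^esub>\<close> is preserved by \<open>\<phi>\<close> and therefore trivial. So \<open>G\<close> has order \<open>2\<^sup>n\<close>, the group
  \<open>D\<^bsub>n-1\<^esub>\<close> is generated by an involution \<open>t\<^sub>1\<close>, and with \<open>t\<^bsub>i+1\<^esub> = \<phi>(t\<^sub>i)\<close> one has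
  \<open>D\<^bsub>n-b\<^esub> = \<langle>t\<^sub>1, \<dots>, t\<^sub>b\<rangle>\<close>. The segment \<open>\<langle>t\<^sub>a, \<dots>, t\<^sub>b\<rangle>\<close> has order \<open>2\<^bsup>b-a+1\<^esup>\<close>; leaving out the generator
  at either end gives a subgroup of index two, which is normal, and so \<open>[t\<^sub>i, t\<^sub>j]\<close> lies in the
  segment strictly between \<open>i\<close> and \<open>j\<close>.

  The heart of the matter is that these commutators are supported much further inside. If \<open>G\<close> is
  not abelian, let \<open>m\<close> be the least \<open>d\<close> for which the commutators \<open>[t\<^sub>i, t\<^bsub>i+d\<^esub>]\<close> are non-trivial, and
  \<open>k = n - m\<close>. Then \<open>[t\<^sub>i, t\<^bsub>i+j\<^esub>]\<close> lies in \<open>\<langle>t\<^bsub>i+k\<^esub>, \<dots>, t\<^bsub>i+j-k\<^esub>\<rangle>\<close> for all \<open>j \<ge> m\<close>. This is proved one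
  step at a time (\<open>narrow_Suc\<close>). If \<open>c = [t\<^sub>i, g]\<close> starts with \<open>t\<^sub>a\<close>, then \<open>h = t\<^bsub>a+m\<^esub>\<close> commutes with all
  other letters of \<open>c\<close>, and conjugation by \<open>h\<close> multiplies \<open>c\<close> by \<open>[t\<^sub>a, t\<^bsub>a+m\<^esub>]\<close>. On the other hand,
  conjugating \<open>t\<^sub>i\<close> by the commuting involutions \<open>g\<close> and \<open>h\<close> in both orders relates the conjugate of
  \<open>c\<close> by \<open>h\<close> to that of \<open>[t\<^sub>i, h]\<close> by \<open>g\<close> (\<open>br_exchange\<close>). Comparing the two makes \<open>[t\<^sub>a, t\<^bsub>a+m\<^esub>]\<close> trivial
  or equal to another translate of itself under \<open>\<phi>\<close>. Neither is possible: a non-trivial element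
  fixed by a positive power of \<open>\<phi>\<close> would lie in every \<open>D\<^sub>i\<close>. In the last step, where \<open>h = g\<close>,
  one uses instead that \<open>g\<close> inverts \<open>c\<close>, which by then is known to be an involution. Since \<open>[t\<^sub>1, t\<^bsub>1+m\<^esub>]\<close> is not trivial, its
  segment is not empty, which gives \<open>2 k \<le> m\<close>, that is \<open>3 k \<le> n\<close>.

  The exponents \<open>\<epsilon>(j,l)\<close> are read off from the commutators with \<open>i = 1\<close>, and \<open>\<phi>\<close> carries the
  relations to all \<open>i\<close>. The resulting homomorphism from \<open>G\<^bsub>n,k,\<epsilon>\<^esub>\<close> onto \<open>G\<close> is injective: already the
  defining relations allow every element to be written with the last generator occurring at most once, in
  front, and an element of the kernel cannot contain it because \<open>t\<^sub>b\<close> is not in \<open>\<langle>t\<^sub>1, \<dots>, t\<^bsub>b-1\<^esub>\<rangle>\<close>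
  (\<open>Gnk_iso\<close>). The isomorphism carries \<open>\<phi>\<close> to the shift \<open>t\<^sub>i \<mapsto> t\<^bsub>i+1\<^esub>\<close> and hence induces an
  isomorphism of HNN extensions (\<open>hnn_extension_iso\<close>). Finally \<open>\<langle>t\<^bsub>k+1\<^esub>, \<dots>, t\<^bsub>n-k\<^esub>\<rangle>\<close> is central and
  elementary abelian and contains all commutators of generators, so it contains all squares and
  the fourth power of every element is trivial (\<open>exponent_four\<close>).\<close>


section \<open>Homomorphisms out of presented monoids\<close>

text \<open>The default rules for \<^const>\<open>lists\<close> trade \<open>w \<in> lists A\<close> for a statement about all letters of \<open>w\<close>,
  which the lemmas below do not match.\<close>

declare in_listsD [rule del] in_listsI [rule del]

lemma iso_of_inverse_homs:
  assumes "h \<in> hom A B" "h' \<in> hom B A"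
    and "\<And>x. x \<in> carrier A \<Longrightarrow> h' (h x) = x" "\<And>y. y \<in> carrier B \<Longrightarrow> h (h' y) = y"
  shows "h \<in> iso A B"
proof -
  have "h ` carrier A \<subseteq> carrier B" "h' ` carrier B \<subseteq> carrier A"
    using assms(1,2) by (auto simp: hom_in_carrier)
  then have "bij_betw h (carrier A) (carrier B)"
    using assms(3,4) by (intro bij_betw_byWitness[where f' = h']) auto
  then show ?thesis using assms(1) by (simp add: iso_def)
qed

locale presentation =
  fixes A :: "'a set" and R :: "('a list \<times> 'a list) set"
  assumes rels: "R \<subseteq> lists A \<times> lists A"
begin

lemma word_cong_lists: "word_cong A R u v \<Longrightarrow> u \<in> lists A \<and> v \<in> lists A"
  by (induction rule: word_cong.induct) (use rels in auto)

lemma word_cong_append_left: "word_cong A R u v \<Longrightarrow> w \<in> lists A \<Longrightarrow> word_cong A R (w @ u) (w @ v)"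
proof (induction rule: word_cong.induct)
  case (rel r s u v)
  then show ?case using word_cong.rel[OF rel(1), where u = "w @ u" and v = v] by simp
next
  case (refl v)
  then show ?case by (simp add: word_cong.refl)
next
  case (sym u v)
  then show ?case by (simp add: word_cong.sym)
next
  case (trans u v x)
  then show ?case by (metis word_cong.trans)
qed

lemma word_cong_append_right: "word_cong A R u v \<Longrightarrow> w \<in> lists A \<Longrightarrow> word_cong A R (u @ w) (v @ w)"
proof (induction rule: word_cong.induct)
  case (rel r s u v)
  then show ?case using word_cong.rel[OF rel(1), where u = u and v = "v @ w"] by simp
next
  case (refl v)
  then show ?case by (simp add: word_cong.refl)
next
  case (sym u v)
  then show ?case by (simp add: word_cong.sym)
next
  case (trans u v x)
  then show ?case by (metis word_cong.trans)
qed

lemma word_cong_append: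
  "word_cong A R u u' \<Longrightarrow> word_cong A R v v' \<Longrightarrow> word_cong A R (u @ v) (u' @ v')"
  by (meson word_cong.trans word_cong_append_left word_cong_append_right word_cong_lists)

lemma word_cong_rel: "(r, s) \<in> R \<Longrightarrow> word_cong A R r s"
  using word_cong.rel[where u = "[]" and v = "[]"] by simp

lemma word_class_eq_iff:
  "u \<in> lists A \<Longrightarrow> word_class A R u = word_class A R v \<longleftrightarrow> word_cong A R u v"
  unfolding word_class_def
  by (metis (mono_tags, lifting) Collect_cong mem_Collect_eq word_cong.refl word_cong.sym word_cong.trans)

lemma word_class_rel: "(r, s) \<in> R \<Longrightarrow> word_class A R r = word_class A R s"
  using word_cong_rel word_cong_lists word_class_eq_iff by blast

lemma carrier_presented: "carrier (presented_monoid A R) = word_class A R ` lists A"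
  by (simp add: presented_monoid_def)

lemma one_presented: "\<one>\<^bsub>presented_monoid A R\<^esub> = word_class A R []"
  by (simp add: presented_monoid_def)

lemma word_class_closed: "w \<in> lists A \<Longrightarrow> word_class A R w \<in> carrier (presented_monoid A R)"
  by (simp add: carrier_presented)

lemma mult_presented:
  assumes "u \<in> lists A" "v \<in> lists A"
  shows "word_class A R u \<otimes>\<^bsub>presented_monoid A R\<^esub> word_class A R v = word_class A R (u @ v)"
proof -
  have "word_class A R (u' @ v') = word_class A R (u @ v)"
    if "u' \<in> word_class A R u" "v' \<in> word_class A R v" for u' v'
  proof -
    have "word_cong A R (u @ v) (u' @ v')"
      using that unfolding word_class_def by (intro word_cong_append) simp_all
    then show ?thesis using assms word_class_eq_iff[of "u @ v" "u' @ v'"] by simp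
  qed
  moreover have "u \<in> word_class A R u" "v \<in> word_class A R v"
    using assms by (simp_all add: word_class_def word_cong.refl)
  ultimately have "(\<Union>u'\<in>word_class A R u. \<Union>v'\<in>word_class A R v. word_class A R (u' @ v')) =
      word_class A R (u @ v)"
    by (metis (no_types, lifting) SUP_eq_const empty_iff)
  then show ?thesis unfolding presented_monoid_def by simp
qed

lemma presented_monoid_monoid: "Group.monoid (presented_monoid A R)"
  by (rule monoidI) (auto simp: carrier_presented one_presented mult_presented)

text \<open>The inverse of a word is the concatenation, in reverse order, of inverses of its letters, so it
  suffices to invert single letters.\<close>

lemma presented_monoid_group:
  assumes inv: "\<And>a. a \<in> A \<Longrightarrow> \<exists>b\<in>lists A. word_cong A R (b @ [a]) []"
  shows "group (presented_monoid A R)"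
proof -
  interpret M: Group.monoid "presented_monoid A R" by (rule presented_monoid_monoid)
  have "\<exists>v\<in>lists A. word_cong A R (v @ w) []" if "w \<in> lists A" for w
    using that
  proof (induction w rule: rev_induct)
    case Nil
    then show ?case by (auto intro: word_cong.refl)
  next
    case (snoc a w)
    then obtain v where v: "v \<in> lists A" "word_cong A R (v @ w) []" by auto
    obtain b where b: "b \<in> lists A" "word_cong A R (b @ [a]) []" using inv snoc by auto
    have "word_cong A R (b @ (v @ w) @ [a]) (b @ [] @ [a])"
      using snoc v b by (intro word_cong_append_left word_cong_append_right) auto
    then have "word_cong A R ((b @ v) @ (w @ [a])) (b @ [a])" by simp
    then have "word_cong A R ((b @ v) @ (w @ [a])) []" using b(2) by (rule word_cong.trans)
    moreover have "b @ v \<in> lists A" using v b by simp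
    ultimately show ?case by (rule bexI)
  qed
  note l_inv = this
  show ?thesis
  proof (rule M.group_l_invI)
    fix U assume "U \<in> carrier (presented_monoid A R)"
    then obtain w where w: "w \<in> lists A" "U = word_class A R w" unfolding carrier_presented by blast
    obtain v where v: "v \<in> lists A" "word_cong A R (v @ w) []" using l_inv[OF w(1)] by blast
    then have "word_class A R (v @ w) = word_class A R []"
      using word_class_eq_iff w(1) by simp
    then have "word_class A R v \<otimes>\<^bsub>presented_monoid A R\<^esub> U = \<one>\<^bsub>presented_monoid A R\<^esub>"
      using v(1) w by (simp only: mult_presented one_presented)
    then show "\<exists>Y\<in>carrier (presented_monoid A R).
        Y \<otimes>\<^bsub>presented_monoid A R\<^esub> U = \<one>\<^bsub>presented_monoid A R\<^esub>"
      using word_class_closed[OF v(1)] by blast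
  qed
qed

text \<open>The universal property: evaluation of words under \<open>f\<close> respects the relations, so it descends to
  the classes.\<close>

lemma presented_monoid_hom:
  assumes "Group.monoid M" and f: "\<And>a. a \<in> A \<Longrightarrow> f a \<in> carrier M"
    and rel: "\<And>r s. (r, s) \<in> R \<Longrightarrow>
      foldr (\<lambda>a x. f a \<otimes>\<^bsub>M\<^esub> x) r \<one>\<^bsub>M\<^esub> = foldr (\<lambda>a x. f a \<otimes>\<^bsub>M\<^esub> x) s \<one>\<^bsub>M\<^esub>"
  shows "\<exists>h\<in>hom (presented_monoid A R) M. \<forall>w\<in>lists A.
    h (word_class A R w) = foldr (\<lambda>a x. f a \<otimes>\<^bsub>M\<^esub> x) w \<one>\<^bsub>M\<^esub>"
proof -
  interpret M: Group.monoid M by (rule assms(1))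
  define ev where "ev w = foldr (\<lambda>a x. f a \<otimes>\<^bsub>M\<^esub> x) w \<one>\<^bsub>M\<^esub>" for w
  have ev_closed: "ev w \<in> carrier M" if "w \<in> lists A" for w
    using that unfolding ev_def by (induction w) (auto simp: f)
  have ev_append: "ev (u @ v) = ev u \<otimes>\<^bsub>M\<^esub> ev v" if "u \<in> lists A" "v \<in> lists A" for u v
    using that(1)
  proof (induction u)
    case Nil
    then show ?case using ev_closed[OF that(2)] by (simp add: ev_def)
  next
    case (Cons a u)
    then show ?case using ev_closed[of u] ev_closed[OF that(2)] f
      by (simp add: ev_def M.m_assoc)
  qed
  have ev_cong: "ev u = ev v" if "word_cong A R u v" for u v
    using that
  proof (induction rule: word_cong.induct)
    case (rel r s u v)
    have "r \<in> lists A" "s \<in> lists A" using rel(1) rels by auto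
    then show ?case using rel assms(3)[OF rel(1)] by (simp add: ev_append) (simp add: ev_def)
  qed auto
  define h where "h U = ev (SOME u. u \<in> U)" for U
  have h: "h (word_class A R w) = ev w" if "w \<in> lists A" for w
  proof -
    have "w \<in> word_class A R w" using that by (simp add: word_class_def word_cong.refl)
    then have "(SOME u. u \<in> word_class A R w) \<in> word_class A R w" by (rule someI)
    then show ?thesis unfolding h_def using ev_cong by (simp add: word_class_def)
  qed
  have "h \<in> hom (presented_monoid A R) M"
    by (rule homI) (auto simp: carrier_presented mult_presented h ev_closed ev_append)
  then show ?thesis using h unfolding ev_def by blast
qed

lemma word_class_foldr:
  "w \<in> lists A \<Longrightarrow> foldr (\<lambda>a x. word_class A R [a] \<otimes>\<^bsub>presented_monoid A R\<^esub> x) w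
     \<one>\<^bsub>presented_monoid A R\<^esub> = word_class A R w"
  by (induction w) (auto simp: one_presented mult_presented)

end


lemma foldr_map_letters:
  "foldr (\<lambda>a x. f (g a) \<otimes>\<^bsub>M\<^esub> x) w z = foldr (\<lambda>a x. f a \<otimes>\<^bsub>M\<^esub> x) (map g w) z"
  by (induction w) auto

lemma presented_monoid_map:
  assumes P: "presentation A R" and P': "presentation A' R'"
    and g: "\<And>a. a \<in> A \<Longrightarrow> g a \<in> A'"
    and rel: "\<And>r s. (r, s) \<in> R \<Longrightarrow> (map g r, map g s) \<in> R'"
  shows "\<exists>h\<in>hom (presented_monoid A R) (presented_monoid A' R').
    \<forall>w\<in>lists A. h (word_class A R w) = word_class A' R' (map g w)"
proof -
  interpret P: presentation A R by (rule P)
  interpret P': presentation A' R' by (rule P')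
  let ?M = "presented_monoid A' R'"
  let ?f = "\<lambda>a. word_class A' R' [g a]"
  have mapl: "map g w \<in> lists A'" if "w \<in> lists A" for w
    using that by (induction w) (auto simp: g)
  have ev: "foldr (\<lambda>a x. ?f a \<otimes>\<^bsub>?M\<^esub> x) w \<one>\<^bsub>?M\<^esub> = word_class A' R' (map g w)" if "w \<in> lists A" for w
    using P'.word_class_foldr[OF mapl[OF that]] 
    by (simp only: foldr_map_letters[where f = "\<lambda>a. word_class A' R' [a]" and g = g])
  have "\<exists>h\<in>hom (presented_monoid A R) ?M. \<forall>w\<in>lists A.
      h (word_class A R w) = foldr (\<lambda>a x. ?f a \<otimes>\<^bsub>?M\<^esub> x) w \<one>\<^bsub>?M\<^esub>"
  proof (rule P.presented_monoid_hom[OF P'.presented_monoid_monoid])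
    fix r s assume rs: "(r, s) \<in> R"
    then have "r \<in> lists A" "s \<in> lists A" using P.rels by auto
    then show "foldr (\<lambda>a x. ?f a \<otimes>\<^bsub>?M\<^esub> x) r \<one>\<^bsub>?M\<^esub> = foldr (\<lambda>a x. ?f a \<otimes>\<^bsub>?M\<^esub> x) s \<one>\<^bsub>?M\<^esub>"
      using P'.word_class_rel[OF rel[OF rs]] by (simp only: ev)
  next
    fix a assume "a \<in> A"
    then show "?f a \<in> carrier ?M" by (intro P'.word_class_closed) (simp add: g)
  qed
  then obtain h where h: "h \<in> hom (presented_monoid A R) ?M"
    "\<forall>w\<in>lists A. h (word_class A R w) = foldr (\<lambda>a x. ?f a \<otimes>\<^bsub>?M\<^esub> x) w \<one>\<^bsub>?M\<^esub>" ..
  have "h (word_class A R w) = word_class A' R' (map g w)" if "w \<in> lists A" for w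
    using bspec[OF h(2) that] ev[OF that] by (rule HOL.trans)
  then show ?thesis using h(1) by blast
qed


section \<open>Free groups\<close>

lemma presentation_free_group: "presentation (S \<times> UNIV) (free_group_rels S)"
  by unfold_locales (auto simp: free_group_rels_def)

lemma free_group_relsI: "s \<in> S \<Longrightarrow> ([(s, b), (s, \<not> b)], []) \<in> free_group_rels S"
  unfolding free_group_rels_def by blast

lemma free_group_group: "group (free_group S)"
proof -
  interpret P: presentation "S \<times> UNIV" "free_group_rels S" by (rule presentation_free_group)
  show ?thesis unfolding free_group_def
  proof (rule P.presented_monoid_group)
    fix a assume "a \<in> S \<times> (UNIV :: bool set)"
    then obtain s b where a: "a = (s, b)" "s \<in> S" by auto
    then have "([(s, \<not> b), (s, b)], []) \<in> free_group_rels S"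
      using free_group_relsI[of s S "\<not> b"] by simp
    then have "word_cong (S \<times> UNIV) (free_group_rels S) ([(s, \<not> b)] @ [a]) []"
      using P.word_cong_rel a by simp
    moreover have "[(s, \<not> b)] \<in> lists (S \<times> UNIV)" using a by simp
    ultimately show "\<exists>b\<in>lists (S \<times> UNIV). word_cong (S \<times> UNIV) (free_group_rels S) (b @ [a]) []"
      by blast
  qed
qed

lemma free_gen_closed: "s \<in> S \<Longrightarrow> free_gen S s \<in> carrier (free_group S)"
  unfolding free_group_def free_gen_def
  by (rule presentation.word_class_closed[OF presentation_free_group]) simp

lemma free_group_inverse_letter:
  assumes "s \<in> S"
  shows "word_class (S \<times> UNIV) (free_group_rels S) [(s, False)] = inv\<^bsub>free_group S\<^esub> (free_gen S s)"
proof -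
  interpret P: presentation "S \<times> UNIV" "free_group_rels S" by (rule presentation_free_group)
  interpret F: group "free_group S" by (rule free_group_group)
  let ?c = "word_class (S \<times> UNIV) (free_group_rels S)"
  have "([(s, False), (s, True)], []) \<in> free_group_rels S"
    using free_group_relsI[OF assms, of False] by simp
  then have "?c [(s, False), (s, True)] = ?c []" by (rule P.word_class_rel)
  then have "?c [(s, False)] \<otimes>\<^bsub>free_group S\<^esub> free_gen S s = \<one>\<^bsub>free_group S\<^esub>"
    using assms P.mult_presented[of "[(s, False)]" "[(s, True)]"] P.one_presented
    by (simp add: free_group_def free_gen_def)
  moreover have "?c [(s, False)] \<in> carrier (free_group S)"
    using P.word_class_closed assms by (simp add: free_group_def)
  ultimately show ?thesis by (intro F.inv_equality[symmetric] free_gen_closed[OF assms])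
qed

lemma free_group_generate: "carrier (free_group S) \<subseteq> generate (free_group S) (free_gen S ` S)"
proof
  interpret P: presentation "S \<times> UNIV" "free_group_rels S" by (rule presentation_free_group)
  interpret F: group "free_group S" by (rule free_group_group)
  let ?c = "word_class (S \<times> UNIV) (free_group_rels S)"
  fix U assume "U \<in> carrier (free_group S)"
  then obtain w where w: "w \<in> lists (S \<times> UNIV)" "U = ?c w"
    unfolding free_group_def P.carrier_presented by blast
  have "?c w \<in> generate (free_group S) (free_gen S ` S)" using w(1)
  proof (induction w)
    case Nil
    then show ?case
      using generate.one[of "free_group S"] by (simp add: free_group_def P.one_presented)
  next
    case (Cons a w)
    obtain s b where a: "a = (s, b)" "s \<in> S" using Cons by (cases a) auto
    have 1: "?c [a] \<in> generate (free_group S) (free_gen S ` S)"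
    proof (cases b)
      case True
      then show ?thesis using a generate.incl[of "free_gen S s" "free_gen S ` S" "free_group S"]
        by (simp add: free_gen_def)
    next
      case False
      then show ?thesis using a free_group_inverse_letter[OF a(2)]
          generate.inv[of "free_gen S s" "free_gen S ` S" "free_group S"] by simp
    qed
    have "?c (a # w) = ?c [a] \<otimes>\<^bsub>free_group S\<^esub> ?c w"
      using P.mult_presented[of "[a]" w] Cons by (simp add: free_group_def)
    then show ?case using generate.eng[OF 1] Cons by simp
  qed
  then show "U \<in> generate (free_group S) (free_gen S ` S)" using w by simp
qed

lemma free_group_hom:
  assumes "group K" and f: "\<And>s. s \<in> S \<Longrightarrow> f s \<in> carrier K"
  shows "\<exists>h\<in>hom (free_group S) K. \<forall>s\<in>S. h (free_gen S s) = f s"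
proof -
  interpret P: presentation "S \<times> UNIV" "free_group_rels S" by (rule presentation_free_group)
  interpret K: group K by (rule assms(1))
  define g where "g = (\<lambda>(s, b). if b then f s else inv\<^bsub>K\<^esub> (f s))"
  have "\<exists>h\<in>hom (presented_monoid (S \<times> UNIV) (free_group_rels S)) K. \<forall>w\<in>lists (S \<times> UNIV).
      h (word_class (S \<times> UNIV) (free_group_rels S) w) = foldr (\<lambda>a x. g a \<otimes>\<^bsub>K\<^esub> x) w \<one>\<^bsub>K\<^esub>"
  proof (rule P.presented_monoid_hom[OF K.is_monoid])
    fix r s assume "(r, s) \<in> free_group_rels S"
    then show "foldr (\<lambda>a x. g a \<otimes>\<^bsub>K\<^esub> x) r \<one>\<^bsub>K\<^esub> = foldr (\<lambda>a x. g a \<otimes>\<^bsub>K\<^esub> x) s \<one>\<^bsub>K\<^esub>"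
      unfolding free_group_rels_def g_def using f by auto
  next
    fix a assume "a \<in> S \<times> (UNIV :: bool set)"
    then show "g a \<in> carrier K" unfolding g_def using f by auto
  qed
  then obtain h where h: "h \<in> hom (presented_monoid (S \<times> UNIV) (free_group_rels S)) K"
    "\<forall>w\<in>lists (S \<times> UNIV).
      h (word_class (S \<times> UNIV) (free_group_rels S) w) = foldr (\<lambda>a x. g a \<otimes>\<^bsub>K\<^esub> x) w \<one>\<^bsub>K\<^esub>" ..
  have "h (free_gen S s) = f s" if "s \<in> S" for s
    using bspec[OF h(2), of "[(s, True)]"] that f by (simp add: free_gen_def g_def)
  then show ?thesis using h(1) unfolding free_group_def by blast
qed


section \<open>Free products\<close>

lemma presentation_free_product:
  assumes "Group.monoid G" "Group.monoid H"
  shows "presentation (carrier G <+> carrier H) (free_product_rels G H)"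
proof -
  interpret G: Group.monoid G by (rule assms)
  interpret H: Group.monoid H by (rule assms)
  show ?thesis by unfold_locales (auto simp: free_product_rels_def)
qed

lemma free_product_relsI:
  "([Inl \<one>\<^bsub>G\<^esub>], []) \<in> free_product_rels G H"
  "([Inr \<one>\<^bsub>H\<^esub>], []) \<in> free_product_rels G H"
  "a \<in> carrier G \<Longrightarrow> b \<in> carrier G \<Longrightarrow> ([Inl a, Inl b], [Inl (a \<otimes>\<^bsub>G\<^esub> b)]) \<in> free_product_rels G H"
  "c \<in> carrier H \<Longrightarrow> d \<in> carrier H \<Longrightarrow> ([Inr c, Inr d], [Inr (c \<otimes>\<^bsub>H\<^esub> d)]) \<in> free_product_rels G H"
  unfolding free_product_rels_def by blast+

lemma free_product_group:
  assumes "group G" "group H"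
  shows "group (free_product G H)"
proof -
  interpret G: group G by (rule assms)
  interpret H: group H by (rule assms)
  interpret P: presentation "carrier G <+> carrier H" "free_product_rels G H"
    by (rule presentation_free_product) unfold_locales
  let ?A = "carrier G <+> carrier H"
  let ?R = "free_product_rels G H"
  show ?thesis unfolding free_product_def
  proof (rule P.presented_monoid_group)
    fix a assume "a \<in> ?A"
    then show "\<exists>b\<in>lists ?A. word_cong ?A ?R (b @ [a]) []"
    proof (rule PlusE)
      fix x assume x: "a = Inl x" "x \<in> carrier G"
      have "word_cong ?A ?R [Inl (inv\<^bsub>G\<^esub> x), Inl x] [Inl (inv\<^bsub>G\<^esub> x \<otimes>\<^bsub>G\<^esub> x)]"
        using x by (intro P.word_cong_rel free_product_relsI G.inv_closed)
      also have "inv\<^bsub>G\<^esub> x \<otimes>\<^bsub>G\<^esub> x = \<one>\<^bsub>G\<^esub>" using x by simp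
      finally have "word_cong ?A ?R [Inl (inv\<^bsub>G\<^esub> x), Inl x] []"
        by (rule word_cong.trans) (intro P.word_cong_rel free_product_relsI)
      then show ?thesis using x by (intro bexI[of _ "[Inl (inv\<^bsub>G\<^esub> x)]"]) (simp_all add: InlI)
    next
      fix x assume x: "a = Inr x" "x \<in> carrier H"
      have "word_cong ?A ?R [Inr (inv\<^bsub>H\<^esub> x), Inr x] [Inr (inv\<^bsub>H\<^esub> x \<otimes>\<^bsub>H\<^esub> x)]"
        using x by (intro P.word_cong_rel free_product_relsI H.inv_closed)
      also have "inv\<^bsub>H\<^esub> x \<otimes>\<^bsub>H\<^esub> x = \<one>\<^bsub>H\<^esub>" using x by simp
      finally have "word_cong ?A ?R [Inr (inv\<^bsub>H\<^esub> x), Inr x] []"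
        by (rule word_cong.trans) (intro P.word_cong_rel free_product_relsI)
      then show ?thesis using x by (intro bexI[of _ "[Inr (inv\<^bsub>H\<^esub> x)]"]) (simp_all add: InrI)
    qed
  qed
qed

lemma free_product_inl_closed:
  assumes "group G" "group H" "a \<in> carrier G"
  shows "free_product_inl G H a \<in> carrier (free_product G H)"
  using presentation.word_class_closed[OF presentation_free_product, of G H "[Inl a]"] assms
  by (simp add: free_product_inl_def free_product_def group.is_monoid InlI)

lemma free_product_inr_closed:
  assumes "group G" "group H" "b \<in> carrier H"
  shows "free_product_inr G H b \<in> carrier (free_product G H)"
  using presentation.word_class_closed[OF presentation_free_product, of G H "[Inr b]"] assms
  by (simp add: free_product_inr_def free_product_def group.is_monoid InrI)

text \<open>A free product is functorial in its first factor, because a homomorphism of that factor maps the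
  relations of the presentation to relations; the maps induced by \<open>\<theta>\<close> and its inverse are mutually inverse.\<close>

lemma free_product_iso:
  assumes G: "group G" and G': "group G'" and H: "group H" and iso: "\<theta> \<in> iso G G'"
  obtains h where "h \<in> iso (free_product G H) (free_product G' H)"
    "\<And>a. a \<in> carrier G \<Longrightarrow> h (free_product_inl G H a) = free_product_inl G' H (\<theta> a)"
    "\<And>b. b \<in> carrier H \<Longrightarrow> h (free_product_inr G H b) = free_product_inr G' H b"
proof -
  interpret G: group G by (rule G)
  interpret G': group G' by (rule G')
  interpret H: group H by (rule H)
  interpret P: presentation "carrier G <+> carrier H" "free_product_rels G H"
    by (rule presentation_free_product) unfold_locales
  interpret P': presentation "carrier G' <+> carrier H" "free_product_rels G' H"
    by (rule presentation_free_product) unfold_locales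
  let ?A = "carrier G <+> carrier H" and ?R = "free_product_rels G H"
  let ?A' = "carrier G' <+> carrier H" and ?R' = "free_product_rels G' H"
  define \<theta>' where "\<theta>' = inv_into (carrier G) \<theta>"
  have iso': "\<theta>' \<in> iso G' G" unfolding \<theta>'_def by (rule G.iso_set_sym[OF iso])
  have bij: "bij_betw \<theta> (carrier G) (carrier G')" using iso by (simp add: iso_def)
  have inv1: "\<theta>' (\<theta> a) = a" if "a \<in> carrier G" for a
    using that bij unfolding \<theta>'_def by (simp add: bij_betw_inv_into_left)
  have inv2: "\<theta> (\<theta>' a) = a" if "a \<in> carrier G'" for a
    using that bij unfolding \<theta>'_def by (simp add: bij_betw_inv_into_right)
  interpret h: group_hom G G' \<theta> using iso by unfold_locales (simp add: iso_def)
  interpret h': group_hom G' G \<theta>' using iso' by unfold_locales (simp add: iso_def)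
  let ?g = "map_sum \<theta> id :: 'a + 'e \<Rightarrow> _" and ?g' = "map_sum \<theta>' id :: 'c + 'e \<Rightarrow> _"
  have "\<exists>h\<in>hom (free_product G H) (free_product G' H). \<forall>w\<in>lists ?A.
      h (word_class ?A ?R w) = word_class ?A' ?R' (map ?g w)"
    unfolding free_product_def
    by (rule presented_monoid_map[OF P.presentation_axioms P'.presentation_axioms])
       (auto simp: free_product_rels_def)
  then obtain h where h: "h \<in> hom (free_product G H) (free_product G' H)"
    "\<forall>w\<in>lists ?A. h (word_class ?A ?R w) = word_class ?A' ?R' (map ?g w)" ..
  have "\<exists>h\<in>hom (free_product G' H) (free_product G H). \<forall>w\<in>lists ?A'.
      h (word_class ?A' ?R' w) = word_class ?A ?R (map ?g' w)"
    unfolding free_product_def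
    by (rule presented_monoid_map[OF P'.presentation_axioms P.presentation_axioms])
       (auto simp: free_product_rels_def)
  then obtain h' where h': "h' \<in> hom (free_product G' H) (free_product G H)"
    "\<forall>w\<in>lists ?A'. h' (word_class ?A' ?R' w) = word_class ?A ?R (map ?g' w)" ..
  have map1: "map ?g' (map ?g w) = w" if "w \<in> lists ?A" for w
    using that by (induction w) (auto simp: inv1)
  have map2: "map ?g (map ?g' w) = w" if "w \<in> lists ?A'" for w
    using that by (induction w) (auto simp: inv2)
  have l1: "map ?g w \<in> lists ?A'" if "w \<in> lists ?A" for w
    using that by (induction w) auto
  have l2: "map ?g' w \<in> lists ?A" if "w \<in> lists ?A'" for w
    using that by (induction w) auto
  have "h \<in> iso (free_product G H) (free_product G' H)"
  proof (rule iso_of_inverse_homs[OF h(1) h'(1)])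
    fix U assume "U \<in> carrier (free_product G H)"
    then obtain w where w: "w \<in> lists ?A" "U = word_class ?A ?R w"
      unfolding free_product_def P.carrier_presented by blast
    then show "h' (h U) = U" using bspec[OF h(2) w(1)] bspec[OF h'(2) l1[OF w(1)]] map1[OF w(1)] by (simp only:)
  next
    fix U assume "U \<in> carrier (free_product G' H)"
    then obtain w where w: "w \<in> lists ?A'" "U = word_class ?A' ?R' w"
      unfolding free_product_def P'.carrier_presented by blast
    then show "h (h' U) = U" using bspec[OF h'(2) w(1)] bspec[OF h(2) l2[OF w(1)]] map2[OF w(1)] by (simp only:)
  qed
  moreover have "h (free_product_inl G H a) = free_product_inl G' H (\<theta> a)" if "a \<in> carrier G" for a
    using bspec[OF h(2), of "[Inl a]"] that by (simp add: free_product_inl_def InlI)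
  moreover have "h (free_product_inr G H b) = free_product_inr G' H b" if "b \<in> carrier H" for b
    using bspec[OF h(2), of "[Inr b]"] that by (simp add: free_product_inr_def InrI)
  ultimately show thesis using that by blast
qed


section \<open>Normal closures and quotients\<close>

lemma normal_closure_incl: "R \<subseteq> normal_closure G R"
  unfolding normal_closure_def by blast

lemma normal_closure_least: "N \<lhd> G \<Longrightarrow> R \<subseteq> N \<Longrightarrow> normal_closure G R \<subseteq> N"
  unfolding normal_closure_def by blast

lemma normal_closure_normal:
  assumes "group G" "R \<subseteq> carrier G"
  shows "normal_closure G R \<lhd> G"
proof -
  interpret G: group G by (rule assms(1))
  have "subgroup (carrier G) G" by (rule G.subgroup_self)
  then have car: "carrier G \<lhd> G" by (rule G.normal_invI) auto
  then have ne: "{N. N \<lhd> G \<and> R \<subseteq> N} \<noteq> {}" using assms(2) by blast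
  show ?thesis
  proof (rule G.normal_invI)
    show "subgroup (normal_closure G R) G"
      unfolding normal_closure_def using ne
      by (intro G.subgroups_Inter) (auto simp: normal_imp_subgroup)
    fix x h assume "x \<in> carrier G" "h \<in> normal_closure G R"
    then show "x \<otimes>\<^bsub>G\<^esub> h \<otimes>\<^bsub>G\<^esub> inv\<^bsub>G\<^esub> x \<in> normal_closure G R"
      unfolding normal_closure_def by (auto intro: normal.inv_op_closed2)
  qed
qed

lemma quotient_hom:
  assumes N: "N \<lhd> F" and K: "group K" and h: "h \<in> hom F K" and ker: "N \<subseteq> kernel F K h"
  obtains k where "k \<in> hom (F Mod N) K" "\<And>x. x \<in> carrier F \<Longrightarrow> k (N #>\<^bsub>F\<^esub> x) = h x"
proof -
  interpret N: normal N F by (rule N)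
  interpret K: group K by (rule K)
  interpret h: group_hom F K h using h by unfold_locales
  define k where "k U = h (SOME x. x \<in> U)" for U
  have k: "k (N #>\<^bsub>F\<^esub> x) = h x" if x: "x \<in> carrier F" for x
  proof -
    have "x \<in> N #>\<^bsub>F\<^esub> x" using x N.subgroup_axioms by (rule N.rcos_self)
    then have "(SOME y. y \<in> N #>\<^bsub>F\<^esub> x) \<in> N #>\<^bsub>F\<^esub> x" by (rule someI)
    then obtain m where m: "m \<in> N" "(SOME y. y \<in> N #>\<^bsub>F\<^esub> x) = m \<otimes>\<^bsub>F\<^esub> x"
      unfolding r_coset_def by blast
    have "m \<in> carrier F" "h m = \<one>\<^bsub>K\<^esub>" using m(1) ker by (auto simp: kernel_def)
    then show ?thesis unfolding k_def m(2) using x by simp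
  qed
  have "k \<in> hom (F Mod N) K"
  proof (rule homI)
    fix U assume "U \<in> carrier (F Mod N)"
    then obtain x where "x \<in> carrier F" "U = N #>\<^bsub>F\<^esub> x" by (auto simp: FactGroup_def RCOSETS_def)
    then show "k U \<in> carrier K" using k by simp
    fix V assume "V \<in> carrier (F Mod N)"
    then obtain y where "y \<in> carrier F" "V = N #>\<^bsub>F\<^esub> y" by (auto simp: FactGroup_def RCOSETS_def)
    then show "k (U \<otimes>\<^bsub>F Mod N\<^esub> V) = k U \<otimes>\<^bsub>K\<^esub> k V"
      using \<open>x \<in> carrier F\<close> \<open>U = _\<close> k by (simp add: N.rcos_sum)
  qed
  then show thesis using that k by blast
qed

lemma coset_hom: "N \<lhd> F \<Longrightarrow> (\<lambda>x. N #>\<^bsub>F\<^esub> x) \<in> hom F (F Mod N)"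
  by (rule normal.r_coset_hom_Mod)

lemma FactGroup_carrier: "carrier (F Mod N) = (\<lambda>x. N #>\<^bsub>F\<^esub> x) ` carrier F"
  by (auto simp: FactGroup_def RCOSETS_def)

text \<open>The universal property of a group given by relators: the kernel of \<open>h\<close> is a normal subgroup
  containing the relators.\<close>

lemma normal_closure_quotient_hom:
  assumes F: "group F" and R: "R \<subseteq> carrier F" and K: "group K" and h: "h \<in> hom F K"
    and rel: "\<And>r. r \<in> R \<Longrightarrow> h r = \<one>\<^bsub>K\<^esub>"
  obtains k where "k \<in> hom (F Mod normal_closure F R) K"
    "\<And>x. x \<in> carrier F \<Longrightarrow> k (normal_closure F R #>\<^bsub>F\<^esub> x) = h x"
proof -
  interpret h: group_hom F K h using F K h by (simp add: group_hom_def group_hom_axioms_def)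
  have "normal_closure F R \<subseteq> kernel F K h"
    by (rule normal_closure_least[OF h.normal_kernel]) (use R rel in \<open>auto simp: kernel_def\<close>)
  then show thesis using that quotient_hom[OF normal_closure_normal[OF F R] K h] by blast
qed

lemma quotient_normal_closure_iso:
  assumes F: "group F" and F': "group F'" and h: "h \<in> iso F F'" and R: "R \<subseteq> carrier F"
  shows "F Mod normal_closure F R \<cong> F' Mod normal_closure F' (h ` R)"
proof -
  interpret F: group F by (rule F)
  define h' where "h' = inv_into (carrier F) h"
  have iso': "h' \<in> iso F' F" unfolding h'_def by (rule F.iso_set_sym[OF h])
  have bij: "bij_betw h (carrier F) (carrier F')" using h by (simp add: iso_def)
  have inv1: "h' (h a) = a" if "a \<in> carrier F" for a
    using that bij unfolding h'_def by (simp add: bij_betw_inv_into_left)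
  have inv2: "h (h' a) = a" if "a \<in> carrier F'" for a
    using that bij unfolding h'_def by (simp add: bij_betw_inv_into_right)
  have hom: "h \<in> hom F F'" "h' \<in> hom F' F" using h iso' by (auto simp: iso_def)
  have R': "h ` R \<subseteq> carrier F'" using R hom(1) by (auto simp: hom_def)
  let ?N = "normal_closure F R" and ?N' = "normal_closure F' (h ` R)"
  have N: "?N \<lhd> F" and N': "?N' \<lhd> F'" using normal_closure_normal F F' R R' by auto
  interpret Q: group "F Mod ?N" using N by (rule normal.factorgroup_is_group)
  interpret Q': group "F' Mod ?N'" using N' by (rule normal.factorgroup_is_group)
  have one: "?N #>\<^bsub>F\<^esub> r = \<one>\<^bsub>F Mod ?N\<^esub>" if "r \<in> R" for r
    using that normal_closure_incl[of R F] N F.coset_join2[of r ?N] R normal_imp_subgroup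
    by (auto simp: FactGroup_def)
  interpret F': group F' by (rule F')
  have one': "?N' #>\<^bsub>F'\<^esub> r = \<one>\<^bsub>F' Mod ?N'\<^esub>" if "r \<in> h ` R" for r
    using that normal_closure_incl[of "h ` R" F'] N' F'.coset_join2[of r ?N'] R' normal_imp_subgroup
    by (auto simp: FactGroup_def)
  obtain k where k: "k \<in> hom (F Mod ?N) (F' Mod ?N')"
    "\<And>x. x \<in> carrier F \<Longrightarrow> k (?N #>\<^bsub>F\<^esub> x) = ?N' #>\<^bsub>F'\<^esub> h x"
    by (rule normal_closure_quotient_hom[OF F R Q'.is_group, of "\<lambda>x. ?N' #>\<^bsub>F'\<^esub> h x"])
       (use one' hom_compose[OF hom(1) coset_hom[OF N']] in \<open>auto simp: comp_def\<close>)
  obtain k' where k': "k' \<in> hom (F' Mod ?N') (F Mod ?N)"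
    "\<And>x. x \<in> carrier F' \<Longrightarrow> k' (?N' #>\<^bsub>F'\<^esub> x) = ?N #>\<^bsub>F\<^esub> h' x"
    by (rule normal_closure_quotient_hom[OF F' R' Q.is_group, of "\<lambda>x. ?N #>\<^bsub>F\<^esub> h' x"])
       (use one inv1 R hom_compose[OF hom(2) coset_hom[OF N]] in \<open>auto simp: comp_def subset_iff\<close>)
  have "k \<in> iso (F Mod ?N) (F' Mod ?N')"
  proof (rule iso_of_inverse_homs[OF k(1) k'(1)])
    fix U assume "U \<in> carrier (F Mod ?N)"
    then obtain x where "x \<in> carrier F" "U = ?N #>\<^bsub>F\<^esub> x" unfolding FactGroup_carrier by blast
    then show "k' (k U) = U" using k k' inv1 hom(1) by (simp add: hom_in_carrier)
  next
    fix U assume "U \<in> carrier (F' Mod ?N')"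
    then obtain x where "x \<in> carrier F'" "U = ?N' #>\<^bsub>F'\<^esub> x" unfolding FactGroup_carrier by blast
    then show "k (k' U) = U" using k k' inv2 hom(2) by (simp add: hom_in_carrier)
  qed
  then show ?thesis by (rule is_isoI)
qed


section \<open>HNN extensions\<close>

text \<open>An isomorphism of base groups that intertwines the associated maps extends to the free products
  with \<open>\<langle>x\<rangle>\<close> by fixing \<open>x\<close>. It then maps the relator of \<open>u\<close> to the relator of \<open>\<theta> u\<close>.\<close>

lemma hnn_extension_iso:
  assumes G: "group G" and G': "group G'" and \<theta>: "\<theta> \<in> iso G G'"
    and H: "H \<subseteq> carrier G" "\<phi> ` H \<subseteq> carrier G" and H': "H' = \<theta> ` H"
    and com: "\<And>u. u \<in> H \<Longrightarrow> \<phi>' (\<theta> u) = \<theta> (\<phi> u)"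
  shows "hnn_extension G H \<phi> \<cong> hnn_extension G' H' \<phi>'"
proof -
  let ?F = "free_product G integer_group" and ?F' = "free_product G' integer_group"
  have Z: "group integer_group" by simp
  have F: "group ?F" by (rule free_product_group[OF G Z])
  have F': "group ?F'" by (rule free_product_group[OF G' Z])
  obtain h where h: "h \<in> iso ?F ?F'"
    "\<And>a. a \<in> carrier G \<Longrightarrow> h (free_product_inl G integer_group a) = free_product_inl G' integer_group (\<theta> a)"
    "\<And>b. b \<in> carrier integer_group \<Longrightarrow> h (free_product_inr G integer_group b) = free_product_inr G' integer_group b"
    using free_product_iso[OF G G' Z \<theta>] by blast
  interpret h: group_hom ?F ?F' h using F F' h(1)
    by (simp add: group_hom_def group_hom_axioms_def iso_def)
  define \<iota> where "\<iota> = free_product_inl G integer_group"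
  define \<iota>' where "\<iota>' = free_product_inl G' integer_group"
  define x where "x = free_product_inr G integer_group 1"
  define x' where "x' = free_product_inr G' integer_group 1"
  have hx: "h x = x'" "x \<in> carrier ?F" unfolding x_def x'_def using h(3) free_product_inr_closed[OF G Z] by auto
  have h\<iota>: "h (\<iota> a) = \<iota>' (\<theta> a)" "\<iota> a \<in> carrier ?F" if "a \<in> carrier G" for a
    unfolding \<iota>_def \<iota>'_def using that h(2) free_product_inl_closed[OF G Z] by auto
  define rel where "rel u = \<iota> (\<phi> u) \<otimes>\<^bsub>?F\<^esub> inv\<^bsub>?F\<^esub> (x \<otimes>\<^bsub>?F\<^esub> \<iota> u \<otimes>\<^bsub>?F\<^esub> inv\<^bsub>?F\<^esub> x)" for u
  define rel' where "rel' u = \<iota>' (\<phi>' u) \<otimes>\<^bsub>?F'\<^esub> inv\<^bsub>?F'\<^esub> (x' \<otimes>\<^bsub>?F'\<^esub> \<iota>' u \<otimes>\<^bsub>?F'\<^esub> inv\<^bsub>?F'\<^esub> x')" for u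
  have rels: "hnn_relators G H \<phi> = rel ` H" "hnn_relators G' H' \<phi>' = rel' ` H'"
    unfolding hnn_relators_def Let_def rel_def rel'_def x_def x'_def \<iota>_def \<iota>'_def by auto
  have car: "rel u \<in> carrier ?F" if "u \<in> H" for u
  proof -
    have "u \<in> carrier G" "\<phi> u \<in> carrier G" using that H by auto
    then show ?thesis unfolding rel_def using hx h\<iota> by simp
  qed
  have "h (rel u) = rel' (\<theta> u)" if "u \<in> H" for u
  proof -
    have "u \<in> carrier G" "\<phi> u \<in> carrier G" using that H by auto
    then show ?thesis unfolding rel_def rel'_def using hx h\<iota> com[OF that] by simp
  qed
  then have "h ` hnn_relators G H \<phi> = hnn_relators G' H' \<phi>'"
    unfolding rels unfolding H' image_image by (intro image_cong HOL.refl)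
  moreover have "hnn_relators G H \<phi> \<subseteq> carrier ?F" using car unfolding rels by auto
  ultimately show ?thesis
    unfolding hnn_extension_def using quotient_normal_closure_iso[OF F F' h(1)] by metis
qed


section \<open>Groups generated by involutions with numbered generators\<close>

lemma (in group) generate_commute:
  assumes z: "z \<in> generate G S" and S: "S \<subseteq> carrier G" and w: "w \<in> carrier G"
    and com: "\<And>s. s \<in> S \<Longrightarrow> s \<otimes> w = w \<otimes> s"
  shows "z \<otimes> w = w \<otimes> z"
  using z
proof (induction rule: generate.induct)
  case one
  then show ?case using w by simp
next
  case (incl h)
  then show ?case by (rule com)
next
  case (inv h)
  then have h: "h \<in> carrier G" "h \<otimes> w = w \<otimes> h" using S com by auto
  have "h \<otimes> (w \<otimes> inv h) = (w \<otimes> h) \<otimes> inv h"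
    using h(1) w by (simp only: m_assoc[symmetric] inv_closed h(2))
  also have "\<dots> = w" using h(1) w by (simp add: m_assoc)
  finally have "w \<otimes> inv h = inv h \<otimes> w"
    using h(1) w by (subst inv_solve_left) auto
  then show ?case by (rule HOL.sym)
next
  case (eng h1 h2)
  then have "h1 \<in> carrier G" "h2 \<in> carrier G" using S generate_in_carrier by auto
  then show ?case using eng w by (metis m_assoc)
qed

locale involution_sequence = group G for G (structure) +
  fixes t :: "nat \<Rightarrow> 'a" and n :: nat
  assumes t_closed: "1 \<le> i \<Longrightarrow> i \<le> n \<Longrightarrow> t i \<in> carrier G"
    and t_square: "1 \<le> i \<Longrightarrow> i \<le> n \<Longrightarrow> t i \<otimes> t i = \<one>"
begin

definition seg :: "nat \<Rightarrow> nat \<Rightarrow> 'a set" where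
  "seg a b = generate G (t ` {a..b})"

text \<open>The commutator of \<open>t i\<close> and \<open>t j\<close>, which are their own inverses.\<close>

definition br :: "nat \<Rightarrow> nat \<Rightarrow> 'a" where
  "br i j = t i \<otimes> t j \<otimes> t i \<otimes> t j"

lemma image_carrier: "1 \<le> a \<Longrightarrow> b \<le> n \<Longrightarrow> t ` {a..b} \<subseteq> carrier G"
  using t_closed by auto

lemma seg_subgroup: "1 \<le> a \<Longrightarrow> b \<le> n \<Longrightarrow> subgroup (seg a b) G"
  unfolding seg_def by (rule generate_is_subgroup[OF image_carrier])

lemma seg_carrier: "1 \<le> a \<Longrightarrow> b \<le> n \<Longrightarrow> x \<in> seg a b \<Longrightarrow> x \<in> carrier G"
  by (rule subgroup.mem_carrier[OF seg_subgroup])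

lemma t_in_seg: "a \<le> i \<Longrightarrow> i \<le> b \<Longrightarrow> t i \<in> seg a b"
  unfolding seg_def by (rule generate.incl) auto

lemma one_in_seg: "\<one> \<in> seg a b"
  unfolding seg_def by (rule generate.one)

lemma seg_mono: "x \<in> seg a b \<Longrightarrow> c \<le> a \<Longrightarrow> b \<le> d \<Longrightarrow> x \<in> seg c d"
  unfolding seg_def by (erule rev_subsetD, rule mono_generate, rule image_mono) simp

lemma seg_empty: "b < a \<Longrightarrow> seg a b = {\<one>}"
  unfolding seg_def by (simp add: generate_empty)

lemma seg_mult: "1 \<le> a \<Longrightarrow> b \<le> n \<Longrightarrow> x \<in> seg a b \<Longrightarrow> y \<in> seg a b \<Longrightarrow> x \<otimes> y \<in> seg a b"
  by (rule subgroup.m_closed[OF seg_subgroup])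

lemma seg_inv: "1 \<le> a \<Longrightarrow> b \<le> n \<Longrightarrow> x \<in> seg a b \<Longrightarrow> inv x \<in> seg a b"
  by (rule subgroup.m_inv_closed[OF seg_subgroup])

lemma t_inv: "1 \<le> i \<Longrightarrow> i \<le> n \<Longrightarrow> inv (t i) = t i"
  by (simp add: inv_equality t_closed t_square)

lemma t_cancel: "1 \<le> i \<Longrightarrow> i \<le> n \<Longrightarrow> x \<in> carrier G \<Longrightarrow> t i \<otimes> (t i \<otimes> x) = x"
  by (simp add: m_assoc[symmetric] t_closed t_square)

lemma br_closed: "1 \<le> i \<Longrightarrow> i \<le> n \<Longrightarrow> 1 \<le> j \<Longrightarrow> j \<le> n \<Longrightarrow> br i j \<in> carrier G"
  by (simp add: br_def t_closed)

lemma br_commutator: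
  "1 \<le> i \<Longrightarrow> i \<le> n \<Longrightarrow> 1 \<le> j \<Longrightarrow> j \<le> n \<Longrightarrow> br i j = commutator G (t i) (t j)"
  by (simp add: br_def commutator_def t_inv)

lemma br_swap: "1 \<le> i \<Longrightarrow> i \<le> n \<Longrightarrow> 1 \<le> j \<Longrightarrow> j \<le> n \<Longrightarrow> br j i = inv (br i j)"
  by (simp add: br_def t_closed inv_mult_group t_inv m_assoc)

lemma br_eq_one_iff:
  assumes "1 \<le> i" "i \<le> n" "1 \<le> j" "j \<le> n"
  shows "br i j = \<one> \<longleftrightarrow> t i \<otimes> t j = t j \<otimes> t i"
proof -
  have "br i j = (t i \<otimes> t j) \<otimes> inv (t j \<otimes> t i)"
    using assms by (simp add: br_def t_closed inv_mult_group t_inv m_assoc)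
  then show ?thesis using assms
    by (metis m_closed r_cancel_one r_inv inv_closed t_closed inv_solve_right' l_one)
qed

lemma conj_t: "1 \<le> i \<Longrightarrow> i \<le> n \<Longrightarrow> 1 \<le> j \<Longrightarrow> j \<le> n \<Longrightarrow> t j \<otimes> t i \<otimes> t j = t i \<otimes> br i j"
  by (simp add: br_def t_closed m_assoc t_cancel)

text \<open>The involutions \<open>t i\<close> and \<open>t j\<close> generate a dihedral group, in which each of them inverts the rotation \<open>(t i \<otimes> t j)\<^sup>2\<close>.\<close>

lemma conj_br_self:
  assumes "1 \<le> i" "i \<le> n" "1 \<le> j" "j \<le> n"
  shows "t j \<otimes> br i j \<otimes> t j = inv (br i j)"
  using assms by (simp add: br_def t_closed inv_mult_group t_inv m_assoc t_square)

text \<open>Conjugating \<open>t i\<close> by the commuting involutions \<open>t p\<close> and \<open>t q\<close> in either order gives the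
  same result: a special case of the Hall-Witt identity.\<close>

lemma br_exchange:
  assumes "1 \<le> i" "i \<le> n" "1 \<le> p" "p \<le> n" "1 \<le> q" "q \<le> n"
    and pq: "t p \<otimes> t q = t q \<otimes> t p"
  shows "br i p \<otimes> (t p \<otimes> br i q \<otimes> t p) = br i q \<otimes> (t q \<otimes> br i p \<otimes> t q)"
proof -
  have c: "t i \<in> carrier G" "t p \<in> carrier G" "t q \<in> carrier G"
    "br i p \<in> carrier G" "br i q \<in> carrier G"
    using assms by (auto simp: t_closed br_closed)
  have conj: "t r \<otimes> (t s \<otimes> t i \<otimes> t s) \<otimes> t r = t i \<otimes> (br i r \<otimes> (t r \<otimes> br i s \<otimes> t r))"
    if "1 \<le> r" "r \<le> n" "1 \<le> s" "s \<le> n" for r s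
  proof -
    have d: "t r \<in> carrier G" "t s \<in> carrier G" "br i r \<in> carrier G" "br i s \<in> carrier G"
      using that assms by (auto simp: t_closed br_closed)
    have "t r \<otimes> (t s \<otimes> t i \<otimes> t s) \<otimes> t r = t r \<otimes> (t i \<otimes> br i s) \<otimes> t r"
      using that assms by (simp add: conj_t)
    also have "\<dots> = (t r \<otimes> t i \<otimes> t r) \<otimes> (t r \<otimes> br i s \<otimes> t r)"
      using c d that by (simp add: m_assoc t_cancel)
    also have "\<dots> = t i \<otimes> (br i r \<otimes> (t r \<otimes> br i s \<otimes> t r))"
      using c d that assms by (simp only: conj_t[of i r]) (simp add: m_assoc)
    finally show ?thesis .
  qed
  have "t p \<otimes> (t q \<otimes> t i \<otimes> t q) \<otimes> t p = (t p \<otimes> t q) \<otimes> t i \<otimes> (t q \<otimes> t p)"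
    using c by (simp add: m_assoc)
  also have "\<dots> = t q \<otimes> (t p \<otimes> t i \<otimes> t p) \<otimes> t q"
    using c by (simp add: m_assoc flip: pq) (simp add: pq m_assoc flip: m_assoc)
  finally have "t i \<otimes> (br i p \<otimes> (t p \<otimes> br i q \<otimes> t p)) = t i \<otimes> (br i q \<otimes> (t q \<otimes> br i p \<otimes> t q))"
    by (simp only: conj[OF assms(3-6)] conj[OF assms(5,6,3,4)])
  then show ?thesis using c by (subst (asm) l_cancel) auto
qed

text \<open>Of the element only the first letter \<open>t u\<close> fails to commute with \<open>t v\<close>, and the commutator \<open>[t u, t v]\<close>
  that this letter leaves behind can be moved past the rest. The narrowing of supports rests on comparing such a
  conjugate with a second computation of it.\<close>

lemma conj_mult_br:
  assumes "1 \<le> u" "u \<le> n" "1 \<le> v" "v \<le> n" "y \<in> carrier G"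
    and yv: "y \<otimes> t v = t v \<otimes> y" and yb: "y \<otimes> br u v = br u v \<otimes> y"
  shows "t v \<otimes> (t u \<otimes> y) \<otimes> t v = (t u \<otimes> y) \<otimes> br u v"
proof -
  have c: "t u \<in> carrier G" "t v \<in> carrier G" "br u v \<in> carrier G"
    using assms by (auto simp: t_closed br_closed)
  have "t v \<otimes> (t u \<otimes> y) \<otimes> t v = (t v \<otimes> t u \<otimes> t v) \<otimes> y"
    using c assms(5) yv by (simp add: m_assoc)
  also have "\<dots> = (t u \<otimes> y) \<otimes> br u v"
    using c assms by (simp only: conj_t[of u v]) (simp add: m_assoc)
  finally show ?thesis .
qed

lemma seg_reverse:
  assumes "b \<le> n" "a \<le> Suc n"
  shows "generate G ((\<lambda>i. t (Suc n - i)) ` {a..b}) = seg (Suc n - b) (Suc n - a)"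
proof -
  have "(\<lambda>i. Suc n - i) ` {a..b} = {Suc n - b..Suc n - a}"
  proof (intro equalityI subsetI)
    fix x assume x: "x \<in> {Suc n - b..Suc n - a}"
    show "x \<in> (\<lambda>i. Suc n - i) ` {a..b}"
    proof (rule image_eqI)
      show "x = Suc n - (Suc n - x)" using x by simp arith
      show "Suc n - x \<in> {a..b}" using x assms by simp arith
    qed
  next
    fix x assume "x \<in> (\<lambda>i. Suc n - i) ` {a..b}"
    then obtain i where "i \<in> {a..b}" "x = Suc n - i" by blast
    then show "x \<in> {Suc n - b..Suc n - a}" using assms by simp arith
  qed
  moreover have "(\<lambda>i. t (Suc n - i)) ` {a..b} = t ` ((\<lambda>i. Suc n - i) ` {a..b})"
    by (simp only: image_image)
  ultimately show ?thesis unfolding seg_def by (simp only:)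
qed

text \<open>The condition on the commutators says that \<open>t b\<close> normalises the segment without \<open>t b\<close>. So
  that segment and its coset by \<open>t b\<close> together are closed under multiplication.\<close>

lemma peel_right_of_br:
  assumes ab: "1 \<le> a" "a \<le> b" "b \<le> n"
    and br: "\<And>i. a \<le> i \<Longrightarrow> i < b \<Longrightarrow> br i b \<in> seg a (b - 1)"
    and x: "x \<in> seg a b"
  shows "x \<in> seg a (b - 1) \<or> (\<exists>y\<in>seg a (b - 1). x = t b \<otimes> y)"
proof -
  let ?K = "seg a (b - 1)"
  have K: "subgroup ?K G" using seg_subgroup ab by simp
  have tb: "t b \<in> carrier G" using t_closed ab by simp
  have car: "y \<in> carrier G" if "y \<in> ?K" for y using subgroup.mem_carrier[OF K that] .
  have conj: "t b \<otimes> y \<otimes> t b \<in> ?K" if "y \<in> ?K" for y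
    using that unfolding seg_def[of a "b - 1"]
  proof (induction rule: generate.induct)
    case one
    then show ?case using tb t_square ab by (simp add: generate.one)
  next
    case (incl h)
    then obtain i where i: "h = t i" "a \<le> i" "i < b" using ab by auto
    have "t b \<otimes> h \<otimes> t b = t i \<otimes> br i b" using conj_t[of i b] i ab by simp
    also have "\<dots> \<in> ?K" by (rule subgroup.m_closed[OF K t_in_seg br]) (use i in auto)
    finally show ?case unfolding seg_def .
  next
    case (inv h)
    then obtain i where i: "h = t i" "a \<le> i" "i < b" using ab by auto
    have "t b \<otimes> inv h \<otimes> t b = t i \<otimes> br i b" using conj_t[of i b] t_inv[of i] i ab by simp
    also have "\<dots> \<in> ?K" by (rule subgroup.m_closed[OF K t_in_seg br]) (use i in auto)
    finally show ?case unfolding seg_def .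
  next
    case (eng h1 h2)
    have h: "h1 \<in> carrier G" "h2 \<in> carrier G" using eng car by (auto simp: seg_def)
    have "t b \<otimes> (h1 \<otimes> h2) \<otimes> t b = (t b \<otimes> h1 \<otimes> t b) \<otimes> (t b \<otimes> h2 \<otimes> t b)"
      using h tb ab by (simp add: m_assoc t_cancel)
    then show ?case using generate.eng[OF eng.IH] by simp
  qed
  have K_mult: "y \<otimes> z \<in> ?K" if "y \<in> ?K" "z \<in> ?K" for y z using subgroup.m_closed[OF K that] .
  have t_K: "t i \<in> ?K \<or> (\<exists>y\<in>?K. t i = t b \<otimes> y)" if "a \<le> i" "i \<le> b" for i
  proof (cases "i = b")
    case True
    then show ?thesis using tb one_in_seg[of a "b - 1"] by (intro disjI2 bexI[of _ \<one>]) auto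
  next
    case False
    then show ?thesis using that by (intro disjI1 t_in_seg) auto
  qed
  show ?thesis using x unfolding seg_def[of a b]
  proof (induction rule: generate.induct)
    case one
    then show ?case by (simp add: one_in_seg)
  next
    case (incl h)
    then obtain i where "h = t i" "a \<le> i" "i \<le> b" by auto
    then show ?case using t_K[of i] by simp
  next
    case (inv h)
    then obtain i where i: "h = t i" "a \<le> i" "i \<le> b" by auto
    then have "inv h = t i" using t_inv[of i] ab by simp
    then show ?case using t_K[of i] i by simp
  next
    case (eng h1 h2)
    from eng.IH(1) show ?case
    proof
      assume 1: "h1 \<in> ?K"
      from eng.IH(2) show ?thesis
      proof
        assume "h2 \<in> ?K"
        then show ?thesis using K_mult 1 by blast
      next
        assume "\<exists>y\<in>?K. h2 = t b \<otimes> y"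
        then obtain y where y: "y \<in> ?K" "h2 = t b \<otimes> y" by blast
        have "h1 \<otimes> h2 = t b \<otimes> ((t b \<otimes> h1 \<otimes> t b) \<otimes> y)"
          using y car[OF 1] car[OF y(1)] tb ab by (simp add: m_assoc t_cancel)
        then show ?thesis using K_mult[OF conj[OF 1] y(1)] by blast
      qed
    next
      assume "\<exists>y\<in>?K. h1 = t b \<otimes> y"
      then obtain y where y: "y \<in> ?K" "h1 = t b \<otimes> y" by blast
      from eng.IH(2) show ?thesis
      proof
        assume 2: "h2 \<in> ?K"
        have "h1 \<otimes> h2 = t b \<otimes> (y \<otimes> h2)" using y car[OF 2] car[OF y(1)] tb by (simp add: m_assoc)
        then show ?thesis using K_mult[OF y(1) 2] by blast
      next
        assume "\<exists>y\<in>?K. h2 = t b \<otimes> y"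
        then obtain z where z: "z \<in> ?K" "h2 = t b \<otimes> z" by blast
        have "h1 \<otimes> h2 = (t b \<otimes> y \<otimes> t b) \<otimes> z"
          using y z car[OF y(1)] car[OF z(1)] tb by (simp add: m_assoc)
        then show ?thesis using K_mult[OF conj[OF y(1)] z(1)] by simp
      qed
    qed
  qed
qed

text \<open>Modulo the central subgroup \<open>Z\<close> the group is generated by commuting involutions, so every square
  lies in \<open>Z\<close>.\<close>

lemma exponent_four_if_central:
  assumes Z: "subgroup Z G" and central: "\<And>z x. z \<in> Z \<Longrightarrow> x \<in> carrier G \<Longrightarrow> z \<otimes> x = x \<otimes> z"
    and sq: "\<And>z. z \<in> Z \<Longrightarrow> z \<otimes> z = \<one>"
    and br: "\<And>i j. i \<in> {1..n} \<Longrightarrow> j \<in> {1..n} \<Longrightarrow> br i j \<in> Z"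
    and gen: "seg 1 n = carrier G" and x: "x \<in> carrier G"
  shows "x [^] (4::nat) = \<one>"
proof -
  have Zc: "z \<in> carrier G" if "z \<in> Z" for z using subgroup.mem_carrier[OF Z that] .
  have Zm: "y \<otimes> z \<in> Z" if "y \<in> Z" "z \<in> Z" for y z using subgroup.m_closed[OF Z that] .
  have car: "y \<in> carrier G" if "y \<in> generate G (t ` {1..n})" for y
    using that gen unfolding seg_def by simp
  have gen': "y \<in> generate G (t ` {1..n})" if "y \<in> carrier G" for y
    using that gen unfolding seg_def by simp
  have t_t: "\<exists>z\<in>Z. t i \<otimes> t j = t j \<otimes> t i \<otimes> z" if "i \<in> {1..n}" "j \<in> {1..n}" for i j
    using that by (intro bexI[OF _ br[OF that]]) (simp add: br_def m_assoc t_closed t_cancel)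
  \<comment> \<open>From generators to all elements in the second argument of the commutator, then in the first.\<close>
  have t_x: "\<exists>z\<in>Z. t i \<otimes> y = y \<otimes> t i \<otimes> z" if i: "i \<in> {1..n}" and y: "y \<in> carrier G" for i y
    using gen'[OF y]
  proof (induction rule: generate.induct)
    case one
    then show ?case using i t_closed subgroup.one_closed[OF Z] by (intro bexI[of _ \<one>]) auto
  next
    case (incl h)
    then show ?case using t_t[OF i] by blast
  next
    case (inv h)
    then obtain j where j: "h = t j" "j \<in> {1..n}" by blast
    then have "inv h = t j" using t_inv[of j] by simp
    then show ?case using t_t[OF i j(2)] by simp
  next
    case (eng h1 h2)
    have c: "h1 \<in> carrier G" "h2 \<in> carrier G" "t i \<in> carrier G" using eng car i t_closed by auto
    obtain z1 z2 where z: "z1 \<in> Z" "t i \<otimes> h1 = h1 \<otimes> t i \<otimes> z1" "z2 \<in> Z" "t i \<otimes> h2 = h2 \<otimes> t i \<otimes> z2"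
      using eng.IH by blast
    have cz: "z1 \<in> carrier G" "z2 \<in> carrier G" using z Zc by auto
    have "t i \<otimes> (h1 \<otimes> h2) = h1 \<otimes> t i \<otimes> (z1 \<otimes> h2)"
      using c cz z(2) by (simp only: m_assoc[symmetric] m_closed)
    also have "\<dots> = h1 \<otimes> t i \<otimes> (h2 \<otimes> z1)" by (simp only: central[OF z(1) c(2)])
    also have "\<dots> = h1 \<otimes> (t i \<otimes> h2) \<otimes> z1" using c cz by (simp only: m_assoc m_closed)
    also have "\<dots> = h1 \<otimes> h2 \<otimes> t i \<otimes> (z2 \<otimes> z1)" unfolding z(4) using c cz by (simp only: m_assoc m_closed)
    finally show ?case using Zm[OF z(3,1)] by blast
  qed
  have comm: "\<exists>z\<in>Z. w \<otimes> y = y \<otimes> w \<otimes> z" if w: "w \<in> carrier G" and y: "y \<in> carrier G" for w y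
    using gen'[OF w]
  proof (induction rule: generate.induct)
    case one
    then show ?case using y subgroup.one_closed[OF Z] by (intro bexI[of _ \<one>]) auto
  next
    case (incl h)
    then show ?case using t_x[OF _ y] by blast
  next
    case (inv h)
    then obtain j where j: "h = t j" "j \<in> {1..n}" by blast
    then have "inv h = t j" using t_inv[of j] by simp
    then show ?case using t_x[OF j(2) y] by simp
  next
    case (eng h1 h2)
    have c: "h1 \<in> carrier G" "h2 \<in> carrier G" using eng car by auto
    obtain z1 z2 where z: "z1 \<in> Z" "h1 \<otimes> y = y \<otimes> h1 \<otimes> z1" "z2 \<in> Z" "h2 \<otimes> y = y \<otimes> h2 \<otimes> z2"
      using eng.IH by blast
    have cz: "z1 \<in> carrier G" "z2 \<in> carrier G" using z Zc by auto
    have "h1 \<otimes> h2 \<otimes> y = h1 \<otimes> (y \<otimes> h2 \<otimes> z2)" using c y z(4) by (simp only: m_assoc m_closed)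
    also have "\<dots> = (h1 \<otimes> y) \<otimes> (h2 \<otimes> z2)" using c y cz by (simp only: m_assoc m_closed)
    also have "\<dots> = y \<otimes> h1 \<otimes> (z1 \<otimes> h2) \<otimes> z2" unfolding z(2) using c y cz by (simp only: m_assoc m_closed)
    also have "\<dots> = y \<otimes> (h1 \<otimes> h2) \<otimes> (z1 \<otimes> z2)"
      unfolding central[OF z(1) c(2)] using c y cz by (simp only: m_assoc m_closed)
    finally show ?case using Zm[OF z(1,3)] by blast
  qed
  have square: "y \<otimes> y \<in> Z" if y: "y \<in> carrier G" for y
    using gen'[OF y]
  proof (induction rule: generate.induct)
    case one
    then show ?case using subgroup.one_closed[OF Z] by simp
  next
    case (incl h)
    then show ?case using t_square subgroup.one_closed[OF Z] by auto
  next
    case (inv h)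
    then obtain j where j: "h = t j" "j \<in> {1..n}" by blast
    then show ?case using t_inv[of j] t_square[of j] subgroup.one_closed[OF Z] by simp
  next
    case (eng h1 h2)
    have c: "h1 \<in> carrier G" "h2 \<in> carrier G" using eng car by auto
    obtain z where z: "z \<in> Z" "h2 \<otimes> h1 = h1 \<otimes> h2 \<otimes> z" using comm[OF c(2,1)] by blast
    have cz: "z \<in> carrier G" using z Zc by auto
    have "h1 \<otimes> h2 \<otimes> (h1 \<otimes> h2) = h1 \<otimes> (h2 \<otimes> h1) \<otimes> h2" using c by (simp only: m_assoc m_closed)
    also have "\<dots> = (h1 \<otimes> h1) \<otimes> (h2 \<otimes> (z \<otimes> h2))" unfolding z(2) using c cz by (simp only: m_assoc m_closed)
    also have "\<dots> = (h1 \<otimes> h1) \<otimes> ((h2 \<otimes> h2) \<otimes> z)"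
      unfolding central[OF z(1) c(2)] using c cz by (simp only: m_assoc m_closed)
    also have "\<dots> \<in> Z" using Zm eng.IH z(1) by simp
    finally show ?case .
  qed
  have "x [^] (4::nat) = (x \<otimes> x) \<otimes> (x \<otimes> x)"
    using x by (simp add: numeral_eq_Suc m_assoc)
  then show ?thesis using sq[OF square[OF x]] by simp
qed

lemma foldr_t_seg:
  assumes "1 \<le> a" "b \<le> n" "\<forall>l\<in>set ls. a \<le> i + l \<and> i + l \<le> b"
  shows "foldr (\<lambda>l p. t (i + l) [^] (e l :: nat) \<otimes> p) ls \<one> \<in> seg a b"
  using assms(3)
proof (induction ls)
  case Nil
  then show ?case by (simp add: one_in_seg)
next
  case (Cons l ls)
  interpret K: subgroup "seg a b" G using seg_subgroup assms by simp
  have "t (i + l) \<in> seg a b" using Cons.prems by (intro t_in_seg) auto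
  then have "t (i + l) [^] (q::nat) \<in> seg a b" for q
    by (induction q) (simp_all add: K.m_closed)
  then show ?case using Cons by simp
qed

text \<open>Peeling off the generators from the left, one after the other, writes an element as an ordered
  product of distinct generators. The offset \<open>i\<close> makes the same exponents usable for all
  translates of the element.\<close>

lemma normal_word:
  assumes peel: "\<And>a b x. 1 \<le> a \<Longrightarrow> a \<le> b \<Longrightarrow> b \<le> n \<Longrightarrow> x \<in> seg a b \<Longrightarrow>
      x \<in> seg (Suc a) b \<or> (\<exists>y\<in>seg (Suc a) b. x = t a \<otimes> y)"
    and ab: "1 \<le> i + a" "i + b \<le> n" and x: "x \<in> seg (i + a) (i + b)"
  shows "\<exists>e :: nat \<Rightarrow> nat. (\<forall>l. e l \<in> {0, 1}) \<and>
    x = foldr (\<lambda>l p. t (i + l) [^] e l \<otimes> p) [a..<Suc b] \<one>"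
  using ab(1) x
proof (induction "Suc b - a" arbitrary: a x)
  case 0
  then have "x = \<one>" using seg_empty[of "i + b" "i + a"] by simp
  then show ?case using 0 by (intro exI[of _ "\<lambda>_. 0"]) simp
next
  case (Suc d)
  then have le: "a \<le> b" by simp
  have ta: "t (i + a) \<in> carrier G" using t_closed Suc.prems le ab by simp
  obtain y c where y: "y \<in> seg (i + Suc a) (i + b)" "c \<in> {0, 1 :: nat}" "x = t (i + a) [^] c \<otimes> y"
  proof -
    from peel[of "i + a" "i + b" x] Suc.prems le ab
    have "x \<in> seg (Suc (i + a)) (i + b) \<or> (\<exists>y\<in>seg (Suc (i + a)) (i + b). x = t (i + a) \<otimes> y)" by simp
    then show thesis
    proof
      assume x': "x \<in> seg (Suc (i + a)) (i + b)"
      have "x \<in> carrier G" by (rule seg_carrier[OF _ _ x']) (use ab in auto)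
      then show thesis using x' by (intro that[of x 0]) simp_all
    next
      assume "\<exists>y\<in>seg (Suc (i + a)) (i + b). x = t (i + a) \<otimes> y"
      then obtain y where "y \<in> seg (Suc (i + a)) (i + b)" "x = t (i + a) \<otimes> y" by blast
      then show thesis using ta by (intro that[of y 1]) simp_all
    qed
  qed
  obtain e :: "nat \<Rightarrow> nat" where e: "\<forall>l. e l \<in> {0, 1}"
    "y = foldr (\<lambda>l p. t (i + l) [^] e l \<otimes> p) [Suc a..<Suc b] \<one>"
  proof -
    have "\<exists>e :: nat \<Rightarrow> nat. (\<forall>l. e l \<in> {0, 1}) \<and>
        y = foldr (\<lambda>l p. t (i + l) [^] e l \<otimes> p) [Suc a..<Suc b] \<one>"
      by (rule Suc.hyps(1)[OF _ _ y(1)]) (use Suc.hyps(2) in auto)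
    then show thesis using that by blast
  qed
  have "foldr (\<lambda>l p. t (i + l) [^] (e(a := c)) l \<otimes> p) [Suc a..<Suc b] \<one> = y"
    unfolding e(2) by (rule foldr_cong) auto
  then have "x = foldr (\<lambda>l p. t (i + l) [^] (e(a := c)) l \<otimes> p) (a # [Suc a..<Suc b]) \<one>"
    using y(3) by simp
  also have "a # [Suc a..<Suc b] = [a..<Suc b]" using le by (simp add: upt_conv_Cons del: upt_Suc)
  finally show ?case using e(1) y(2) by (intro exI[of _ "e(a := c)"]) auto
qed

end


section \<open>Narrowing the supports of commutators\<close>

text \<open>What the combinatorial argument uses of the sequence \<open>t\<^sub>1, \<dots>, t\<^sub>n\<close>. Generators at distance less than
  \<open>m\<close> commute, the commutators at distance \<open>m\<close> are non-trivial and pairwise distinct, and the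
  supports of commutators are invariant under translation (\<open>br_shift\<close>). All conditions are symmetric
  under reversing the sequence, which halves the work: statements about the left ends of supports
  imply those about the right ends.\<close>

locale narrow_sequence = involution_sequence +
  fixes m :: nat
  assumes m_pos: "1 \<le> m"
    and peel_left: "1 \<le> a \<Longrightarrow> a \<le> b \<Longrightarrow> b \<le> n \<Longrightarrow> x \<in> seg a b \<Longrightarrow>
      x \<in> seg (Suc a) b \<or> (\<exists>y\<in>seg (Suc a) b. x = t a \<otimes> y)"
    and peel_right: "1 \<le> a \<Longrightarrow> a \<le> b \<Longrightarrow> b \<le> n \<Longrightarrow> x \<in> seg a b \<Longrightarrow>
      x \<in> seg a (b - 1) \<or> (\<exists>y\<in>seg a (b - 1). x = t b \<otimes> y)"
    and br_seg: "1 \<le> i \<Longrightarrow> i < j \<Longrightarrow> j \<le> n \<Longrightarrow> br i j \<in> seg (Suc i) (j - 1)"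
    and close_commute: "1 \<le> i \<Longrightarrow> i < j \<Longrightarrow> j \<le> n \<Longrightarrow> j < i + m \<Longrightarrow> t i \<otimes> t j = t j \<otimes> t i"
    and br_m_nontrivial: "1 \<le> i \<Longrightarrow> i + m \<le> n \<Longrightarrow> br i (i + m) \<noteq> \<one>"
    and br_m_distinct: "1 \<le> i \<Longrightarrow> i < j \<Longrightarrow> j + m \<le> n \<Longrightarrow> br i (i + m) \<noteq> br j (j + m)"
    and br_shift: "1 \<le> i \<Longrightarrow> i + j < n \<Longrightarrow> 1 \<le> a \<Longrightarrow> b < n \<Longrightarrow>
      br (Suc i) (Suc i + j) \<in> seg (Suc a) (Suc b) \<longleftrightarrow> br i (i + j) \<in> seg a b"
begin

lemma t_commute:
  assumes "1 \<le> i" "i \<le> n" "1 \<le> j" "j \<le> n" "i < j + m" "j < i + m"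
  shows "t i \<otimes> t j = t j \<otimes> t i"
proof (cases i j rule: linorder_cases)
  case less
  then show ?thesis using close_commute assms by blast
next
  case greater
  then have "t j \<otimes> t i = t i \<otimes> t j" using close_commute assms by blast
  then show ?thesis by (rule HOL.sym)
qed simp

lemma seg_commute:
  assumes "1 \<le> a" "b \<le> n" "1 \<le> c" "d \<le> n" "b < c + m" "d < a + m"
    and x: "x \<in> seg a b" and y: "y \<in> seg c d"
  shows "x \<otimes> y = y \<otimes> x"
proof -
  have y': "y \<in> carrier G" using seg_carrier[OF assms(3,4) y] .
  have "t i \<otimes> y = y \<otimes> t i" if i: "i \<in> {a..b}" for i
  proof -
    have "y \<otimes> t i = t i \<otimes> y"
    proof (rule generate_commute)
      show "y \<in> generate G (t ` {c..d})" using y unfolding seg_def .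
      show "t ` {c..d} \<subseteq> carrier G" using image_carrier assms by blast
      show "t i \<in> carrier G" using i assms by (auto simp: t_closed)
      fix s assume "s \<in> t ` {c..d}"
      then obtain j where "s = t j" "j \<in> {c..d}" by blast
      moreover from this have "1 \<le> j" "j \<le> n" "1 \<le> i" "i \<le> n" "j < i + m" "i < j + m"
        using i assms by auto
      ultimately show "s \<otimes> t i = t i \<otimes> s" by (blast intro: t_commute)
    qed
    then show ?thesis by (rule HOL.sym)
  qed
  note com = this
  show ?thesis
  proof (rule generate_commute[OF x[unfolded seg_def] image_carrier[OF assms(1,2)] y'])
    fix s assume "s \<in> t ` {a..b}"
    then show "s \<otimes> y = y \<otimes> s" using com by blast
  qed
qed

lemma seg_square:
  assumes "1 \<le> a" "b \<le> n" "b < a + m" and x: "x \<in> seg a b"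
  shows "x \<otimes> x = \<one>"
  using x unfolding seg_def
proof (induction rule: generate.induct)
  case one
  then show ?case by simp
next
  case (incl h)
  then show ?case using assms t_square by auto
next
  case (inv h)
  then obtain i where "i \<in> {a..b}" "h = t i" by blast
  then show ?case using assms t_square t_inv by auto
next
  case (eng h1 h2)
  have h: "h1 \<in> seg a b" "h2 \<in> seg a b" using eng by (auto simp: seg_def)
  then have c: "h1 \<in> carrier G" "h2 \<in> carrier G" using seg_carrier[OF assms(1,2)] by auto
  have "h2 \<otimes> h1 = h1 \<otimes> h2" using seg_commute[OF _ _ _ _ _ _ h(2,1)] assms by simp
  then have "h1 \<otimes> h2 \<otimes> (h1 \<otimes> h2) = (h1 \<otimes> h1) \<otimes> (h2 \<otimes> h2)"
    using c by (metis m_assoc m_closed)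
  then show ?case using eng by simp
qed

lemma peel:
  assumes "1 \<le> a" "b \<le> n" "x \<in> seg a b"
  obtains "x \<in> seg (Suc a) b" | y where "a \<le> b" "y \<in> seg (Suc a) b" "x = t a \<otimes> y"
proof (cases "a \<le> b")
  case True
  then show ?thesis using peel_left[OF assms(1) _ assms(2,3)] that by blast
next
  case False
  then show ?thesis using assms(3) seg_empty[of b a] one_in_seg that(1) by simp
qed

lemma conj_seg:
  assumes "1 \<le> u" "1 \<le> v" "v \<le> n" "u \<le> b" "b \<le> n" "u \<le> n"
    and y: "y \<in> seg (Suc u) b" and w: "br u v \<in> seg c d"
    and "1 \<le> c" "d \<le> n" "b < v + m" "v \<le> u + m" "b < c + m" "d \<le> u + m"
  shows "t v \<otimes> (t u \<otimes> y) \<otimes> t v = (t u \<otimes> y) \<otimes> br u v"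
proof (rule conj_mult_br)
  show "y \<in> carrier G" by (rule seg_carrier[OF _ _ y]) (use assms in auto)
  show "y \<otimes> t v = t v \<otimes> y"
    by (rule seg_commute[OF _ _ _ _ _ _ y t_in_seg[of v v v]]) (use assms in auto)
  show "y \<otimes> br u v = br u v \<otimes> y"
    by (rule seg_commute[OF _ _ _ _ _ _ y w]) (use assms in auto)
qed (use assms in auto)

text \<open>The supports of the commutators at distance less than \<open>m + K\<close> are narrower by \<open>K\<close> at both ends than
  the interval spanned by the two indices. The case \<open>K = 1\<close> is \<open>br_seg\<close>; the aim is \<open>K = n - m\<close>.\<close>

definition narrow :: "nat \<Rightarrow> bool" where
  "narrow K \<longleftrightarrow> (\<forall>i j. 1 \<le> i \<longrightarrow> m \<le> j \<longrightarrow> j < m + K \<longrightarrow> i + j \<le> n \<longrightarrow>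
      br i (i + j) \<in> seg (i + K) (i + j - K))"

lemma narrowD: "narrow K \<Longrightarrow> 1 \<le> i \<Longrightarrow> m \<le> j \<Longrightarrow> j < m + K \<Longrightarrow> i + j \<le> n \<Longrightarrow>
   br i (i + j) \<in> seg (i + K) (i + j - K)"
  unfolding narrow_def by blast

lemma narrow_one: "narrow 1"
  unfolding narrow_def using br_seg m_pos by auto

text \<open>This computes the conjugate of \<open>[t\<^sub>i, t\<^bsub>i+j\<^esub>]\<close>, when it starts with \<open>t\<^bsub>i+K\<^esub>\<close>, by \<open>g = t\<^bsub>i+m+K\<^esub>\<close>: the
  first letter is the only one at distance \<open>m\<close> from \<open>g\<close>, the others are closer.\<close>

lemma conj_far:
  assumes K: "narrow K" "1 \<le> K" "K < m" and i: "1 \<le> i" "i + m + K \<le> n"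
    and j: "m \<le> j" "j < m + K" and f: "f \<in> seg (Suc (i + K)) (i + j - K)" and le: "i + K \<le> i + j - K"
  shows "t (i + m + K) \<otimes> (t (i + K) \<otimes> f) \<otimes> t (i + m + K)
    = (t (i + K) \<otimes> f) \<otimes> br (i + K) (i + m + K)"
proof (rule conj_seg[OF _ _ _ _ _ _ f])
  show "br (i + K) (i + m + K) \<in> seg (i + K + K) (i + m)"
    using narrowD[OF K(1), of "i + K" m] K i by (simp add: add.commute add.left_commute)
qed (use assms in auto)

text \<open>Let \<open>c\<close> be the new commutator \<open>[t\<^sub>i, g]\<close>, where \<open>g = t\<^bsub>i+m+K\<^esub>\<close>, and suppose that it starts with
  \<open>t\<^bsub>i+a\<^esub>\<close> where \<open>a < K\<close>. With \<open>h = t\<^bsub>i+a+m\<^esub>\<close> and \<open>e = [t\<^sub>i, h]\<close>, the conjugate of \<open>c\<close> by \<open>h\<close> is \<open>c w\<close>,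
  and the conjugate of \<open>e\<close> by \<open>g\<close> is \<open>e\<close> or \<open>e w'\<close>, for commutators \<open>w \<noteq> w'\<close> at distance \<open>m\<close>. By
  \<open>br_exchange\<close> this forces \<open>w = \<one>\<close> or \<open>w = w'\<close>, as \<open>c\<close> and \<open>e\<close> commute.\<close>

lemma far_left_step:
  assumes K: "narrow K" "1 \<le> K" "K < m" and i: "1 \<le> i" "i + m + K \<le> n"
    and a: "1 \<le> a" "a < K" and b: "b < i + m + K"
    and c: "br i (i + m + K) \<in> seg (i + a) b"
  shows "br i (i + m + K) \<in> seg (Suc (i + a)) b"
proof (rule peel[OF _ _ c])
  fix y assume ab: "i + a \<le> b" and y: "y \<in> seg (Suc (i + a)) b" and cy: "br i (i + m + K) = t (i + a) \<otimes> y"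
  define c where "c = br i (i + m + K)"
  define e where "e = br i (i + (a + m))"
  define w where "w = br (i + a) (i + a + m)"
  define w' where "w' = br (i + K) (i + m + K)"
  have e: "e \<in> seg (i + K) (i + (a + m) - K)"
    unfolding e_def by (rule narrowD[OF K(1)]) (use K i a in auto)
  have w: "w \<in> seg (i + a + K) (i + a + m - K)"
    unfolding w_def by (rule narrowD[OF K(1)]) (use K i a in auto)
  have car: "c \<in> carrier G" "e \<in> carrier G" "w \<in> carrier G" "w' \<in> carrier G"
    unfolding c_def e_def w_def w'_def using i a by (auto intro!: br_closed)
  have "t (i + a + m) \<otimes> (t (i + a) \<otimes> y) \<otimes> t (i + a + m) = (t (i + a) \<otimes> y) \<otimes> w"
    unfolding w_def by (rule conj_seg[OF _ _ _ _ _ _ y w[unfolded w_def]]) (use i a b ab K in auto)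
  then have ch: "t (i + (a + m)) \<otimes> c \<otimes> t (i + (a + m)) = c \<otimes> w"
    unfolding c_def cy by (simp add: add.assoc)
  have ec: "e \<otimes> c = c \<otimes> e"
    by (rule seg_commute[OF _ _ _ _ _ _ e c[folded c_def]]) (use i a b K in auto)
  have ex: "e \<otimes> (c \<otimes> w) = c \<otimes> (t (i + m + K) \<otimes> e \<otimes> t (i + m + K))"
    using br_exchange[of i "i + (a + m)" "i + m + K", folded e_def c_def] ch
      t_commute[of "i + (a + m)" "i + m + K"] i a K by simp
  have "w = \<one> \<or> w = w'"
  proof (rule peel[OF _ _ e])
    assume e1: "e \<in> seg (Suc (i + K)) (i + (a + m) - K)"
    have "e \<otimes> t (i + m + K) = t (i + m + K) \<otimes> e"
      by (rule seg_commute[OF _ _ _ _ _ _ e1 t_in_seg[of "i+m+K" _ "i+m+K"]]) (use i a K in auto)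
    then have "t (i + m + K) \<otimes> e \<otimes> t (i + m + K) = e"
      using car i by (metis t_cancel m_assoc t_closed add_leD1 le_trans le_add1)
    then have "e \<otimes> (c \<otimes> w) = c \<otimes> e" using ex by (simp only:)
    then have "(e \<otimes> c) \<otimes> w = c \<otimes> e" using car by (simp only: m_assoc)
    then have "(e \<otimes> c) \<otimes> w = e \<otimes> c" by (simp only: ec)
    then show ?thesis using car l_cancel_one[of "e \<otimes> c" w] by simp
  next
    fix f assume le: "i + K \<le> i + (a + m) - K" and f: "f \<in> seg (Suc (i + K)) (i + (a + m) - K)"
      and ef: "e = t (i + K) \<otimes> f"
    have "t (i + m + K) \<otimes> e \<otimes> t (i + m + K) = e \<otimes> w'"
      unfolding ef w'_def by (rule conj_far[OF K i _ _ f le]) (use a in auto)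
    then have "(e \<otimes> c) \<otimes> w = (c \<otimes> e) \<otimes> w'" using ex car by (simp only: m_assoc)
    then have "(e \<otimes> c) \<otimes> w = (e \<otimes> c) \<otimes> w'" by (simp only: ec)
    then show ?thesis using car l_cancel[of "e \<otimes> c" w w'] by simp
  qed (use i a K in auto)
  moreover have "w \<noteq> \<one>" unfolding w_def using br_m_nontrivial[of "i + a"] i a by simp
  moreover have "w \<noteq> w'"
    unfolding w_def w'_def using br_m_distinct[of "i + a" "i + K"] i a by (simp add: add.commute add.left_commute)
  ultimately show ?thesis by blast
qed (use i a b in auto)

text \<open>The argument of \<open>far_left_step\<close> gives nothing for \<open>a = K\<close>, since there \<open>h = g\<close>. But now the support of
  \<open>c\<close> is so short that \<open>c\<close> is an involution, so that \<open>g\<close>, which inverts \<open>c\<close> by \<open>conj_br_self\<close>, commutes with it. If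
  \<open>c\<close> started with \<open>t\<^bsub>i+K\<^esub>\<close>, conjugation by \<open>g\<close> would change it.\<close>

lemma far_left_last:
  assumes K: "narrow K" "1 \<le> K" "K < m" and i: "1 \<le> i" "i + m + K \<le> n"
    and b: "b \<le> i + m" and c: "br i (i + m + K) \<in> seg (i + K) b"
  shows "br i (i + m + K) \<in> seg (Suc (i + K)) b"
proof (rule peel[OF _ _ c])
  fix y assume le: "i + K \<le> b" and y: "y \<in> seg (Suc (i + K)) b"
    and cy: "br i (i + m + K) = t (i + K) \<otimes> y"
  define c where "c = br i (i + m + K)"
  define w where "w = br (i + K) (i + m + K)"
  have w: "w \<in> seg (i + K + K) (i + m)"
    unfolding w_def using narrowD[OF K(1), of "i + K" m] K i by (simp add: add.commute add.left_commute)
  have car: "c \<in> carrier G" "w \<in> carrier G"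
    unfolding c_def w_def using i by (auto intro!: br_closed)
  have "t (i + m + K) \<otimes> c \<otimes> t (i + m + K) = c \<otimes> w"
    unfolding c_def cy w_def
    by (rule conj_seg[OF _ _ _ _ _ _ y w[unfolded w_def]]) (use i K b le in auto)
  moreover have "t (i + m + K) \<otimes> c \<otimes> t (i + m + K) = inv c"
    unfolding c_def by (rule conj_br_self) (use i in auto)
  moreover have "c \<otimes> c = \<one>"
    by (rule seg_square[OF _ _ _ c[folded c_def]]) (use i K b in auto)
  then have "inv c = c" using car by (simp add: inv_equality)
  ultimately have "c \<otimes> w = c" by (simp only:)
  then have "w = \<one>" using car l_cancel_one by blast
  then show ?thesis using br_m_nontrivial[of "i + K"] i
    unfolding w_def by (simp add: add.commute add.left_commute)
qed (use i b in auto)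

text \<open>Once the new commutator \<open>c\<close> is narrow, it commutes with \<open>h = t\<^bsub>i+j\<^esub>\<close>. So in \<open>br_exchange\<close> the conjugate of
  \<open>e = [t\<^sub>i, h]\<close> by \<open>g\<close> is \<open>e\<close> itself, and \<open>e\<close> cannot start with \<open>t\<^bsub>i+K\<^esub>\<close>.\<close>

lemma near_left_last:
  assumes K: "narrow K" "1 \<le> K" "K < m" and i: "1 \<le> i" "i + m + K \<le> n" and j: "m \<le> j" "j < m + K"
    and c: "br i (i + m + K) \<in> seg (Suc (i + K)) (i + m - 1)"
    and b: "b \<le> i + j - K" and e: "br i (i + j) \<in> seg (i + K) b"
  shows "br i (i + j) \<in> seg (Suc (i + K)) b"
proof (rule peel[OF _ _ e])
  fix f assume le: "i + K \<le> b" and f: "f \<in> seg (Suc (i + K)) b" and ef: "br i (i + j) = t (i + K) \<otimes> f"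
  define c where "c = br i (i + m + K)"
  define e where "e = br i (i + j)"
  define w where "w = br (i + K) (i + m + K)"
  have car: "c \<in> carrier G" "e \<in> carrier G" "w \<in> carrier G"
    unfolding c_def e_def w_def using i j by (auto intro!: br_closed)
  have "c \<otimes> t (i + j) = t (i + j) \<otimes> c"
    unfolding c_def by (rule seg_commute[OF _ _ _ _ _ _ c t_in_seg[of "i+j" _ "i+j"]]) (use i j K in auto)
  then have ch: "t (i + j) \<otimes> c \<otimes> t (i + j) = c"
    using car i j by (simp add: m_assoc t_closed t_cancel)
  have eg: "t (i + m + K) \<otimes> e \<otimes> t (i + m + K) = e \<otimes> w"
    unfolding e_def ef w_def
    by (rule conj_far[OF K i j seg_mono[OF f]]) (use b le in auto)
  have ec: "e \<otimes> c = c \<otimes> e"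
    unfolding e_def c_def
    by (rule seg_commute[OF _ _ _ _ _ _ e c]) (use i j b K in auto)
  have "e \<otimes> c = c \<otimes> (e \<otimes> w)"
    using br_exchange[of i "i + j" "i + m + K", folded e_def c_def] ch eg
      t_commute[of "i + j" "i + m + K"] i j K by simp
  then have "(c \<otimes> e) \<otimes> w = e \<otimes> c" using car by (simp only: m_assoc)
  then have "(c \<otimes> e) \<otimes> w = c \<otimes> e" by (simp only: ec)
  then have "w = \<one>" using car l_cancel_one[of "c \<otimes> e" w] by simp
  then show ?thesis using br_m_nontrivial[of "i + K"] i
    unfolding w_def by (simp add: add.commute add.left_commute)
qed (use i j b in auto)

lemma br_shift_iff:
  assumes "1 \<le> i" "1 \<le> a" "i + j + s \<le> n" "b + s \<le> n"
  shows "br (i + s) (i + s + j) \<in> seg (a + s) (b + s) \<longleftrightarrow> br i (i + j) \<in> seg a b"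
  using assms
proof (induction s)
  case (Suc s)
  then show ?case using br_shift[of "i + s" j "a + s" "b + s"] by simp
qed simp

text \<open>Some steps below are available only when \<open>i\<close> or \<open>i + j\<close> is at an end of the sequence; translation
  carries their conclusions to all other positions.\<close>

lemma br_transport:
  assumes "1 \<le> i" "1 \<le> i'" "i + j \<le> n" "i' + j \<le> n" "u \<le> j"
    and br: "br i (i + j) \<in> seg (i + l) (i + u)"
  shows "br i' (i' + j) \<in> seg (i' + l) (i' + u)"
proof (cases "i \<le> i'")
  case True
  then show ?thesis using br_shift_iff[of i "i + l" j "i' - i" "i + u"] assms by (simp add: add.commute)
next
  case False
  then show ?thesis using br_shift_iff[of i' "i' + l" j "i - i'" "i' + u"] assms by (simp add: add.commute)
qed

abbreviation t_rev :: "nat \<Rightarrow> 'a" where "t_rev \<equiv> \<lambda>i. t (Suc n - i)"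

lemma involution_sequence_rev: "involution_sequence G t_rev n"
  by unfold_locales (auto simp: t_closed t_square)

lemma seg_rev: "b \<le> n \<Longrightarrow> a \<le> Suc n \<Longrightarrow>
   involution_sequence.seg G t_rev a b = seg (Suc n - b) (Suc n - a)"
  using seg_reverse by (simp add: involution_sequence.seg_def[OF involution_sequence_rev])

lemma br_rev: "1 \<le> i \<Longrightarrow> i \<le> n \<Longrightarrow> 1 \<le> j \<Longrightarrow> j \<le> n \<Longrightarrow>
   involution_sequence.br G t_rev i j = inv (br (Suc n - j) (Suc n - i))"
  using br_swap[of "Suc n - j" "Suc n - i"]
  by (simp add: involution_sequence.br_def[OF involution_sequence_rev] br_def)

lemma inv_mem_seg_iff:
  "1 \<le> a \<Longrightarrow> b \<le> n \<Longrightarrow> x \<in> carrier G \<Longrightarrow> inv x \<in> seg a b \<longleftrightarrow> x \<in> seg a b"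
  using seg_inv[of a b x] seg_inv[of a b "inv x"] by auto

lemma br_rev_seg:
  assumes "1 \<le> i" "i \<le> n" "1 \<le> j" "j \<le> n" "1 \<le> a" "a \<le> Suc n" "1 \<le> b" "b \<le> n"
  shows "involution_sequence.br G t_rev i j \<in> involution_sequence.seg G t_rev a b
    \<longleftrightarrow> br (Suc n - j) (Suc n - i) \<in> seg (Suc n - b) (Suc n - a)"
  using assms by (simp add: br_rev seg_rev inv_mem_seg_iff br_closed)

text \<open>The two peeling conditions are exchanged, and each commutator is replaced by an inverse.\<close>

lemma narrow_sequence_rev: "narrow_sequence G t_rev n m"
proof -
  \<comment> \<open>Index \<open>a\<close> of the reversed sequence is index \<open>Suc n - a\<close> of the original one.\<close>
  interpret R: involution_sequence G t_rev n by (rule involution_sequence_rev)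
  show ?thesis
  proof unfold_locales
    fix a b x assume ab: "1 \<le> a" "a \<le> b" "b \<le> n" and x: "x \<in> R.seg a b"
    have x': "x \<in> seg (Suc n - b) (Suc n - a)" using x ab by (simp add: seg_rev)
    have eq: "Suc (Suc n - b) = Suc n - (b - 1)" "Suc n - a - 1 = Suc n - Suc a" using ab by auto
    show "x \<in> R.seg (Suc a) b \<or> (\<exists>y\<in>R.seg (Suc a) b. x = t_rev a \<otimes> y)"
      using peel_right[OF _ _ _ x'] ab eq by (simp add: seg_rev)
    have "x \<in> seg (Suc (Suc n - b)) (Suc n - a) \<or>
        (\<exists>y\<in>seg (Suc (Suc n - b)) (Suc n - a). x = t (Suc n - b) \<otimes> y)"
      by (rule peel_left[OF _ _ _ x']) (use ab in auto)
    then show "x \<in> R.seg a (b - 1) \<or> (\<exists>y\<in>R.seg a (b - 1). x = t_rev b \<otimes> y)"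
      using ab by (simp add: seg_rev eq(1))
  next
    fix i j :: nat assume ij: "1 \<le> i" "i < j" "j \<le> n"
    have "br (Suc n - j) (Suc n - i) \<in> seg (Suc (Suc n - j)) (Suc n - i - 1)"
      by (rule br_seg) (use ij in auto)
    moreover have "Suc (Suc n - j) = Suc n - (j - 1)" "Suc n - i - 1 = Suc n - Suc i" using ij by auto
    ultimately show "R.br i j \<in> R.seg (Suc i) (j - 1)"
      using ij by (simp add: br_rev_seg)
    assume "j < i + m"
    then show "t_rev i \<otimes> t_rev j = t_rev j \<otimes> t_rev i" using ij by (intro t_commute) auto
  next
    fix i assume i: "1 \<le> i" "i + m \<le> n"
    then have "br (Suc n - (i + m)) (Suc n - i) \<noteq> \<one>"
      using br_m_nontrivial[of "Suc n - (i + m)"] by simp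
    then show "R.br i (i + m) \<noteq> \<one>" using i by (simp add: br_rev br_closed)
  next
    fix i j assume i: "1 \<le> i" "i < j" "j + m \<le> n"
    have "br (Suc n - (j + m)) (Suc n - (j + m) + m) \<noteq> br (Suc n - (i + m)) (Suc n - (i + m) + m)"
      by (rule br_m_distinct) (use i in auto)
    then have "br (Suc n - (j + m)) (Suc n - j) \<noteq> br (Suc n - (i + m)) (Suc n - i)"
      using i by simp
    moreover have "br (Suc n - (j + m)) (Suc n - j) \<in> carrier G" "br (Suc n - (i + m)) (Suc n - i) \<in> carrier G"
      using i by (auto intro!: br_closed)
    ultimately have "inv (br (Suc n - (i + m)) (Suc n - i)) \<noteq> inv (br (Suc n - (j + m)) (Suc n - j))"
      by (metis inv_inv)
    then show "R.br i (i + m) \<noteq> R.br j (j + m)" using i by (simp add: br_rev)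
  next
    fix i j a b :: nat assume i: "1 \<le> i" "i + j < n" "1 \<le> a" "b < n"
    show "R.br (Suc i) (Suc i + j) \<in> R.seg (Suc a) (Suc b) \<longleftrightarrow> R.br i (i + j) \<in> R.seg a b"
    proof (cases "a \<le> b")
      case True
      have "br (Suc (n - (i + j))) (Suc (n - (i + j)) + j) \<in> seg (Suc (n - b)) (Suc (n - a)) \<longleftrightarrow>
         br (n - (i + j)) ((n - (i + j)) + j) \<in> seg (n - b) (n - a)"
        by (rule br_shift) (use i True in auto)
      then show ?thesis using i True by (simp add: br_rev_seg Suc_diff_le)
    next
      case False
      have "R.br (Suc i) (Suc i + j) = \<one> \<longleftrightarrow> R.br i (i + j) = \<one>"
      proof -
        have "br (Suc (n - (i + j))) (Suc (n - (i + j)) + j) \<in> seg (Suc n) n \<longleftrightarrow>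
           br (n - (i + j)) ((n - (i + j)) + j) \<in> seg n (n - 1)"
          using br_shift[of "n - (i + j)" j n "n - 1"] i by simp
        then show ?thesis using i by (simp add: br_rev br_closed seg_empty Suc_diff_le)
      qed
      then show ?thesis using False i by (simp add: R.seg_empty)
    qed
  qed (rule m_pos)
qed

lemma narrow_rev:
  assumes "narrow K" "K < m"
  shows "narrow_sequence.narrow G t_rev n m K"
  unfolding narrow_sequence.narrow_def[OF narrow_sequence_rev]
proof (intro allI impI)
  fix i j assume i: "1 \<le> i" "m \<le> j" "j < m + K" "i + j \<le> n"
  have "br (Suc n - (i + j)) (Suc n - (i + j) + j) \<in> seg (Suc n - (i + j) + K) (Suc n - (i + j) + j - K)"
    by (rule narrowD[OF assms(1)]) (use i in auto)
  moreover have "Suc n - (i + j) + K = Suc n - (i + j - K)" "Suc n - (i + j) + j - K = Suc n - (i + K)"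
    "Suc n - (i + j) + j = Suc n - i"
    using i assms(2) by auto
  ultimately show "involution_sequence.br G t_rev i (i + j) \<in> involution_sequence.seg G t_rev (i + K) (i + j - K)"
    using i assms(2) by (subst br_rev_seg) auto
qed

lemma far_right_step:
  assumes K: "narrow K" "1 \<le> K" "K < m" and i: "1 \<le> i" "i + m + K \<le> n"
    and b: "i + m < b" "b < i + m + K" and a: "i < a" "a \<le> n"
    and c: "br i (i + m + K) \<in> seg a b"
  shows "br i (i + m + K) \<in> seg a (b - 1)"
proof -
  interpret R: narrow_sequence G t_rev n m by (rule narrow_sequence_rev)
  define p where "p = Suc n - (i + m + K)"
  have "R.br p (p + m + K) \<in> R.seg (Suc (p + (i + m + K - b))) (Suc n - a)"
  proof (rule R.far_left_step[OF narrow_rev[OF K(1,3)] K(2,3)])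
    show "R.br p (p + m + K) \<in> R.seg (p + (i + m + K - b)) (Suc n - a)"
      using c i a b by (subst br_rev_seg) (auto simp: p_def)
  qed (use a b i in \<open>auto simp: p_def\<close>)
  then show ?thesis using i a b by (subst (asm) br_rev_seg) (auto simp: p_def)
qed

lemma far_right_last:
  assumes K: "narrow K" "1 \<le> K" "K < m" and i: "1 \<le> i" "i + m + K \<le> n"
    and a: "i + K \<le> a" "a \<le> n"
    and c: "br i (i + m + K) \<in> seg a (i + m)"
  shows "br i (i + m + K) \<in> seg a (i + m - 1)"
proof -
  interpret R: narrow_sequence G t_rev n m by (rule narrow_sequence_rev)
  define p where "p = Suc n - (i + m + K)"
  have "R.br p (p + m + K) \<in> R.seg (Suc (p + K)) (Suc n - a)"
  proof (rule R.far_left_last[OF narrow_rev[OF K(1,3)] K(2,3)])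
    show "R.br p (p + m + K) \<in> R.seg (p + K) (Suc n - a)"
      using c i a by (subst br_rev_seg) (auto simp: p_def)
  qed (use a i in \<open>auto simp: p_def\<close>)
  then show ?thesis using i a by (subst (asm) br_rev_seg) (auto simp: p_def)
qed

lemma near_right_last:
  assumes K: "narrow K" "1 \<le> K" "K < m" and i: "1 \<le> i" "i + m + K \<le> n" and j: "m \<le> j" "j < m + K"
    and c: "br i (i + m + K) \<in> seg (Suc (i + K)) (i + m - 1)"
    and p: "p = i + m + K - j" and a: "p + K \<le> a" "a \<le> n" and e: "br p (p + j) \<in> seg a (p + j - K)"
  shows "br p (p + j) \<in> seg a (p + j - K - 1)"
proof -
  interpret R: narrow_sequence G t_rev n m by (rule narrow_sequence_rev)
  define q where "q = Suc n - (i + m + K)"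
  have "R.br q (q + j) \<in> R.seg (Suc (q + K)) (Suc n - a)"
  proof (rule R.near_left_last[OF narrow_rev[OF K(1,3)] K(2,3) _ _ j])
    show "R.br q (q + j) \<in> R.seg (q + K) (Suc n - a)"
      using e i a j by (subst br_rev_seg) (auto simp: p q_def)
    show "R.br q (q + m + K) \<in> R.seg (Suc (q + K)) (q + m - 1)"
      using c i a j K by (subst br_rev_seg) (auto simp: p q_def)
  qed (use a i j p in \<open>auto simp: q_def\<close>)
  then show ?thesis using i a j by (subst (asm) br_rev_seg) (auto simp: p q_def)
qed

text \<open>The two ends are moved inwards in turn. The last step on each side needs the other end to have
  been moved up to its last step already, because it uses that the support is short.\<close>

lemma far_narrow:
  assumes K: "narrow K" "1 \<le> K" "K < m" and i: "1 \<le> i" "i + m + K \<le> n"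
  shows "br i (i + m + K) \<in> seg (Suc (i + K)) (i + m - 1)"
proof -
  let ?c = "br i (i + m + K)"
  have "?c \<in> seg (i + 1) (i + m + K - 1)" using br_seg[of i "i + m + K"] i K by simp
  moreover have "a \<le> K \<Longrightarrow> 1 \<le> a \<Longrightarrow> ?c \<in> seg (i + 1) (i + m + K - 1) \<Longrightarrow> ?c \<in> seg (i + a) (i + m + K - 1)" for a
  proof (induction a)
    case (Suc a)
    show ?case
    proof (cases "a = 0")
      case True
      then show ?thesis using Suc by simp
    next
      case False
      then show ?thesis
        using far_left_step[OF K i, of a "i + m + K - 1"] Suc K by simp
    qed
  qed simp
  ultimately have 1: "?c \<in> seg (i + K) (i + m + K - 1)" using K by blast
  have "b \<le> K - 1 \<Longrightarrow> ?c \<in> seg (i + K) (i + m + K - 1 - b)" for b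
  proof (induction b)
    case 0
    then show ?case using 1 by simp
  next
    case (Suc b)
    then show ?case
      using far_right_step[OF K i, of "i + m + K - 1 - b" "i + K"] i K by simp
  qed
  from this[of "K - 1"] have "?c \<in> seg (i + K) (i + m)" using K by simp
  then have "?c \<in> seg (Suc (i + K)) (i + m)" by (intro far_left_last[OF K i]) auto
  then show ?thesis using far_right_last[OF K i] K i by simp
qed

text \<open>The commutators at distance \<open>m + K\<close> come first. They are needed to improve the shorter ones, of which the
  left end is treated at the left end of the sequence and the right end at the right end.\<close>

lemma narrow_Suc:
  assumes K: "narrow K" "1 \<le> K" "K < m" and n: "m + K < n"
  shows "narrow (Suc K)"
  unfolding narrow_def
proof (intro allI impI)
  fix i j assume i: "1 \<le> i" and j: "m \<le> j" "j < m + Suc K" and ij: "i + j \<le> n"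
  show "br i (i + j) \<in> seg (i + Suc K) (i + j - Suc K)"
  proof (cases "j = m + K")
    case True
    then show ?thesis using far_narrow[OF K i] ij by (simp add: add.assoc)
  next
    case False
    then have jK: "j < m + K" using j by simp
    have "br 1 (1 + j) \<in> seg (1 + K) (1 + j - K)" by (rule narrowD[OF K(1)]) (use j jK n in auto)
    then have "br 1 (1 + j) \<in> seg (Suc (1 + K)) (1 + j - K)"
      by (intro near_left_last[OF K _ _ j(1) jK]) (use far_narrow[OF K, of 1] n in auto)
    then have 1: "br 1 (1 + j) \<in> seg (1 + Suc K) (1 + (j - K))"
      using j K by (simp add: Suc_diff_le)
    define q where "q = n - (m + K)"
    define p where "p = q + m + K - j"
    have pq: "1 \<le> q" "q + m + K \<le> n" "1 \<le> p" "p + j \<le> n" unfolding p_def q_def using n jK j by auto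
    have "br p (p + j) \<in> seg (p + Suc K) (p + (j - K))"
      by (rule br_transport[OF _ _ _ _ _ 1]) (use pq j jK n in auto)
    then have "br p (p + j) \<in> seg (p + Suc K) (p + j - K)" using j K by simp
    then have "br p (p + j) \<in> seg (p + Suc K) (p + j - K - 1)"
      using pq j jK K by (intro near_right_last[OF K pq(1,2) j(1) jK far_narrow[OF K pq(1,2)] p_def]) auto
    then have 2: "br p (p + j) \<in> seg (p + Suc K) (p + (j - Suc K))" using j K by simp
    have "br i (i + j) \<in> seg (i + Suc K) (i + (j - Suc K))"
      by (rule br_transport[OF _ _ _ _ _ 2]) (use pq j jK n i ij in auto)
    then show ?thesis using j K by simp
  qed
qed

text \<open>A non-trivial commutator \<open>[t\<^sub>1, t\<^bsub>1+m\<^esub>]\<close> has a non-empty support.\<close>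

lemma narrow_bound:
  assumes K: "narrow K" "1 \<le> K" and n: "m + K \<le> n"
  shows "2 * K \<le> m"
proof (rule ccontr)
  assume "\<not> 2 * K \<le> m"
  then have "br 1 (1 + m) = \<one>"
    using narrowD[OF K(1), of 1 m] K n seg_empty[of "1 + m - K" "1 + K"] by simp
  then show False using br_m_nontrivial[of 1] K n by simp
qed

text \<open>The step from \<open>K\<close> needs \<open>K < m\<close>, which is supplied by \<open>narrow_bound\<close> at the previous stage.\<close>

theorem narrow_all:
  assumes "1 \<le> K" "m + K \<le> n"
  shows "narrow K \<and> 2 * K \<le> m"
  using assms
proof (induction K)
  case (Suc K)
  show ?case
  proof (cases "K = 0")
    case True
    then show ?thesis using narrow_one narrow_bound[of 1] Suc by simp
  next
    case False
    then have "narrow K" "2 * K \<le> m" using Suc by auto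
    then have "narrow (Suc K)" using narrow_Suc[of K] Suc False by auto
    then show ?thesis using narrow_bound Suc by blast
  qed
qed simp

end


section \<open>The generating involutions of the base group\<close>

locale partial_shift = group G for G (structure) +
  fixes H\<^sub>1 H\<^sub>2 :: "'a set" and \<phi> :: "'a \<Rightarrow> 'a"
  assumes finite_carrier: "finite (carrier G)"
    and H\<^sub>1: "subgroup H\<^sub>1 G" and H\<^sub>2: "subgroup H\<^sub>2 G"
    and index_two: "card (rcosets H\<^sub>1) = 2"
    and \<phi>_iso: "\<phi> \<in> iso (G\<lparr>carrier := H\<^sub>1\<rparr>) (G\<lparr>carrier := H\<^sub>2\<rparr>)"
    and no_invariant: "\<And>K. subgroup K G \<Longrightarrow> K \<subseteq> H\<^sub>1 \<inter> H\<^sub>2 \<Longrightarrow> \<phi> ` K = K \<Longrightarrow> K = {\<one>}"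
begin

lemma H\<^sub>1_carrier: "x \<in> H\<^sub>1 \<Longrightarrow> x \<in> carrier G"
  by (rule subgroup.mem_carrier[OF H\<^sub>1])

lemma H\<^sub>2_carrier: "x \<in> H\<^sub>2 \<Longrightarrow> x \<in> carrier G"
  by (rule subgroup.mem_carrier[OF H\<^sub>2])

lemma \<phi>_mult: "x \<in> H\<^sub>1 \<Longrightarrow> y \<in> H\<^sub>1 \<Longrightarrow> \<phi> (x \<otimes> y) = \<phi> x \<otimes> \<phi> y"
  using \<phi>_iso by (simp add: iso_def hom_def)

lemma \<phi>_bij: "bij_betw \<phi> H\<^sub>1 H\<^sub>2"
  using \<phi>_iso by (simp add: iso_def)

lemma \<phi>_inj: "x \<in> H\<^sub>1 \<Longrightarrow> y \<in> H\<^sub>1 \<Longrightarrow> \<phi> x = \<phi> y \<longleftrightarrow> x = y"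
  by (rule inj_on_eq_iff[OF bij_betw_imp_inj_on[OF \<phi>_bij]])

lemma \<phi>_H\<^sub>2: "x \<in> H\<^sub>1 \<Longrightarrow> \<phi> x \<in> H\<^sub>2"
  using \<phi>_bij by (auto simp: bij_betw_def)

lemma \<phi>_closed: "x \<in> H\<^sub>1 \<Longrightarrow> \<phi> x \<in> carrier G"
  by (rule H\<^sub>2_carrier[OF \<phi>_H\<^sub>2])

lemma group_hom_\<phi>: "group_hom (G\<lparr>carrier := H\<^sub>1\<rparr>) G \<phi>"
proof -
  have "group (G\<lparr>carrier := H\<^sub>1\<rparr>)" by (rule subgroup.subgroup_is_group[OF H\<^sub>1 is_group])
  moreover have "\<phi> \<in> hom (G\<lparr>carrier := H\<^sub>1\<rparr>) G"
    by (rule homI) (simp_all add: \<phi>_closed \<phi>_mult)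
  ultimately show ?thesis using is_group by (simp add: group_hom_def group_hom_axioms_def)
qed

lemma \<phi>_one: "\<phi> \<one> = \<one>"
  using group_hom.hom_one[OF group_hom_\<phi>] by simp

lemma \<phi>_inv: "x \<in> H\<^sub>1 \<Longrightarrow> \<phi> (inv x) = inv (\<phi> x)"
  using group_hom.hom_inv[OF group_hom_\<phi>, of x] m_inv_consistent[OF H\<^sub>1, of x] by simp

lemma not_in_H\<^sub>1_quotient:
  assumes "x \<in> carrier G" "y \<in> carrier G" "x \<notin> H\<^sub>1" "y \<notin> H\<^sub>1"
  shows "x \<otimes> inv y \<in> H\<^sub>1"
proof (rule ccontr)
  assume n: "x \<otimes> inv y \<notin> H\<^sub>1"
  have 1: "H\<^sub>1 #> x \<noteq> H\<^sub>1" "H\<^sub>1 #> y \<noteq> H\<^sub>1"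
    using rcos_self[OF assms(1) H\<^sub>1] rcos_self[OF assms(2) H\<^sub>1] assms(3,4) by auto
  have 2: "H\<^sub>1 #> x \<noteq> H\<^sub>1 #> y"
  proof
    assume "H\<^sub>1 #> x = H\<^sub>1 #> y"
    then have "x \<in> H\<^sub>1 #> y" using rcos_self[OF assms(1) H\<^sub>1] by simp
    then show False using n subgroup.rcos_module_imp[OF H\<^sub>1 is_group assms(2)] by blast
  qed
  have "{H\<^sub>1, H\<^sub>1 #> x, H\<^sub>1 #> y} \<subseteq> rcosets H\<^sub>1"
    using assms(1,2) subgroup.subgroup_in_rcosets[OF H\<^sub>1 is_group]
      rcosetsI[OF subgroup.subset[OF H\<^sub>1]] by auto
  moreover have "finite (rcosets H\<^sub>1)" using index_two card.infinite by fastforce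
  ultimately have "card {H\<^sub>1, H\<^sub>1 #> x, H\<^sub>1 #> y} \<le> 2"
    unfolding index_two[symmetric] by (intro card_mono)
  moreover have "card {H\<^sub>1, H\<^sub>1 #> x, H\<^sub>1 #> y} = 3" using 1 2 by (simp add: eq_commute)
  ultimately show False by simp
qed

lemma H\<^sub>1_proper: "H\<^sub>1 \<noteq> carrier G"
proof
  assume H: "H\<^sub>1 = carrier G"
  have "H\<^sub>1 #> x = H\<^sub>1" if "x \<in> carrier G" for x
    using coset_join2[OF that H\<^sub>1] that H by simp
  then have "rcosets H\<^sub>1 \<subseteq> {H\<^sub>1}" unfolding RCOSETS_def by auto
  then have "card (rcosets H\<^sub>1) \<le> 1" using card_mono[of "{H\<^sub>1}"] by simp
  then show False using index_two by simp
qed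

text \<open>The domain of the \<open>i\<close>-th power of the partial map \<open>\<phi>\<close>.\<close>

primrec pow_dom :: "nat \<Rightarrow> 'a set" where
  "pow_dom 0 = carrier G"
| "pow_dom (Suc i) = {x \<in> H\<^sub>1. \<phi> x \<in> pow_dom i}"

declare pow_dom.simps(2) [simp del]

lemma pow_dom_Suc_iff: "x \<in> pow_dom (Suc i) \<longleftrightarrow> x \<in> H\<^sub>1 \<and> \<phi> x \<in> pow_dom i"
  by (simp add: pow_dom.simps)

lemma pow_dom_subgroup: "subgroup (pow_dom i) G"
proof (induction i)
  case 0
  then show ?case by (simp add: subgroup_self)
next
  case (Suc i)
  show ?case
  proof (rule subgroupI)
    show "pow_dom (Suc i) \<subseteq> carrier G" using H\<^sub>1_carrier by (auto simp: pow_dom_Suc_iff)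
    show "pow_dom (Suc i) \<noteq> {}" using subgroup.one_closed[OF H\<^sub>1] subgroup.one_closed[OF Suc] \<phi>_one by (auto simp: pow_dom.simps(2))
    show "inv x \<in> pow_dom (Suc i)" if "x \<in> pow_dom (Suc i)" for x
      using that subgroup.m_inv_closed[OF H\<^sub>1] subgroup.m_inv_closed[OF Suc] \<phi>_inv by (simp add: pow_dom_Suc_iff)
    show "x \<otimes> y \<in> pow_dom (Suc i)" if "x \<in> pow_dom (Suc i)" "y \<in> pow_dom (Suc i)" for x y
      using that subgroup.m_closed[OF H\<^sub>1] subgroup.m_closed[OF Suc] \<phi>_mult by (simp add: pow_dom_Suc_iff)
  qed
qed

lemma pow_dom_carrier: "x \<in> pow_dom i \<Longrightarrow> x \<in> carrier G"
  by (rule subgroup.mem_carrier[OF pow_dom_subgroup])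

lemma pow_dom_Suc_subset: "pow_dom (Suc i) \<subseteq> pow_dom i"
proof (induction i)
  case 0
  then show ?case using H\<^sub>1_carrier by (auto simp: pow_dom_Suc_iff)
qed (auto simp: pow_dom_Suc_iff)

lemma inv_dom_iff: "x \<in> carrier G \<Longrightarrow> inv x \<in> pow_dom i \<longleftrightarrow> x \<in> pow_dom i"
  using subgroup.m_inv_closed[OF pow_dom_subgroup, of x i] subgroup.m_inv_closed[OF pow_dom_subgroup, of "inv x" i] by auto

lemma pow_dom_antimono: "i \<le> j \<Longrightarrow> pow_dom j \<subseteq> pow_dom i"
  using decseqD[of pow_dom] pow_dom_Suc_subset by (simp add: decseq_Suc_iff)

text \<open>Quotients of two elements, rather than cardinalities of cosets, express that the index is at most two, as
  they are pulled back along \<open>\<phi>\<close> directly.\<close>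

lemma pow_dom_index_two:
  "x \<in> pow_dom i - pow_dom (Suc i) \<Longrightarrow> y \<in> pow_dom i - pow_dom (Suc i) \<Longrightarrow> x \<otimes> inv y \<in> pow_dom (Suc i)"
proof (induction i arbitrary: x y)
  case 0
  then show ?case using not_in_H\<^sub>1_quotient[of x y] \<phi>_closed by (auto simp: pow_dom_Suc_iff)
next
  case (Suc i)
  have x: "x \<in> H\<^sub>1" "\<phi> x \<in> pow_dom i - pow_dom (Suc i)" and y: "y \<in> H\<^sub>1" "\<phi> y \<in> pow_dom i - pow_dom (Suc i)"
    using Suc.prems by (auto simp: pow_dom_Suc_iff)
  have "\<phi> (x \<otimes> inv y) \<in> pow_dom (Suc i)"
    using Suc.IH[OF x(2) y(2)] x(1) y(1) subgroup.m_inv_closed[OF H\<^sub>1] by (simp only: \<phi>_mult \<phi>_inv)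
  moreover have "x \<otimes> inv y \<in> H\<^sub>1"
    using x(1) y(1) subgroup.m_closed[OF H\<^sub>1] subgroup.m_inv_closed[OF H\<^sub>1] by simp
  ultimately show ?case by (simp add: pow_dom_Suc_iff)
qed

lemma pow_dom_stabilizes: "\<exists>i. pow_dom i = pow_dom (Suc i)"
proof (rule ccontr)
  assume n: "\<nexists>i. pow_dom i = pow_dom (Suc i)"
  have "card (pow_dom i) + i \<le> card (carrier G)" for i
  proof (induction i)
    case (Suc i)
    have "pow_dom (Suc i) \<subset> pow_dom i" using n pow_dom_Suc_subset by blast
    moreover have "finite (pow_dom i)" using finite_carrier pow_dom_carrier by (metis finite_subset subsetI)
    ultimately have "card (pow_dom (Suc i)) < card (pow_dom i)" by (rule psubset_card_mono[rotated])
    then show ?case using Suc by simp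
  qed simp
  from this[of "Suc (card (carrier G))"] show False by simp
qed

definition n :: nat where "n = (LEAST i. pow_dom i = pow_dom (Suc i))"

lemma pow_dom_n: "pow_dom n = pow_dom (Suc n)"
  unfolding n_def by (rule LeastI_ex[OF pow_dom_stabilizes])

lemma pow_dom_less_n: "i < n \<Longrightarrow> pow_dom i \<noteq> pow_dom (Suc i)"
  unfolding n_def by (rule not_less_Least)

lemma pow_dom_n_trivial: "pow_dom n = {\<one>}"
proof (rule no_invariant[OF pow_dom_subgroup])
  have "x \<in> H\<^sub>1 \<and> \<phi> x \<in> pow_dom n" if "x \<in> pow_dom n" for x
    using subsetD[OF equalityD1[OF pow_dom_n] that] pow_dom_Suc_iff[of x n] by simp
  then have sub: "pow_dom n \<subseteq> H\<^sub>1" "\<phi> ` pow_dom n \<subseteq> pow_dom n" by auto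
  have "inj_on \<phi> (pow_dom n)" by (rule inj_on_subset[OF bij_betw_imp_inj_on[OF \<phi>_bij] sub(1)])
  moreover have "finite (pow_dom n)" using finite_carrier pow_dom_carrier by (metis finite_subset subsetI)
  ultimately show eq: "\<phi> ` pow_dom n = pow_dom n" by (rule endo_inj_surj[OF _ sub(2), rotated])
  have "\<phi> ` pow_dom n \<subseteq> H\<^sub>2" using sub(1) \<phi>_H\<^sub>2 by auto
  then have "pow_dom n \<subseteq> H\<^sub>2" unfolding eq .
  then show "pow_dom n \<subseteq> H\<^sub>1 \<inter> H\<^sub>2" using sub(1) by (rule Int_greatest[rotated])
qed

lemma n_pos: "1 \<le> n"
proof (rule ccontr)
  assume "\<not> 1 \<le> n"
  then have "n = 0" by simp
  then have "carrier G = {x \<in> H\<^sub>1. \<phi> x \<in> carrier G}" using pow_dom_n by (simp add: pow_dom.simps)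
  then show False using H\<^sub>1_proper H\<^sub>1_carrier by blast
qed

text \<open>The indices start at \<open>1\<close>; truncated subtraction makes \<open>t 0 = t 1\<close>.\<close>

definition t :: "nat \<Rightarrow> 'a" where
  "t i = (\<phi> ^^ (i - 1)) (SOME x. x \<in> pow_dom (n - 1) - pow_dom n)"

lemma t_Suc: "1 \<le> i \<Longrightarrow> t (Suc i) = \<phi> (t i)"
  unfolding t_def by (cases i) auto

lemma t_dom: "1 \<le> i \<Longrightarrow> i \<le> n \<Longrightarrow> t i \<in> pow_dom (n - i) - pow_dom (Suc (n - i))"
proof (induction i rule: dec_induct)
  case base
  have "pow_dom (n - 1) - pow_dom n \<noteq> {}"
    using pow_dom_less_n[of "n - 1"] pow_dom_Suc_subset[of "n - 1"] n_pos by auto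
  then have "(SOME x. x \<in> pow_dom (n - 1) - pow_dom n) \<in> pow_dom (n - 1) - pow_dom n" by (rule some_in_eq[THEN iffD2])
  then have "t 1 \<in> pow_dom (n - 1) - pow_dom n" unfolding t_def by simp
  then show ?case using n_pos by simp
next
  case (step i)
  then have i: "t i \<in> pow_dom (Suc (n - Suc i)) - pow_dom (Suc (Suc (n - Suc i)))"
    by (simp add: Suc_diff_Suc)
  then show ?case using t_Suc[OF step(1)] by (simp add: pow_dom_Suc_iff)
qed

lemma t_H\<^sub>1: "1 \<le> i \<Longrightarrow> i < n \<Longrightarrow> t i \<in> H\<^sub>1"
  using t_dom[of i] by (cases "n - i") (auto simp: pow_dom_Suc_iff)

text \<open>Both \<open>t\<^sub>1\<close> and its inverse lie in \<open>D\<^bsub>n-1\<^esub>\<close> but not in \<open>D\<^sub>n\<close>, which has index at most two there and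
  is trivial; so their quotient \<open>t\<^sub>1\<^sup>2\<close> is trivial. The map \<open>\<phi>\<close> carries this to the other \<open>t\<^sub>i\<close>.\<close>

lemma t_sq: "1 \<le> i \<Longrightarrow> i \<le> n \<Longrightarrow> t i \<otimes> t i = \<one>"
proof (induction i rule: dec_induct)
  case base
  have t1: "t 1 \<in> pow_dom (n - 1) - pow_dom (Suc (n - 1))" using t_dom[of 1] n_pos by simp
  have c: "t 1 \<in> carrier G" using t1 pow_dom_carrier by blast
  have "inv (t 1) \<in> pow_dom (n - 1) - pow_dom (Suc (n - 1))" using t1 inv_dom_iff[OF c] by simp
  then have "t 1 \<otimes> inv (inv (t 1)) \<in> pow_dom (Suc (n - 1))"
    by (rule pow_dom_index_two[OF t1])
  then show ?case using c n_pos pow_dom_n_trivial by simp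
next
  case (step i)
  then have "t i \<in> H\<^sub>1" using t_H\<^sub>1 by simp
  then show ?case using step \<phi>_mult[of "t i" "t i"] t_Suc \<phi>_one by simp
qed

sublocale S: involution_sequence G t n
proof unfold_locales
  fix i assume i: "1 \<le> i" "i \<le> n"
  show "t i \<in> carrier G" using t_dom[OF i] pow_dom_carrier[of "t i" "n - i"] by simp
  show "t i \<otimes> t i = \<one>" by (rule t_sq[OF i])
qed

text \<open>At each step the index of consecutive domains is at most two, and \<open>t\<^sub>b\<close> is in the larger but not in
  the smaller one.\<close>

lemma seg_dom: "b \<le> n \<Longrightarrow> S.seg 1 b = pow_dom (n - b)"
proof (induction b)
  case 0
  then show ?case using S.seg_empty[of 0 1] pow_dom_n_trivial by simp
next
  case (Suc b)
  have tb: "t (Suc b) \<in> pow_dom (n - Suc b) - pow_dom (Suc (n - Suc b))" using t_dom[of "Suc b"] Suc.prems by simp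
  have eq: "Suc (n - Suc b) = n - b" using Suc.prems by simp
  show ?case
  proof
    have "t ` {1..Suc b} \<subseteq> pow_dom (n - Suc b)"
    proof
      fix x assume "x \<in> t ` {1..Suc b}"
      then obtain i where i: "x = t i" "1 \<le> i" "i \<le> Suc b" by auto
      have "t i \<in> pow_dom (n - i)" using t_dom[of i] i Suc.prems by simp
      moreover have "pow_dom (n - i) \<subseteq> pow_dom (n - Suc b)" using i by (intro pow_dom_antimono) simp
      ultimately show "x \<in> pow_dom (n - Suc b)" using i by blast
    qed
    then show "S.seg 1 (Suc b) \<subseteq> pow_dom (n - Suc b)"
      unfolding S.seg_def by (rule generate_subgroup_incl[OF _ pow_dom_subgroup])
    show "pow_dom (n - Suc b) \<subseteq> S.seg 1 (Suc b)"
    proof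
      fix x assume x: "x \<in> pow_dom (n - Suc b)"
      have c: "x \<in> carrier G" "t (Suc b) \<in> carrier G" using x tb pow_dom_carrier by auto
      have seg: "y \<in> S.seg 1 (Suc b)" if "y \<in> pow_dom (Suc (n - Suc b))" for y
        using that Suc S.seg_mono[of y 1 b 1 "Suc b"] eq by simp
      show "x \<in> S.seg 1 (Suc b)"
      proof (cases "x \<in> pow_dom (Suc (n - Suc b))")
        case True
        then show ?thesis by (rule seg)
      next
        case False
        then have "x \<otimes> inv (t (Suc b)) \<in> S.seg 1 (Suc b)"
          using x tb by (intro seg pow_dom_index_two) auto
        then have "x \<otimes> inv (t (Suc b)) \<otimes> t (Suc b) \<in> S.seg 1 (Suc b)"
          by (rule S.seg_mult[rotated 2, OF _ S.t_in_seg]) (use Suc.prems in auto)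
        then show ?thesis using c by (simp add: m_assoc)
      qed
    qed
  qed
qed

lemma seg_all: "S.seg 1 n = carrier G"
  using seg_dom[of n] by simp

lemma seg_H\<^sub>1:
  assumes "1 \<le> a" "b < n" "x \<in> S.seg a b" shows "x \<in> H\<^sub>1"
proof -
  have "x \<in> S.seg 1 b" using assms S.seg_mono by blast
  then have "x \<in> pow_dom (n - b)" using seg_dom assms by simp
  then show ?thesis using assms by (cases "n - b") (auto simp: pow_dom_Suc_iff)
qed

lemma seg_eq_H\<^sub>1: "S.seg 1 (n - 1) = H\<^sub>1"
  using seg_dom[of "n - 1"] n_pos \<phi>_closed by (auto simp: pow_dom_Suc_iff)

lemma \<phi>_seg:
  assumes "1 \<le> a" "b < n" shows "\<phi> ` S.seg a b = S.seg (Suc a) (Suc b)"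
proof -
  have sub: "t ` {a..b} \<subseteq> H\<^sub>1" using assms t_H\<^sub>1 by auto
  have "\<phi> ` generate (G\<lparr>carrier := H\<^sub>1\<rparr>) (t ` {a..b}) = generate G (\<phi> ` t ` {a..b})"
    using group_hom.generate_img[OF group_hom_\<phi>, of "t ` {a..b}"] sub by simp
  moreover have "generate (G\<lparr>carrier := H\<^sub>1\<rparr>) (t ` {a..b}) = generate G (t ` {a..b})"
    using generate_consistent[OF sub H\<^sub>1] by simp
  moreover have "\<phi> ` t ` {a..b} = t ` {Suc a..Suc b}"
  proof -
    have "\<phi> ` t ` {a..b} = (\<lambda>i. t (Suc i)) ` {a..b}"
      unfolding image_image using assms t_Suc by (intro image_cong) auto
    also have "\<dots> = t ` Suc ` {a..b}" by (simp only: image_image)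
    finally show ?thesis by (simp only: image_Suc_atLeastAtMost)
  qed
  ultimately show ?thesis unfolding S.seg_def by simp
qed

lemma \<phi>_seg_iff:
  assumes "1 \<le> a" "b < n" "x \<in> H\<^sub>1"
  shows "\<phi> x \<in> S.seg (Suc a) (Suc b) \<longleftrightarrow> x \<in> S.seg a b"
proof -
  have "\<phi> x \<in> \<phi> ` S.seg a b \<longleftrightarrow> x \<in> S.seg a b"
  proof
    assume "\<phi> x \<in> \<phi> ` S.seg a b"
    then obtain y where y: "y \<in> S.seg a b" "\<phi> x = \<phi> y" by blast
    then show "x \<in> S.seg a b" using \<phi>_inj[OF assms(3) seg_H\<^sub>1[OF assms(1,2) y(1)]] by simp
  qed simp
  then show ?thesis using \<phi>_seg assms by simp
qed

lemma peel_right_one: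
  assumes "1 \<le> b" "b \<le> n" "x \<in> S.seg 1 b"
  shows "x \<in> S.seg 1 (b - 1) \<or> (\<exists>y\<in>S.seg 1 (b - 1). x = t b \<otimes> y)"
proof (cases "x \<in> S.seg 1 (b - 1)")
  case False
  have seg: "S.seg 1 (b - 1) = pow_dom (Suc (n - b))" using seg_dom[of "b - 1"] assms by (simp add: Suc_diff_le)
  have tb: "t b \<in> pow_dom (n - b) - pow_dom (Suc (n - b))" using t_dom assms by simp
  have x: "x \<in> pow_dom (n - b) - pow_dom (Suc (n - b))" using False assms seg seg_dom by auto
  have c: "x \<in> carrier G" "t b \<in> carrier G" using x tb pow_dom_carrier by auto
  have "inv x \<in> pow_dom (n - b) - pow_dom (Suc (n - b))"
    using x inv_dom_iff[OF c(1)] by simp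
  then have "t b \<otimes> inv (inv x) \<in> pow_dom (Suc (n - b))" by (rule pow_dom_index_two[OF tb])
  then have "t b \<otimes> x \<in> S.seg 1 (b - 1)" using seg c by simp
  moreover have "x = t b \<otimes> (t b \<otimes> x)" using S.t_cancel assms c by simp
  ultimately show ?thesis by blast
qed simp

lemma finite_seg: "1 \<le> a \<Longrightarrow> b \<le> n \<Longrightarrow> finite (S.seg a b)"
  using finite_subset[OF _ finite_carrier] S.seg_carrier by (metis subsetI)

lemma t_last_not_seg: "1 \<le> b \<Longrightarrow> b \<le> n \<Longrightarrow> t b \<notin> S.seg 1 (b - 1)"
  using seg_dom[of "b - 1"] t_dom[of b] by (simp add: Suc_diff_le)

lemma card_seg: "b \<le> n \<Longrightarrow> card (S.seg 1 b) = 2 ^ b"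
proof (induction b)
  case 0
  then show ?case using S.seg_empty[of 0 1] by simp
next
  case (Suc b)
  let ?K = "S.seg 1 b" and ?s = "t (Suc b)"
  have s: "?s \<in> carrier G" using S.t_closed Suc.prems by simp
  have car: "x \<in> carrier G" if "x \<in> ?K" for x using S.seg_carrier[OF _ _ that] Suc.prems by simp
  have "S.seg 1 (Suc b) = ?K \<union> (\<lambda>x. ?s \<otimes> x) ` ?K"
  proof
    show "S.seg 1 (Suc b) \<subseteq> ?K \<union> (\<lambda>x. ?s \<otimes> x) ` ?K"
      using peel_right_one[of "Suc b"] Suc.prems by auto
    have "x \<in> S.seg 1 (Suc b)" "?s \<otimes> x \<in> S.seg 1 (Suc b)" if "x \<in> ?K" for x
    proof -
      show x: "x \<in> S.seg 1 (Suc b)" using S.seg_mono[OF that] by simp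
      show "?s \<otimes> x \<in> S.seg 1 (Suc b)"
        by (rule S.seg_mult[OF _ _ S.t_in_seg x]) (use Suc.prems in auto)
    qed
    then show "?K \<union> (\<lambda>x. ?s \<otimes> x) ` ?K \<subseteq> S.seg 1 (Suc b)" by blast
  qed
  moreover have "?K \<inter> (\<lambda>x. ?s \<otimes> x) ` ?K = {}"
  proof -
    have "?s \<otimes> x \<notin> ?K" if "x \<in> ?K" for x
    proof
      assume "?s \<otimes> x \<in> ?K"
      then have "?s \<otimes> x \<otimes> inv x \<in> ?K"
        using that Suc.prems by (intro S.seg_mult[of _ _ "?s \<otimes> x"] S.seg_inv) auto
      then show False using t_last_not_seg[of "Suc b"] Suc.prems s car[OF that] by (simp add: m_assoc)
    qed
    then show ?thesis by blast
  qed
  moreover have "inj_on (\<lambda>x. ?s \<otimes> x) ?K" using s car by (intro inj_onI) simp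
  moreover have "finite ?K" using finite_seg Suc.prems by simp
  ultimately show ?case using Suc by (simp add: card_Un_disjoint card_image)
qed

lemma card_seg_two: "1 \<le> b \<Longrightarrow> b \<le> n \<Longrightarrow> card (S.seg 2 b) = 2 ^ (b - 1)"
proof -
  assume b: "1 \<le> b" "b \<le> n"
  have "S.seg 2 b = \<phi> ` S.seg 1 (b - 1)"
    using \<phi>_seg[of 1 "b - 1"] b by (simp add: numeral_2_eq_2)
  moreover have "inj_on \<phi> (S.seg 1 (b - 1))"
    using seg_H\<^sub>1[of 1 "b - 1"] b \<phi>_inj by (intro inj_onI) auto
  ultimately show ?thesis using card_seg[of "b - 1"] b by (simp add: card_image)
qed

text \<open>Otherwise \<open>\<langle>t\<^sub>1, \<dots>, t\<^sub>b\<rangle>\<close> would equal \<open>\<langle>t\<^sub>2, \<dots>, t\<^sub>b\<rangle>\<close>, whose order is that of its preimage \<open>\<langle>t\<^sub>1, \<dots>, t\<^bsub>b-1\<^esub>\<rangle>\<close> under \<open>\<phi>\<close>.\<close>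

lemma t_first_not_seg:
  assumes "1 \<le> b" "b \<le> n" shows "t 1 \<notin> S.seg 2 b"
proof
  assume t1: "t 1 \<in> S.seg 2 b"
  have "t ` {1..b} \<subseteq> S.seg 2 b"
  proof
    fix x assume "x \<in> t ` {1..b}"
    then obtain i where "x = t i" "1 \<le> i" "i \<le> b" by auto
    then show "x \<in> S.seg 2 b" using t1 S.t_in_seg[of 2 i b] by (cases "i = 1") auto
  qed
  then have "S.seg 1 b \<subseteq> S.seg 2 b"
    unfolding S.seg_def[of 1] using S.seg_subgroup[of 2 b] assms generate_subgroup_incl by simp
  then have "card (S.seg 1 b) \<le> card (S.seg 2 b)"
    by (rule card_mono[OF finite_seg[OF one_le_numeral assms(2)]])
  then have "(2::nat) ^ b \<le> 2 ^ (b - 1)"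
    by (simp only: card_seg[OF assms(2)] card_seg_two[OF assms])
  moreover have "(2::nat) ^ (b - 1) < 2 ^ b" using assms(1) by simp
  ultimately show False by (simp only: leD)
qed

text \<open>The chain of domains only gives the peeling on the right. On the left, \<open>\<langle>t\<^sub>2, \<dots>, t\<^sub>b\<rangle>\<close> and its coset
  by \<open>t\<^sub>1\<close> are disjoint and, by their cardinalities, fill \<open>\<langle>t\<^sub>1, \<dots>, t\<^sub>b\<rangle>\<close>.\<close>

lemma peel_left_one:
  assumes b: "1 \<le> b" "b \<le> n" and x: "x \<in> S.seg 1 b"
  shows "x \<in> S.seg 2 b \<or> (\<exists>y\<in>S.seg 2 b. x = t 1 \<otimes> y)"
proof -
  let ?K = "S.seg 2 b"
  have s: "t 1 \<in> carrier G" using S.t_closed n_pos by simp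
  have car: "x \<in> carrier G" if "x \<in> ?K" for x using S.seg_carrier[OF _ _ that] b by simp
  have fin: "finite (S.seg 1 b)" using finite_seg b by simp
  have K: "?K \<subseteq> S.seg 1 b" using S.seg_mono by fastforce
  have "t 1 \<otimes> y \<in> S.seg 1 b" if "y \<in> ?K" for y
    by (rule S.seg_mult[OF _ _ S.t_in_seg]) (use b K that in auto)
  then have sub: "?K \<union> (\<lambda>y. t 1 \<otimes> y) ` ?K \<subseteq> S.seg 1 b" using K by blast
  have disj: "?K \<inter> (\<lambda>y. t 1 \<otimes> y) ` ?K = {}"
  proof -
    have "t 1 \<otimes> y \<notin> ?K" if "y \<in> ?K" for y
    proof
      assume "t 1 \<otimes> y \<in> ?K"
      then have "t 1 \<otimes> y \<otimes> inv y \<in> ?K"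
        using that b by (intro S.seg_mult[of _ _ "t 1 \<otimes> y"] S.seg_inv) auto
      then show False using t_first_not_seg b s car[OF that] by (simp add: m_assoc)
    qed
    then show ?thesis by blast
  qed
  have inj: "inj_on (\<lambda>y. t 1 \<otimes> y) ?K" using s car by (intro inj_onI) simp
  have finK: "finite ?K" using finite_seg b by simp
  have "card (?K \<union> (\<lambda>y. t 1 \<otimes> y) ` ?K) = 2 ^ (b - 1) + 2 ^ (b - 1)"
    using card_Un_disjoint[OF finK finite_imageI[OF finK] disj] card_image[OF inj] card_seg_two[OF b] by simp
  also have "\<dots> = 2 ^ b" using b by (cases b) auto
  finally have "?K \<union> (\<lambda>y. t 1 \<otimes> y) ` ?K = S.seg 1 b"
    using card_subset_eq[OF fin sub] card_seg b by simp
  then show ?thesis using x by blast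
qed

text \<open>The map \<open>\<phi>\<close> carries the two ways of peeling \<open>\<langle>t\<^sub>1, \<dots>, t\<^sub>b\<rangle>\<close> to all later segments.\<close>

lemma peel_shift:
  assumes "1 \<le> a" "a \<le> b" "b \<le> n" "x \<in> S.seg a b"
  shows "(x \<in> S.seg (Suc a) b \<or> (\<exists>y\<in>S.seg (Suc a) b. x = t a \<otimes> y)) \<and>
    (x \<in> S.seg a (b - 1) \<or> (\<exists>y\<in>S.seg a (b - 1). x = t b \<otimes> y))"
  using assms
proof (induction a arbitrary: b x rule: dec_induct)
  case base
  then show ?case using peel_left_one peel_right_one by (simp add: numeral_2_eq_2)
next
  case (step a)
  define c where "c = b - 1"
  have c: "b = Suc c" "a \<le> c" "c < n" using step by (auto simp: c_def)
  obtain x' where x': "x' \<in> S.seg a c" "x = \<phi> x'"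
    using step.prems \<phi>_seg[of a c] step(1) c by auto
  note IH = step.IH[OF c(2) less_imp_le[OF c(3)] x'(1)]
  have im: "\<phi> y \<in> S.seg (Suc u) (Suc v)" if "y \<in> S.seg u v" "1 \<le> u" "v < n" for u v y
    using that \<phi>_seg[of u v] by blast
  have tH: "t a \<in> H\<^sub>1" "t c \<in> H\<^sub>1" using t_H\<^sub>1 step(1) c by auto
  have "\<phi> x' \<in> S.seg (Suc (Suc a)) (Suc c) \<or> (\<exists>y\<in>S.seg (Suc (Suc a)) (Suc c). \<phi> x' = t (Suc a) \<otimes> y)"
    using IH[THEN conjunct1]
  proof
    assume "x' \<in> S.seg (Suc a) c"
    then show ?thesis using im[of x' "Suc a" c] c by simp
  next
    assume "\<exists>y\<in>S.seg (Suc a) c. x' = t a \<otimes> y"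
    then obtain y where y: "y \<in> S.seg (Suc a) c" "x' = t a \<otimes> y" by blast
    have "y \<in> H\<^sub>1" using seg_H\<^sub>1[OF _ _ y(1)] c by simp
    then have "\<phi> x' = t (Suc a) \<otimes> \<phi> y" using y tH \<phi>_mult t_Suc step(1) by simp
    moreover have "\<phi> y \<in> S.seg (Suc (Suc a)) (Suc c)" using im[OF y(1)] c by simp
    ultimately show ?thesis by blast
  qed
  moreover have "\<phi> x' \<in> S.seg (Suc a) c \<or> (\<exists>y\<in>S.seg (Suc a) c. \<phi> x' = t (Suc c) \<otimes> y)"
    using IH[THEN conjunct2]
  proof
    assume "x' \<in> S.seg a (c - 1)"
    then show ?thesis using im[of x' a "c - 1"] c step(1) by simp
  next
    assume "\<exists>y\<in>S.seg a (c - 1). x' = t c \<otimes> y"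
    then obtain y where y: "y \<in> S.seg a (c - 1)" "x' = t c \<otimes> y" by blast
    have "y \<in> H\<^sub>1" using seg_H\<^sub>1[OF _ _ y(1)] c step(1) by simp
    then have "\<phi> x' = t (Suc c) \<otimes> \<phi> y" using y tH \<phi>_mult t_Suc[of c] step(1) c by simp
    moreover have "\<phi> y \<in> S.seg (Suc a) c" using im[OF y(1)] c step(1) by simp
    ultimately show ?thesis by blast
  qed
  ultimately show ?case using c x' by simp
qed

lemma br_in_H\<^sub>1: "1 \<le> i \<Longrightarrow> i < n \<Longrightarrow> 1 \<le> j \<Longrightarrow> j < n \<Longrightarrow> S.br i j \<in> H\<^sub>1"
  unfolding S.br_def using t_H\<^sub>1 subgroup.m_closed[OF H\<^sub>1] by simp

lemma br_Suc: "1 \<le> i \<Longrightarrow> i < n \<Longrightarrow> 1 \<le> j \<Longrightarrow> j < n \<Longrightarrow> S.br (Suc i) (Suc j) = \<phi> (S.br i j)"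
  unfolding S.br_def using t_H\<^sub>1 subgroup.m_closed[OF H\<^sub>1] \<phi>_mult t_Suc by simp

text \<open>The generator left out at either end normalises the remaining segment of index two, so the commutator lies in
  \<open>\<langle>t\<^sub>2, \<dots>, t\<^sub>j\<rangle>\<close> and in \<open>\<langle>t\<^sub>1, \<dots>, t\<^bsub>j-1\<^esub>\<rangle>\<close>. Peeling off \<open>t\<^sub>j\<close> identifies the intersection.\<close>

lemma br_one_seg:
  assumes j: "1 < j" "j \<le> n"
  shows "S.br 1 j \<in> S.seg 2 (j - 1)"
proof -
  have c: "t 1 \<in> carrier G" "t j \<in> carrier G" using S.t_closed j by auto
  have t: "t 1 \<in> S.seg 1 j" "t j \<in> S.seg 1 j" "t j \<in> S.seg 2 j" using S.t_in_seg j by auto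
  have m3: "x \<otimes> y \<otimes> z \<in> S.seg 1 j" if "x \<in> S.seg 1 j" "y \<in> S.seg 1 j" "z \<in> S.seg 1 j" for x y z
    using that j by (intro S.seg_mult) auto
  have conj1: "t 1 \<otimes> t j \<otimes> t 1 \<in> S.seg 2 j"
  proof (rule ccontr)
    assume "\<not> ?thesis"
    then obtain y where y: "y \<in> S.seg 2 j" "t 1 \<otimes> t j \<otimes> t 1 = t 1 \<otimes> y"
      using peel_left_one[of j] m3[OF t(1) t(2) t(1)] j by auto
    have cy: "y \<in> carrier G" using S.seg_carrier[OF _ _ y(1)] j by simp
    have "t j \<otimes> t 1 = y" using y(2) c cy by (simp add: m_assoc)
    then have "t 1 = t j \<otimes> y" using S.t_cancel j c by fastforce
    also have "\<dots> \<in> S.seg 2 j" using y t j by (intro S.seg_mult) auto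
    finally show False using t_first_not_seg j by simp
  qed
  have conj2: "t j \<otimes> t 1 \<otimes> t j \<in> S.seg 1 (j - 1)"
  proof (rule ccontr)
    assume "\<not> ?thesis"
    then obtain y where y: "y \<in> S.seg 1 (j - 1)" "t j \<otimes> t 1 \<otimes> t j = t j \<otimes> y"
      using peel_right_one[of j] m3[OF t(2) t(1) t(2)] j by auto
    have cy: "y \<in> carrier G" using S.seg_carrier[OF _ _ y(1)] j by simp
    have "t 1 \<otimes> t j = y" using y(2) c cy by (simp add: m_assoc)
    then have "t j = t 1 \<otimes> y" using S.t_cancel[of 1] j c by fastforce
    also have "\<dots> \<in> S.seg 1 (j - 1)"
      by (rule S.seg_mult[OF _ _ S.t_in_seg y(1)]) (use j in auto)
    finally show False using t_last_not_seg j by simp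
  qed
  have b2: "S.br 1 j \<in> S.seg 2 j"
    unfolding S.br_def by (rule S.seg_mult[OF _ _ conj1 t(3)]) (use j in auto)
  have "S.br 1 j = t 1 \<otimes> (t j \<otimes> t 1 \<otimes> t j)" unfolding S.br_def using c by (simp add: m_assoc)
  also have "\<dots> \<in> S.seg 1 (j - 1)"
    by (rule S.seg_mult[OF _ _ S.t_in_seg conj2]) (use j in auto)
  finally have b1: "S.br 1 j \<in> S.seg 1 (j - 1)" .
  from peel_shift[OF _ _ _ b2, THEN conjunct2] j
  have "S.br 1 j \<in> S.seg 2 (j - 1) \<or> (\<exists>y\<in>S.seg 2 (j - 1). S.br 1 j = t j \<otimes> y)" by simp
  then show ?thesis
  proof
    assume "\<exists>y\<in>S.seg 2 (j - 1). S.br 1 j = t j \<otimes> y"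
    then obtain y where y: "y \<in> S.seg 2 (j - 1)" "S.br 1 j = t j \<otimes> y" by blast
    have cy: "y \<in> carrier G" using S.seg_carrier[OF _ _ y(1)] j by simp
    have "S.br 1 j \<otimes> inv y \<in> S.seg 1 (j - 1)"
      by (rule S.seg_mult[OF _ _ b1 S.seg_inv[OF _ _ S.seg_mono[OF y(1)]]]) (use j in auto)
    then have "t j \<in> S.seg 1 (j - 1)" using y(2) cy c by (simp add: m_assoc)
    then show ?thesis using t_last_not_seg j by simp
  qed
qed

lemma br_seg: "1 \<le> i \<Longrightarrow> i < j \<Longrightarrow> j \<le> n \<Longrightarrow> S.br i j \<in> S.seg (Suc i) (j - 1)"
proof (induction i arbitrary: j rule: dec_induct)
  case base
  then show ?case using br_one_seg by (simp add: numeral_2_eq_2)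
next
  case (step i)
  define k where "k = j - 1"
  have k: "j = Suc k" "i < k" "k < n" using step by (auto simp: k_def)
  have "S.br i k \<in> S.seg (Suc i) (k - 1)" using step.IH k by simp
  then have "\<phi> (S.br i k) \<in> S.seg (Suc (Suc i)) (Suc (k - 1))"
    using \<phi>_seg_iff[of "Suc i" "k - 1"] br_in_H\<^sub>1[of i k] k step(1) by simp
  then show ?case using br_Suc[of i k] k step(1) by simp
qed

text \<open>If two translates of a commutator agree, it is fixed by a positive power of \<open>\<phi>\<close>. It then lies in the domains
  of all powers of \<open>\<phi>\<close>, and these are eventually trivial.\<close>

lemma br_distinct:
  assumes "1 \<le> i" "i < j" "1 \<le> d" "j + d \<le> n" and eq: "S.br i (i + d) = S.br j (j + d)"
  shows "S.br i (i + d) = \<one>"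
proof -
  let ?x = "S.br i (i + d)"
  have shift: "S.br (i + s) (i + s + d) \<in> pow_dom k \<longleftrightarrow> ?x \<in> pow_dom (k + s)" if "i + s + d \<le> n" for s k
    using that
  proof (induction s arbitrary: k)
    case (Suc s)
    have "S.br (i + s) (i + s + d) \<in> H\<^sub>1" using Suc.prems assms by (intro br_in_H\<^sub>1) auto
    then have "S.br (i + Suc s) (i + Suc s + d) \<in> pow_dom k \<longleftrightarrow> S.br (i + s) (i + s + d) \<in> pow_dom (Suc k)"
      using br_Suc[of "i + s" "i + s + d"] Suc.prems assms pow_dom_Suc_iff by simp
    then show ?case using Suc by simp
  qed simp
  have step: "?x \<in> pow_dom k \<longleftrightarrow> ?x \<in> pow_dom (k + (j - i))" for k
    using shift[of "j - i" k] assms by simp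
  have "?x \<in> pow_dom (q * (j - i))" for q
  proof (induction q)
    case 0
    then show ?case using S.br_closed[of i "i + d"] assms by simp
  next
    case (Suc q)
    then show ?case using step[of "q * (j - i)"] by (simp add: add.commute)
  qed
  then have "?x \<in> pow_dom (n * (j - i))" .
  moreover have "pow_dom (n * (j - i)) \<subseteq> pow_dom n" using assms by (intro pow_dom_antimono) simp
  ultimately have "?x \<in> pow_dom n" by blast
  then show ?thesis using pow_dom_n_trivial by simp
qed

lemma br_one_iff: "1 \<le> i \<Longrightarrow> 1 \<le> d \<Longrightarrow> i + d \<le> n \<Longrightarrow> S.br i (i + d) = \<one> \<longleftrightarrow> S.br 1 (1 + d) = \<one>"
proof (induction i rule: dec_induct)
  case (step i)
  have H: "S.br i (i + d) \<in> H\<^sub>1" using step by (intro br_in_H\<^sub>1) auto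
  have "S.br (Suc i) (Suc i + d) = \<phi> (S.br i (i + d))" using br_Suc[of i "i + d"] step by simp
  then show ?case using step \<phi>_inj[OF H subgroup.one_closed[OF H\<^sub>1]] \<phi>_one by simp
qed simp

lemma narrow_sequence_least:
  assumes m: "1 \<le> m" "1 + m \<le> n" "S.br 1 (1 + m) \<noteq> \<one>"
    and least: "\<And>d. 1 \<le> d \<Longrightarrow> d < m \<Longrightarrow> S.br 1 (1 + d) = \<one>"
  shows "narrow_sequence G t n m"
proof unfold_locales
  show "1 \<le> m" by fact
  fix a b x assume "1 \<le> a" "a \<le> b" "b \<le> n" "x \<in> S.seg a b"
  from peel_shift[OF this]
  show "x \<in> S.seg (Suc a) b \<or> (\<exists>y\<in>S.seg (Suc a) b. x = t a \<otimes> y)"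
    "x \<in> S.seg a (b - 1) \<or> (\<exists>y\<in>S.seg a (b - 1). x = t b \<otimes> y)" by auto
next
  fix i j assume ij: "1 \<le> i" "i < j" "j \<le> n"
  then show "S.br i j \<in> S.seg (Suc i) (j - 1)" by (rule br_seg)
  assume "j < i + m"
  then have "S.br i (i + (j - i)) = \<one>" using least[of "j - i"] ij by (subst br_one_iff) auto
  then show "t i \<otimes> t j = t j \<otimes> t i" using S.br_eq_one_iff[of i j] ij by simp
next
  fix i assume "1 \<le> i" "i + m \<le> n"
  then show "S.br i (i + m) \<noteq> \<one>" using br_one_iff[of i m] m by simp
next
  fix i j assume i: "1 \<le> i" "i < j" "j + m \<le> n"
  then have "S.br i (i + m) \<noteq> \<one>" using br_one_iff[of i m] m by simp
  then show "S.br i (i + m) \<noteq> S.br j (j + m)" using br_distinct[OF i(1,2) m(1) i(3)] by blast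
next
  fix i j a b :: nat assume i: "1 \<le> i" "i + j < n" "1 \<le> a" "b < n"
  show "S.br (Suc i) (Suc i + j) \<in> S.seg (Suc a) (Suc b) \<longleftrightarrow> S.br i (i + j) \<in> S.seg a b"
    using br_Suc[of i "i + j"] \<phi>_seg_iff[OF i(3,4) br_in_H\<^sub>1[of i "i + j"]] i by simp
qed

end


section \<open>The groups \<open>G\<^bsub>n,k,\<epsilon>\<^esub>\<close>\<close>

text \<open>The defining relations of \<open>G\<^bsub>n,k,\<epsilon>\<^esub>\<close> as a property of a sequence of elements of an arbitrary group, so
  that they can be stated both for the generators of \<open>G\<^bsub>n,k,\<epsilon>\<^esub>\<close> and for the involutions found in \<open>G\<close>.\<close>

definition satisfies_relations ::
    "('a, 'm) monoid_scheme \<Rightarrow> (nat \<Rightarrow> 'a) \<Rightarrow> nat \<Rightarrow> nat \<Rightarrow> (nat \<Rightarrow> nat \<Rightarrow> nat) \<Rightarrow> bool" where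
  "satisfies_relations K s n k \<epsilon> \<longleftrightarrow>
    (\<forall>i. 1 \<le> i \<longrightarrow> i \<le> n \<longrightarrow> s i \<otimes>\<^bsub>K\<^esub> s i = \<one>\<^bsub>K\<^esub>) \<and>
    (\<forall>i j. 1 \<le> i \<longrightarrow> i + j \<le> n \<longrightarrow> 0 < j \<longrightarrow> j < n - k \<longrightarrow> commutator K (s i) (s (i + j)) = \<one>\<^bsub>K\<^esub>) \<and>
    (\<forall>i j. 1 \<le> i \<longrightarrow> i < i + j \<longrightarrow> i + j \<le> n \<longrightarrow> n - k \<le> j \<longrightarrow> j \<le> n - 1 \<longrightarrow>
       commutator K (s i) (s (i + j)) =
       foldr (\<lambda>l p. s (i + l) [^]\<^bsub>K\<^esub> \<epsilon> j l \<otimes>\<^bsub>K\<^esub> p) [k..<Suc (j - k)] \<one>\<^bsub>K\<^esub>)"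

lemma (in group_hom) hom_commutator:
  "x \<in> carrier G \<Longrightarrow> y \<in> carrier G \<Longrightarrow> h (commutator G x y) = commutator H (h x) (h y)"
  by (simp add: commutator_def)

lemma (in Group.monoid) foldr_pow_closed:
  "\<forall>l\<in>set ls. x l \<in> carrier G \<Longrightarrow>
    foldr (\<lambda>l p. x l [^] (e l :: nat) \<otimes> p) ls \<one> \<in> carrier G"
  by (induction ls) auto

lemma (in group_hom) hom_foldr:
  "\<forall>l\<in>set ls. x l \<in> carrier G \<Longrightarrow>
    h (foldr (\<lambda>l p. x l [^] (e l :: nat) \<otimes> p) ls \<one>) =
    foldr (\<lambda>l p. h (x l) [^]\<^bsub>H\<^esub> e l \<otimes>\<^bsub>H\<^esub> p) ls \<one>\<^bsub>H\<^esub>"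
  by (induction ls) (auto simp: hom_nat_pow G.foldr_pow_closed)

text \<open>The relators of \<open>G\<^bsub>n,k,\<epsilon>\<^esub>\<close> are elements of the free group; under a homomorphism they become the
  quotients of the two sides of the relations.\<close>

lemma relators_vanish_iff:
  assumes hom: "group_hom (free_group {1..n}) H h" and k: "0 < n" "2 * k < n"
  shows "(\<forall>r\<in>Gnk_relators n k \<epsilon>. h r = \<one>\<^bsub>H\<^esub>) \<longleftrightarrow>
    satisfies_relations H (\<lambda>i. h (free_gen {1..n} i)) n k \<epsilon>"
proof -
  let ?F = "free_group {1..n}" and ?t = "free_gen {1..n}"
  interpret group_hom ?F H h by (rule hom)
  have t: "?t i \<in> carrier ?F" if "1 \<le> i" "i \<le> n" for i
    using that free_gen_closed[of i "{1..n}"] by simp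
  have 1: "h (?t i [^]\<^bsub>?F\<^esub> (2::nat)) = h (?t i) \<otimes>\<^bsub>H\<^esub> h (?t i)" if "1 \<le> i" "i \<le> n" for i
    using t[OF that] by (simp add: numeral_2_eq_2 del: One_nat_def)
  have 2: "h (commutator ?F (?t i) (?t (i + j))) = commutator H (h (?t i)) (h (?t (i + j)))"
    if "1 \<le> i" "i + j \<le> n" for i j
    using t that by (intro hom_commutator) auto
  have 3: "h (commutator ?F (?t i) (?t (i + j)) \<otimes>\<^bsub>?F\<^esub>
      inv\<^bsub>?F\<^esub> (foldr (\<lambda>l p. ?t (i + l) [^]\<^bsub>?F\<^esub> \<epsilon> j l \<otimes>\<^bsub>?F\<^esub> p) [k..<Suc (j - k)] \<one>\<^bsub>?F\<^esub>)) = \<one>\<^bsub>H\<^esub>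
    \<longleftrightarrow> commutator H (h (?t i)) (h (?t (i + j))) =
      foldr (\<lambda>l p. h (?t (i + l)) [^]\<^bsub>H\<^esub> \<epsilon> j l \<otimes>\<^bsub>H\<^esub> p) [k..<Suc (j - k)] \<one>\<^bsub>H\<^esub>"
    if ij: "1 \<le> i" "i + j \<le> n" "n - k \<le> j" for i j
  proof -
    define f where "f = foldr (\<lambda>l p. ?t (i + l) [^]\<^bsub>?F\<^esub> \<epsilon> j l \<otimes>\<^bsub>?F\<^esub> p) [k..<Suc (j - k)] \<one>\<^bsub>?F\<^esub>"
    define f' where "f' = foldr (\<lambda>l p. h (?t (i + l)) [^]\<^bsub>H\<^esub> \<epsilon> j l \<otimes>\<^bsub>H\<^esub> p) [k..<Suc (j - k)] \<one>\<^bsub>H\<^esub>"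
    have ls: "\<forall>l\<in>set [k..<Suc (j - k)]. ?t (i + l) \<in> carrier ?F"
    proof
      fix l assume "l \<in> set [k..<Suc (j - k)]"
      then have "l \<le> j" by auto
      then show "?t (i + l) \<in> carrier ?F" using ij by (intro t) auto
    qed
    have f: "f \<in> carrier ?F" "h f = f'"
      unfolding f_def f'_def by (rule G.foldr_pow_closed[OF ls], rule hom_foldr[OF ls])
    define c where "c = commutator ?F (?t i) (?t (i + j))"
    define c' where "c' = commutator H (h (?t i)) (h (?t (i + j)))"
    have "?t i \<in> carrier ?F" "?t (i + j) \<in> carrier ?F" using t ij by auto
    then have c: "c \<in> carrier ?F" "h c = c'"
      using 2[OF ij(1,2)] unfolding c_def c'_def by (simp_all add: commutator_def del: One_nat_def)
    have c': "c' \<in> carrier H" "f' \<in> carrier H" using c f hom_closed by blast+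
    have "h (c \<otimes>\<^bsub>?F\<^esub> inv\<^bsub>?F\<^esub> f) = c' \<otimes>\<^bsub>H\<^esub> inv\<^bsub>H\<^esub> f'"
      using f c by (simp del: One_nat_def)
    moreover have "c' \<otimes>\<^bsub>H\<^esub> inv\<^bsub>H\<^esub> f' = \<one>\<^bsub>H\<^esub> \<longleftrightarrow> c' = f'"
      using c' H.inv_solve_right'[of "\<one>\<^bsub>H\<^esub>" c' f'] by auto
    ultimately show ?thesis unfolding f_def f'_def c_def c'_def by simp
  qed
  define w where "w i j = commutator ?F (?t i) (?t (i + j)) \<otimes>\<^bsub>?F\<^esub> inv\<^bsub>?F\<^esub>
      (foldr (\<lambda>l p. ?t (i + l) [^]\<^bsub>?F\<^esub> \<epsilon> j l \<otimes>\<^bsub>?F\<^esub> p) [k..<Suc (j - k)] \<one>\<^bsub>?F\<^esub>)" for i j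
  have R: "r \<in> Gnk_relators n k \<epsilon> \<longleftrightarrow>
      (\<exists>i. r = ?t i [^]\<^bsub>?F\<^esub> (2::nat) \<and> 1 \<le> i \<and> i \<le> n) \<or>
      (\<exists>i j. r = commutator ?F (?t i) (?t (i + j)) \<and> 1 \<le> i \<and> i + j \<le> n \<and> 0 < j \<and> j < n - k) \<or>
      (\<exists>i j. r = w i j \<and> 1 \<le> i \<and> i < i + j \<and> i + j \<le> n \<and> n - k \<le> j \<and> j \<le> n - 1)" for r
    unfolding Gnk_relators_def Let_def w_def by (simp only: Un_iff mem_Collect_eq disj_assoc)
  show ?thesis
  proof
    assume L: "\<forall>r\<in>Gnk_relators n k \<epsilon>. h r = \<one>\<^bsub>H\<^esub>"
    show "satisfies_relations H (\<lambda>i. h (?t i)) n k \<epsilon>"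
      unfolding satisfies_relations_def
    proof (intro conjI allI impI)
      fix i assume i: "1 \<le> i" "i \<le> n"
      then have "?t i [^]\<^bsub>?F\<^esub> (2::nat) \<in> Gnk_relators n k \<epsilon>" using R by blast
      then have "h (?t i [^]\<^bsub>?F\<^esub> (2::nat)) = \<one>\<^bsub>H\<^esub>" by (rule bspec[OF L])
      then show "h (?t i) \<otimes>\<^bsub>H\<^esub> h (?t i) = \<one>\<^bsub>H\<^esub>" by (simp only: 1[OF i])
    next
      fix i j assume ij: "1 \<le> i" "i + j \<le> n" "0 < j" "j < n - k"
      then have "commutator ?F (?t i) (?t (i + j)) \<in> Gnk_relators n k \<epsilon>" using R by blast
      then have "h (commutator ?F (?t i) (?t (i + j))) = \<one>\<^bsub>H\<^esub>" by (rule bspec[OF L])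
      then show "commutator H (h (?t i)) (h (?t (i + j))) = \<one>\<^bsub>H\<^esub>" by (simp only: 2[OF ij(1,2)])
    next
      fix i j assume ij: "1 \<le> i" "i < i + j" "i + j \<le> n" "n - k \<le> j" "j \<le> n - 1"
      then have "w i j \<in> Gnk_relators n k \<epsilon>" using R by blast
      then have "h (w i j) = \<one>\<^bsub>H\<^esub>" by (rule bspec[OF L])
      then show "commutator H (h (?t i)) (h (?t (i + j))) =
          foldr (\<lambda>l p. h (?t (i + l)) [^]\<^bsub>H\<^esub> \<epsilon> j l \<otimes>\<^bsub>H\<^esub> p) [k..<Suc (j - k)] \<one>\<^bsub>H\<^esub>"
        unfolding w_def by (rule 3[OF ij(1,3,4), THEN iffD1])
    qed
  next
    assume S: "satisfies_relations H (\<lambda>i. h (?t i)) n k \<epsilon>"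
    show "\<forall>r\<in>Gnk_relators n k \<epsilon>. h r = \<one>\<^bsub>H\<^esub>"
    proof
      fix r assume "r \<in> Gnk_relators n k \<epsilon>"
      then have "(\<exists>i. r = ?t i [^]\<^bsub>?F\<^esub> (2::nat) \<and> 1 \<le> i \<and> i \<le> n) \<or>
        (\<exists>i j. r = commutator ?F (?t i) (?t (i + j)) \<and> 1 \<le> i \<and> i + j \<le> n \<and> 0 < j \<and> j < n - k) \<or>
        (\<exists>i j. r = w i j \<and> 1 \<le> i \<and> i < i + j \<and> i + j \<le> n \<and> n - k \<le> j \<and> j \<le> n - 1)"
        by (rule R[THEN iffD1])
      then show "h r = \<one>\<^bsub>H\<^esub>"
      proof (elim disjE exE conjE)
        fix i assume r: "r = ?t i [^]\<^bsub>?F\<^esub> (2::nat)" and i: "1 \<le> i" "i \<le> n"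
        have "h (?t i) \<otimes>\<^bsub>H\<^esub> h (?t i) = \<one>\<^bsub>H\<^esub>"
          using S i unfolding satisfies_relations_def by blast
        then show ?thesis by (simp only: r 1[OF i])
      next
        fix i j assume r: "r = commutator ?F (?t i) (?t (i + j))"
          and ij: "1 \<le> i" "i + j \<le> n" "0 < j" "j < n - k"
        have "commutator H (h (?t i)) (h (?t (i + j))) = \<one>\<^bsub>H\<^esub>"
          using S ij unfolding satisfies_relations_def by blast
        then show ?thesis by (simp only: r 2[OF ij(1,2)])
      next
        fix i j assume r: "r = w i j"
          and ij: "1 \<le> i" "i < i + j" "i + j \<le> n" "n - k \<le> j" "j \<le> n - 1"
        have "commutator H (h (?t i)) (h (?t (i + j))) =
            foldr (\<lambda>l p. h (?t (i + l)) [^]\<^bsub>H\<^esub> \<epsilon> j l \<otimes>\<^bsub>H\<^esub> p) [k..<Suc (j - k)] \<one>\<^bsub>H\<^esub>"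
          using S ij unfolding satisfies_relations_def by blast
        then show ?thesis unfolding r w_def by (rule 3[OF ij(1,3,4), THEN iffD2])
      qed
    qed
  qed
qed

lemma satisfies_relations_cong:
  assumes "\<And>i. 1 \<le> i \<Longrightarrow> i \<le> n \<Longrightarrow> s i = s' i" and "satisfies_relations K s n k \<epsilon>"
  shows "satisfies_relations K s' n k \<epsilon>"
  unfolding satisfies_relations_def
proof (intro conjI allI impI)
  fix i assume "1 \<le> i" "i \<le> n"
  then show "s' i \<otimes>\<^bsub>K\<^esub> s' i = \<one>\<^bsub>K\<^esub>"
    using assms by (simp add: satisfies_relations_def)
next
  fix i j assume ij: "1 \<le> i" "i + j \<le> n" "0 < j" "j < n - k"
  then have "commutator K (s i) (s (i + j)) = \<one>\<^bsub>K\<^esub>"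
    using assms(2) unfolding satisfies_relations_def by blast
  then show "commutator K (s' i) (s' (i + j)) = \<one>\<^bsub>K\<^esub>"
    using assms(1)[of i] assms(1)[of "i + j"] ij by simp
next
  fix i j assume ij: "1 \<le> i" "i < i + j" "i + j \<le> n" "n - k \<le> j" "j \<le> n - 1"
  have "foldr (\<lambda>l p. s (i + l) [^]\<^bsub>K\<^esub> \<epsilon> j l \<otimes>\<^bsub>K\<^esub> p) [k..<Suc (j - k)] \<one>\<^bsub>K\<^esub>
      = foldr (\<lambda>l p. s' (i + l) [^]\<^bsub>K\<^esub> \<epsilon> j l \<otimes>\<^bsub>K\<^esub> p) [k..<Suc (j - k)] \<one>\<^bsub>K\<^esub>"
  proof (rule foldr_cong)
    fix l p assume "l \<in> set [k..<Suc (j - k)]"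
    then have "1 \<le> i + l" "i + l \<le> n" using ij by auto
    then show "s (i + l) [^]\<^bsub>K\<^esub> \<epsilon> j l \<otimes>\<^bsub>K\<^esub> p = s' (i + l) [^]\<^bsub>K\<^esub> \<epsilon> j l \<otimes>\<^bsub>K\<^esub> p"
      using assms(1) by simp
  qed auto
  moreover have "commutator K (s i) (s (i + j)) =
      foldr (\<lambda>l p. s (i + l) [^]\<^bsub>K\<^esub> \<epsilon> j l \<otimes>\<^bsub>K\<^esub> p) [k..<Suc (j - k)] \<one>\<^bsub>K\<^esub>"
    using assms(2) ij unfolding satisfies_relations_def by blast
  moreover have "s i = s' i" "s (i + j) = s' (i + j)" using assms(1) ij by auto
  ultimately show "commutator K (s' i) (s' (i + j)) =
      foldr (\<lambda>l p. s' (i + l) [^]\<^bsub>K\<^esub> \<epsilon> j l \<otimes>\<^bsub>K\<^esub> p) [k..<Suc (j - k)] \<one>\<^bsub>K\<^esub>"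
    by simp
qed

lemma (in involution_sequence) satisfies_relations_br:
  assumes rel: "satisfies_relations G t n k \<epsilon>" and ij: "1 \<le> i" "i < j" "j \<le> n" and k: "2 * k < n"
  shows "br i j = \<one> \<or> (1 \<le> k \<and> br i j \<in> seg (i + k) (j - k))"
    and "j < i + (n - k) \<Longrightarrow> br i j = \<one>"
proof -
  define d where "d = j - i"
  have d: "j = i + d" "0 < d" using ij by (auto simp: d_def)
  have br: "br i j = commutator G (t i) (t (i + d))" using br_commutator[of i j] ij d by simp
  show near: "br i j = \<one>" if "j < i + (n - k)"
    using rel br that d ij unfolding satisfies_relations_def by simp
  show "br i j = \<one> \<or> (1 \<le> k \<and> br i j \<in> seg (i + k) (j - k))"
  proof (cases "d < n - k")
    case True
    then show ?thesis using near d by simp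
  next
    case False
    then have dk: "n - k \<le> d" "d \<le> n - 1" "1 \<le> k" using ij d k by auto
    have "br i j = foldr (\<lambda>l p. t (i + l) [^] \<epsilon> d l \<otimes> p) [k..<Suc (d - k)] \<one>"
      using rel br dk d ij unfolding satisfies_relations_def by simp
    also have "\<dots> \<in> seg (i + k) (j - k)"
      by (rule foldr_t_seg) (use ij d dk k in auto)
    finally show ?thesis using dk by simp
  qed
qed


lemma Gnk_relators_closed:
  assumes "0 < n" "2 * k < n"
  shows "Gnk_relators n k \<epsilon> \<subseteq> carrier (free_group {1..n})"
proof -
  let ?F = "free_group {1..n}" and ?t = "free_gen {1..n}"
  interpret F: group ?F by (rule free_group_group)
  have t: "?t i \<in> carrier ?F" if "1 \<le> i" "i \<le> n" for i
    using that free_gen_closed[of i "{1..n}"] by simp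
  have com: "commutator ?F (?t i) (?t (i + j)) \<in> carrier ?F" if "1 \<le> i" "i + j \<le> n" for i j
    using t[of i] t[of "i + j"] that by (simp add: commutator_def del: One_nat_def)
  have fold: "foldr (\<lambda>l p. ?t (i + l) [^]\<^bsub>?F\<^esub> \<epsilon> j l \<otimes>\<^bsub>?F\<^esub> p) [k..<Suc (j - k)] \<one>\<^bsub>?F\<^esub> \<in> carrier ?F"
    if ij: "1 \<le> i" "i + j \<le> n" "n - k \<le> j" for i j
  proof -
    have "\<forall>l\<in>set [k..<Suc (j - k)]. ?t (i + l) \<in> carrier ?F"
    proof
      fix l assume "l \<in> set [k..<Suc (j - k)]"
      then have "l \<le> j" by auto
      then show "?t (i + l) \<in> carrier ?F" using ij by (intro t) auto
    qed
    then show ?thesis by (rule F.foldr_pow_closed)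
  qed
  show ?thesis
  proof
    fix r assume "r \<in> Gnk_relators n k \<epsilon>"
    then show "r \<in> carrier ?F"
      unfolding Gnk_relators_def Let_def
    proof (elim UnE CollectE exE conjE)
      fix i assume "r = ?t i [^]\<^bsub>?F\<^esub> (2::nat)" and i: "1 \<le> i" "i \<le> n"
      then show ?thesis using F.nat_pow_closed[OF t[OF i]] by simp
    next
      fix i j assume "r = commutator ?F (?t i) (?t (i + j))" and ij: "1 \<le> i" "i + j \<le> n"
      then show ?thesis using com[OF ij] by simp
    next
      fix i j assume r: "r = commutator ?F (?t i) (?t (i + j)) \<otimes>\<^bsub>?F\<^esub> inv\<^bsub>?F\<^esub>
            (foldr (\<lambda>l p. ?t (i + l) [^]\<^bsub>?F\<^esub> \<epsilon> j l \<otimes>\<^bsub>?F\<^esub> p) [k..<Suc (j - k)] \<one>\<^bsub>?F\<^esub>)"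
        and ij: "1 \<le> i" "i + j \<le> n" "n - k \<le> j"
      show ?thesis unfolding r by (rule F.m_closed[OF com[OF ij(1,2)] F.inv_closed[OF fold[OF ij]]])
    qed
  qed
qed

context
  fixes n k :: nat and \<epsilon> :: "nat \<Rightarrow> nat \<Rightarrow> nat"
  assumes nk: "0 < n" "2 * k < n"
begin

lemma Gnk_normal: "normal_closure (free_group {1..n}) (Gnk_relators n k \<epsilon>) \<lhd> free_group {1..n}"
  by (rule normal_closure_normal[OF free_group_group Gnk_relators_closed[OF nk]])

lemma Gnk_group: "group (Gnk n k \<epsilon>)"
  unfolding Gnk_def by (rule normal.factorgroup_is_group[OF Gnk_normal])

lemma Gnk_projection:
  "group_hom (free_group {1..n}) (Gnk n k \<epsilon>)
    (\<lambda>x. normal_closure (free_group {1..n}) (Gnk_relators n k \<epsilon>) #>\<^bsub>free_group {1..n}\<^esub> x)"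
proof (rule group_hom.intro[OF free_group_group Gnk_group group_hom_axioms.intro])
  show "(\<lambda>x. normal_closure (free_group {1..n}) (Gnk_relators n k \<epsilon>) #>\<^bsub>free_group {1..n}\<^esub> x)
      \<in> hom (free_group {1..n}) (Gnk n k \<epsilon>)"
    unfolding Gnk_def by (rule coset_hom[OF Gnk_normal])
qed

lemma Gnk_gen_closed: "1 \<le> i \<Longrightarrow> i \<le> n \<Longrightarrow> Gnk_gen n k \<epsilon> i \<in> carrier (Gnk n k \<epsilon>)"
  unfolding Gnk_gen_def
  by (rule group_hom.hom_closed[OF Gnk_projection free_gen_closed]) simp

text \<open>The projection from the free group is onto and maps generators to generators.\<close>

lemma Gnk_generate: "carrier (Gnk n k \<epsilon>) = generate (Gnk n k \<epsilon>) (Gnk_gen n k \<epsilon> ` {1..n})"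
proof -
  let ?F = "free_group {1..n}"
  let ?p = "\<lambda>x. normal_closure ?F (Gnk_relators n k \<epsilon>) #>\<^bsub>?F\<^esub> x"
  interpret F: group ?F by (rule free_group_group)
  have sub: "free_gen {1..n} ` {1..n} \<subseteq> carrier ?F" by (rule image_subsetI[OF free_gen_closed])
  have "carrier (Gnk n k \<epsilon>) = ?p ` carrier ?F"
    unfolding Gnk_def by (rule FactGroup_carrier)
  also have "carrier ?F = generate ?F (free_gen {1..n} ` {1..n})"
    by (rule equalityI[OF free_group_generate F.generate_incl[OF sub]])
  also have "?p ` \<dots> = generate (Gnk n k \<epsilon>) (?p ` free_gen {1..n} ` {1..n})"
    by (rule group_hom.generate_img[OF Gnk_projection sub, symmetric])
  also have "?p ` free_gen {1..n} ` {1..n} = Gnk_gen n k \<epsilon> ` {1..n}"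
    unfolding image_image by (rule image_cong[OF HOL.refl]) (rule Gnk_gen_def[symmetric])
  finally show ?thesis .
qed

lemma Gnk_satisfies_relations: "satisfies_relations (Gnk n k \<epsilon>) (Gnk_gen n k \<epsilon>) n k \<epsilon>"
proof -
  let ?F = "free_group {1..n}" and ?R = "Gnk_relators n k \<epsilon>"
  interpret F: group ?F by (rule free_group_group)
  have "normal_closure ?F ?R #>\<^bsub>?F\<^esub> r = \<one>\<^bsub>Gnk n k \<epsilon>\<^esub>" if "r \<in> ?R" for r
  proof -
    have "normal_closure ?F ?R #>\<^bsub>?F\<^esub> r = normal_closure ?F ?R"
      using that normal_closure_incl[of ?R ?F] Gnk_relators_closed[OF nk] normal_imp_subgroup[OF Gnk_normal]
      by (intro F.coset_join2) auto
    then show ?thesis by (simp add: Gnk_def FactGroup_def)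
  qed
  then have "satisfies_relations (Gnk n k \<epsilon>)
      (\<lambda>i. normal_closure ?F ?R #>\<^bsub>?F\<^esub> free_gen {1..n} i) n k \<epsilon>"
    by (intro relators_vanish_iff[OF Gnk_projection nk, THEN iffD1] ballI)
  then show ?thesis
    by (rule satisfies_relations_cong[rotated]) (simp only: Gnk_gen_def)
qed

text \<open>The universal property of \<open>G\<^bsub>n,k,\<epsilon>\<^esub>\<close>.\<close>

lemma Gnk_hom:
  assumes K: "group K" and s: "\<And>i. 1 \<le> i \<Longrightarrow> i \<le> n \<Longrightarrow> s i \<in> carrier K"
    and rel: "satisfies_relations K s n k \<epsilon>"
  shows "\<exists>h\<in>hom (Gnk n k \<epsilon>) K. \<forall>i\<in>{1..n}. h (Gnk_gen n k \<epsilon> i) = s i"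
proof -
  let ?F = "free_group {1..n}" and ?R = "Gnk_relators n k \<epsilon>"
  obtain p where p: "p \<in> hom ?F K" "\<forall>i\<in>{1..n}. p (free_gen {1..n} i) = s i"
    using free_group_hom[OF K, of "{1..n}" s] s by auto
  interpret p: group_hom ?F K p
    using p(1) K free_group_group[of "{1..n}"] by (simp add: group_hom_def group_hom_axioms_def)
  have "satisfies_relations K (\<lambda>i. p (free_gen {1..n} i)) n k \<epsilon>"
    by (rule satisfies_relations_cong[OF _ rel]) (use p(2) in auto)
  then have "\<forall>r\<in>?R. p r = \<one>\<^bsub>K\<^esub>" using relators_vanish_iff[OF p.group_hom_axioms nk] by blast
  then obtain h where h: "h \<in> hom (?F Mod normal_closure ?F ?R) K"
    "\<And>x. x \<in> carrier ?F \<Longrightarrow> h (normal_closure ?F ?R #>\<^bsub>?F\<^esub> x) = p x"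
    using normal_closure_quotient_hom[OF free_group_group Gnk_relators_closed[OF nk] K p(1)] by metis
  have "h (Gnk_gen n k \<epsilon> i) = s i" if "i \<in> {1..n}" for i
    unfolding Gnk_gen_def using h(2)[OF free_gen_closed[OF that]] p(2) that by simp
  then show ?thesis using h(1) unfolding Gnk_def by blast
qed

end


section \<open>Identification of the base group and of the HNN extension\<close>

context partial_shift
begin

lemma \<phi>_foldr:
  "\<forall>l\<in>set ls. 1 \<le> i + l \<and> i + l < n \<Longrightarrow>
    foldr (\<lambda>l p. t (i + l) [^] (e l :: nat) \<otimes> p) ls \<one> \<in> H\<^sub>1 \<and>
    \<phi> (foldr (\<lambda>l p. t (i + l) [^] e l \<otimes> p) ls \<one>) = foldr (\<lambda>l p. t (Suc i + l) [^] e l \<otimes> p) ls \<one>"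
proof (induction ls)
  case Nil
  then show ?case using subgroup.one_closed[OF H\<^sub>1] \<phi>_one by simp
next
  case (Cons l ls)
  have t: "t (i + l) \<in> H\<^sub>1" "\<phi> (t (i + l)) = t (Suc i + l)"
    using Cons.prems t_H\<^sub>1 t_Suc[of "i + l"] by simp_all
  have "t (i + l) [^] q \<in> H\<^sub>1 \<and> \<phi> (t (i + l) [^] q) = t (Suc i + l) [^] q" for q :: nat
    using t subgroup.one_closed[OF H\<^sub>1] subgroup.m_closed[OF H\<^sub>1] \<phi>_one \<phi>_mult
    by (induction q) simp_all
  then show ?case using Cons subgroup.m_closed[OF H\<^sub>1] \<phi>_mult by simp
qed

text \<open>The exponents in the relation for \<open>i = 1\<close> serve for every \<open>i\<close>, as \<open>\<phi>\<close> translates both sides.\<close>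

lemma br_foldr_shift:
  assumes one: "S.br 1 (1 + j) = foldr (\<lambda>l p. t (1 + l) [^] (e l :: nat) \<otimes> p) ls \<one>"
    and ls: "\<forall>l\<in>set ls. l \<le> j" and i: "1 \<le> i" "i + j \<le> n"
  shows "S.br i (i + j) = foldr (\<lambda>l p. t (i + l) [^] e l \<otimes> p) ls \<one>"
  using i
proof (induction i rule: dec_induct)
  case base
  show ?case by (rule one)
next
  case (step i)
  have "\<forall>l\<in>set ls. 1 \<le> i + l \<and> i + l < n" using ls step by auto
  note f = \<phi>_foldr[OF this, of e]
  have "S.br (Suc i) (Suc i + j) = \<phi> (S.br i (i + j))" using br_Suc[of i "i + j"] step by simp
  then show ?case using step f by simp
qed

text \<open>If \<open>G\<close> is abelian, \<open>k = 0\<close>. Otherwise \<open>k = n - m\<close> for the least distance \<open>m\<close> at which commutators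
  are non-trivial, and \<open>\<epsilon>\<close> comes from the normal words of the commutators \<open>[t\<^sub>1, t\<^bsub>1+j\<^esub>]\<close>.\<close>

lemma relations_exist:
  "\<exists>k \<epsilon>. gamma_params n k \<epsilon> \<and> 2 * k < n \<and> satisfies_relations G t n k \<epsilon>"
proof (cases "\<forall>d. 1 \<le> d \<longrightarrow> 1 + d \<le> n \<longrightarrow> S.br 1 (1 + d) = \<one>")
  case True
  have "gamma_params n 0 (\<lambda>_ _. 0)" using n_pos by (simp add: gamma_params_def)
  moreover have "satisfies_relations G t n 0 (\<lambda>_ _. 0)"
    unfolding satisfies_relations_def
  proof (intro conjI allI impI)
    fix i assume "1 \<le> i" "i \<le> n"
    then show "t i \<otimes> t i = \<one>" by (rule S.t_square)
  next
    fix i j assume ij: "1 \<le> i" "i + j \<le> n" "0 < j"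
    then have "S.br i (i + j) = \<one>" using True br_one_iff[of i j] by simp
    then show "commutator G (t i) (t (i + j)) = \<one>" using S.br_commutator[of i "i + j"] ij by simp
  next
    fix i j assume "n - 0 \<le> j" "j \<le> n - 1"
    then have False using n_pos by simp
    then show "commutator G (t i) (t (i + j)) =
        foldr (\<lambda>l p. t (i + l) [^] (0::nat) \<otimes> p) [0..<Suc (j - 0)] \<one>" ..
  qed
  ultimately show ?thesis using n_pos by (intro exI[of _ 0] exI[of _ "\<lambda>_ _. 0"]) simp
next
  case False
  define m where "m = (LEAST d. 1 \<le> d \<and> 1 + d \<le> n \<and> S.br 1 (1 + d) \<noteq> \<one>)"
  have ex: "\<exists>d. 1 \<le> d \<and> 1 + d \<le> n \<and> S.br 1 (1 + d) \<noteq> \<one>" using False by blast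
  have m: "1 \<le> m \<and> 1 + m \<le> n \<and> S.br 1 (1 + m) \<noteq> \<one>"
    unfolding m_def by (rule LeastI_ex[OF ex])
  have least: "S.br 1 (1 + d) = \<one>" if "1 \<le> d" "d < m" for d
    using not_less_Least[of d "\<lambda>d. 1 \<le> d \<and> 1 + d \<le> n \<and> S.br 1 (1 + d) \<noteq> \<one>"] that m
    unfolding m_def[symmetric] by simp
  interpret N: narrow_sequence G t n m
    by (rule narrow_sequence_least) (use m least in auto)
  define k where "k = n - m"
  have k: "1 \<le> k" "m + k = n" "n - k = m" using m by (auto simp: k_def)
  have narrow: "N.narrow k" and k2: "2 * k \<le> m" using N.narrow_all[of k] k by auto
  have "\<exists>e :: nat \<Rightarrow> nat. (\<forall>l. e l \<in> {0, 1}) \<and>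
      S.br 1 (1 + j) = foldr (\<lambda>l p. t (1 + l) [^] e l \<otimes> p) [k..<Suc (j - k)] \<one>"
    if j: "m \<le> j" "j \<le> n - 1" for j
  proof (rule S.normal_word)
    show "S.br 1 (1 + j) \<in> S.seg (1 + k) (1 + (j - k))"
      using N.narrowD[OF narrow, of 1 j] j k k2 by (simp add: Suc_diff_le)
  qed (use peel_shift j k k2 in auto)
  then have "\<forall>j. \<exists>e :: nat \<Rightarrow> nat. m \<le> j \<and> j \<le> n - 1 \<longrightarrow> (\<forall>l. e l \<in> {0, 1}) \<and>
      S.br 1 (1 + j) = foldr (\<lambda>l p. t (1 + l) [^] e l \<otimes> p) [k..<Suc (j - k)] \<one>"
    by blast
  then obtain \<epsilon> :: "nat \<Rightarrow> nat \<Rightarrow> nat" where \<epsilon>: "\<forall>j. m \<le> j \<and> j \<le> n - 1 \<longrightarrow> (\<forall>l. \<epsilon> j l \<in> {0, 1}) \<and>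
      S.br 1 (1 + j) = foldr (\<lambda>l p. t (1 + l) [^] \<epsilon> j l \<otimes> p) [k..<Suc (j - k)] \<one>"
    using choice[of "\<lambda>j e. m \<le> j \<and> j \<le> n - 1 \<longrightarrow> (\<forall>l. e l \<in> {0, 1 :: nat}) \<and>
      S.br 1 (1 + j) = foldr (\<lambda>l p. t (1 + l) [^] e l \<otimes> p) [k..<Suc (j - k)] \<one>"] by blast
  have "(\<Sum>l = k..m - k. \<epsilon> m l) > 0"
  proof (rule ccontr)
    assume "\<not> (\<Sum>l = k..m - k. \<epsilon> m l) > 0"
    then have z: "\<forall>l\<in>{k..m - k}. \<epsilon> m l = 0" by simp
    have "foldr (\<lambda>l p. t (1 + l) [^] \<epsilon> m l \<otimes> p) ls \<one> = \<one>" if "set ls \<subseteq> {k..m - k}" for ls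
      using that by (induction ls) (auto simp: z)
    then have "foldr (\<lambda>l p. t (1 + l) [^] \<epsilon> m l \<otimes> p) [k..<Suc (m - k)] \<one> = \<one>"
      by (simp del: upt_Suc add: atLeastLessThanSuc_atLeastAtMost)
    moreover have "S.br 1 (1 + m) = foldr (\<lambda>l p. t (1 + l) [^] \<epsilon> m l \<otimes> p) [k..<Suc (m - k)] \<one>"
    proof -
      have "m \<le> m \<and> m \<le> n - 1" using m by auto
      then show ?thesis using \<epsilon> by blast
    qed
    ultimately show False using m by simp
  qed
  then have "gamma_params n k \<epsilon>"
    unfolding gamma_params_def k(3) using \<epsilon> k k2 n_pos by auto
  moreover have "satisfies_relations G t n k \<epsilon>"
    unfolding satisfies_relations_def k(3)
  proof (intro conjI allI impI)
    fix i assume "1 \<le> i" "i \<le> n"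
    then show "t i \<otimes> t i = \<one>" by (rule S.t_square)
  next
    fix i j assume ij: "1 \<le> i" "i + j \<le> n" "0 < j" "j < m"
    then have "S.br i (i + j) = \<one>" using least[of j] br_one_iff[of i j] by simp
    then show "commutator G (t i) (t (i + j)) = \<one>" using S.br_commutator[of i "i + j"] ij by simp
  next
    fix i j assume ij: "1 \<le> i" "i < i + j" "i + j \<le> n" "m \<le> j" "j \<le> n - 1"
    have "S.br i (i + j) = foldr (\<lambda>l p. t (i + l) [^] \<epsilon> j l \<otimes> p) [k..<Suc (j - k)] \<one>"
    proof (rule br_foldr_shift)
      have "m \<le> j \<and> j \<le> n - 1" using ij by blast
      then show "S.br 1 (1 + j) = foldr (\<lambda>l p. t (1 + l) [^] \<epsilon> j l \<otimes> p) [k..<Suc (j - k)] \<one>"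
        using \<epsilon> by blast
    qed (use ij in auto)
    then show "commutator G (t i) (t (i + j)) =
        foldr (\<lambda>l p. t (i + l) [^] \<epsilon> j l \<otimes> p) [k..<Suc (j - k)] \<one>"
      using S.br_commutator[of i "i + j"] ij by simp
  qed
  moreover have "2 * k < n" using k k2 by simp
  ultimately show ?thesis by blast
qed

text \<open>The central subgroup is \<open>\<langle>t\<^bsub>k+1\<^esub>, \<dots>, t\<^bsub>n-k\<^esub>\<rangle>\<close>: its generators are at distance less than \<open>n - k\<close> from all
  others, and by the relations it contains all commutators.\<close>

lemma exponent_four:
  assumes rel: "satisfies_relations G t n k \<epsilon>" and k: "2 * k < n" and x: "x \<in> carrier G"
  shows "x [^] (4::nat) = \<one>"
proof (rule S.exponent_four_if_central)
  let ?Z = "S.seg (Suc k) (n - k)"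
  show Z: "subgroup ?Z G" by (rule S.seg_subgroup) auto
  have gen: "y \<in> generate G (t ` {1..n})" if "y \<in> carrier G" for y
    using that seg_all unfolding S.seg_def by simp
  have sub: "t ` {Suc k..n - k} \<subseteq> carrier G" "t ` {1..n} \<subseteq> carrier G" using S.t_closed by auto
  have tt: "t i \<otimes> t l = t l \<otimes> t i" if "i \<in> {1..n}" "l \<in> {Suc k..n - k}" for i l
  proof (cases i l rule: linorder_cases)
    case less
    then have "S.br i l = \<one>" by (intro S.satisfies_relations_br(2)[OF rel]) (use that k in auto)
    then show ?thesis using S.br_eq_one_iff[of i l] that by auto
  next
    case greater
    then have "S.br l i = \<one>" by (intro S.satisfies_relations_br(2)[OF rel]) (use that k in auto)
    then show ?thesis using S.br_eq_one_iff[of l i] that by auto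
  qed simp
  show central: "z \<otimes> y = y \<otimes> z" if z: "z \<in> ?Z" and y: "y \<in> carrier G" for z y
  proof (rule generate_commute[OF z[unfolded S.seg_def] sub(1) y])
    fix s assume "s \<in> t ` {Suc k..n - k}"
    then obtain l where l: "s = t l" "l \<in> {Suc k..n - k}" by blast
    have "y \<otimes> t l = t l \<otimes> y"
    proof (rule generate_commute[OF gen[OF y] sub(2)])
      show "t l \<in> carrier G" using sub(1) l by blast
      fix s' assume "s' \<in> t ` {1..n}"
      then obtain i where "s' = t i" "i \<in> {1..n}" by blast
      then show "s' \<otimes> t l = t l \<otimes> s'" using tt[OF _ l(2)] by simp
    qed
    then show "s \<otimes> y = y \<otimes> s" using l by simp
  qed
  show "z \<otimes> z = \<one>" if "z \<in> ?Z" for z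
    using that unfolding S.seg_def
  proof (induction rule: generate.induct)
    case one
    then show ?case by simp
  next
    case (incl h)
    then show ?case using S.t_square by auto
  next
    case (inv h)
    then obtain i where "h = t i" "i \<in> {Suc k..n - k}" by blast
    then have "1 \<le> i" "i \<le> n" "h = t i" by auto
    then show ?case using S.t_square[of i] S.t_inv[of i] by simp
  next
    case (eng h1 h2)
    have c: "h1 \<in> carrier G" "h2 \<in> carrier G"
      using generate_in_carrier[OF sub(1)] eng(1,2) by auto
    have com: "h2 \<otimes> h1 = h1 \<otimes> h2" by (rule central[unfolded S.seg_def, OF eng(2) c(1)])
    have "h1 \<otimes> h2 \<otimes> (h1 \<otimes> h2) = h1 \<otimes> (h2 \<otimes> h1) \<otimes> h2" using c by (simp only: m_assoc m_closed)
    also have "\<dots> = (h1 \<otimes> h1) \<otimes> (h2 \<otimes> h2)" unfolding com using c by (simp only: m_assoc m_closed)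
    finally show ?case using eng.IH by simp
  qed
  have br_less: "S.br i j \<in> ?Z" if "1 \<le> i" "i < j" "j \<le> n" for i j
    using S.satisfies_relations_br(1)[OF rel that k]
  proof
    assume "S.br i j = \<one>"
    then show ?thesis by (simp add: S.one_in_seg)
  next
    assume "1 \<le> k \<and> S.br i j \<in> S.seg (i + k) (j - k)"
    then show ?thesis using S.seg_mono[of "S.br i j" "i + k" "j - k"] that by simp
  qed
  show "S.br i j \<in> ?Z" if "i \<in> {1..n}" "j \<in> {1..n}" for i j
  proof (cases i j rule: linorder_cases)
    case less
    then show ?thesis using br_less that by simp
  next
    case equal
    then have "S.br i j = \<one>" using S.br_eq_one_iff[of i j] that by auto
    then show ?thesis by (simp add: S.one_in_seg)
  next
    case greater
    then have "S.br j i \<in> ?Z" using br_less that by simp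
    then have "inv (S.br j i) \<in> ?Z" by (rule subgroup.m_inv_closed[OF Z])
    then show ?thesis using S.br_swap[of j i] that by simp
  qed
qed (use seg_all x in auto)

text \<open>By induction on \<open>b\<close>, the kernel meets the segment \<open>\<langle>t\<^sub>1, \<dots>, t\<^sub>b\<rangle>\<close> of \<open>G\<^bsub>n,k,\<epsilon>\<^esub>\<close> trivially: an
  element of it cannot contain the last generator, as the image \<open>t\<^sub>b\<close> of that generator is not in the span of the earlier ones.\<close>

lemma Gnk_iso:
  assumes rel: "satisfies_relations G t n k \<epsilon>" and k: "2 * k < n"
  shows "\<exists>h\<in>iso (Gnk n k \<epsilon>) G. \<forall>i\<in>{1..n}. h (Gnk_gen n k \<epsilon> i) = t i"
proof -
  let ?Q = "Gnk n k \<epsilon>" and ?s = "Gnk_gen n k \<epsilon>"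
  have nk: "0 < n" "2 * k < n" using n_pos k by auto
  interpret Q: group ?Q by (rule Gnk_group[OF nk])
  note srel = Gnk_satisfies_relations[OF nk, of \<epsilon>]
  interpret Q: involution_sequence ?Q ?s n
  proof unfold_locales
    fix i assume i: "1 \<le> i" "i \<le> n"
    show "?s i \<in> carrier ?Q" by (rule Gnk_gen_closed[OF nk i])
    show "?s i \<otimes>\<^bsub>?Q\<^esub> ?s i = \<one>\<^bsub>?Q\<^esub>"
      using srel i unfolding satisfies_relations_def by blast
  qed
  obtain h where h: "h \<in> hom ?Q G" "\<forall>i\<in>{1..n}. h (?s i) = t i"
    using Gnk_hom[OF nk is_group S.t_closed rel] by blast
  interpret h: group_hom ?Q G h
    by (rule group_hom.intro[OF Q.is_group is_group group_hom_axioms.intro[OF h(1)]])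
  have Q_all: "carrier ?Q = Q.seg 1 n" unfolding Q.seg_def by (rule Gnk_generate[OF nk])
  have sub: "?s ` {a..b} \<subseteq> carrier ?Q" if "1 \<le> a" "b \<le> n" for a b using Q.t_closed that by auto
  have h_seg: "h ` Q.seg a b = S.seg a b" if "1 \<le> a" "b \<le> n" for a b
  proof -
    have "h ` ?s ` {a..b} = t ` {a..b}"
      unfolding image_image using h(2) that by (intro image_cong) auto
    then show ?thesis
      unfolding Q.seg_def S.seg_def using h.generate_img[OF sub[OF that]] by simp
  qed
  have ker: "x \<in> Q.seg 1 b \<Longrightarrow> h x = \<one> \<Longrightarrow> x = \<one>\<^bsub>?Q\<^esub>" if "b \<le> n" for b x
    using that
  proof (induction b arbitrary: x)
    case 0
    then show ?case using Q.seg_empty[of 0 1] by simp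
  next
    case (Suc b)
    have "Q.br i (Suc b) \<in> Q.seg 1 (Suc b - 1)" if i: "1 \<le> i" "i < Suc b" for i
      using Q.satisfies_relations_br(1)[OF srel i Suc.prems(3) k]
    proof
      assume "Q.br i (Suc b) = \<one>\<^bsub>?Q\<^esub>"
      then show ?thesis by (simp only: Q.one_in_seg)
    next
      assume "1 \<le> k \<and> Q.br i (Suc b) \<in> Q.seg (i + k) (Suc b - k)"
      then show ?thesis using Q.seg_mono[of "Q.br i (Suc b)" "i + k" "Suc b - k" 1 "Suc b - 1"] i by force
    qed
    then have "x \<in> Q.seg 1 b \<or> (\<exists>y\<in>Q.seg 1 b. x = ?s (Suc b) \<otimes>\<^bsub>?Q\<^esub> y)"
      using Q.peel_right_of_br[of 1 "Suc b" x] Suc.prems by simp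
    then show ?case
    proof
      assume "x \<in> Q.seg 1 b"
      then show ?thesis using Suc by simp
    next
      assume "\<exists>y\<in>Q.seg 1 b. x = ?s (Suc b) \<otimes>\<^bsub>?Q\<^esub> y"
      then obtain y where y: "y \<in> Q.seg 1 b" "x = ?s (Suc b) \<otimes>\<^bsub>?Q\<^esub> y" by blast
      have b: "1 \<le> Suc b" "Suc b \<le> n" using Suc.prems by auto
      have cy: "y \<in> carrier ?Q" using Q.seg_carrier[OF _ _ y(1)] b by simp
      have hy: "h y \<in> S.seg 1 b" using y(1) h_seg[of 1 b] b by auto
      have "t (Suc b) \<otimes> h y = \<one>" using Suc.prems(2) y(2) cy Q.t_closed[OF b] h(2) b by simp
      then have "t (Suc b) = inv (h y)"
        using h.hom_closed[OF cy] S.t_closed[OF b] by (simp add: inv_equality)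
      also have "\<dots> \<in> S.seg 1 b" using hy b by (intro S.seg_inv) auto
      finally show ?thesis using t_last_not_seg[OF b] by simp
    qed
  qed
  have "inj_on h (carrier ?Q)"
    using ker[OF le_refl] Q_all by (intro h.inj_on_one_iff[THEN iffD2]) auto
  moreover have "h ` carrier ?Q = carrier G" using h_seg[of 1 n] Q_all seg_all by simp
  ultimately have "h \<in> iso ?Q G" using h(1) by (simp add: iso_def bij_betw_def)
  then show ?thesis using h(2) by blast
qed

end


theorem theorem3p2:
  fixes G :: "('a, 'm) monoid_scheme" and H\<^sub>1 H\<^sub>2 :: "'a set" and \<phi> :: "'a \<Rightarrow> 'a"
  assumes "group G" and "finite (carrier G)"
    and "subgroup H\<^sub>1 G" and "subgroup H\<^sub>2 G"
    and "card (rcosets\<^bsub>G\<^esub> H\<^sub>1) = 2" and "card (rcosets\<^bsub>G\<^esub> H\<^sub>2) = 2"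
    and "\<phi> \<in> iso (G\<lparr>carrier := H\<^sub>1\<rparr>) (G\<lparr>carrier := H\<^sub>2\<rparr>)"
    and "\<And>K. subgroup K G \<Longrightarrow> K \<subseteq> H\<^sub>1 \<inter> H\<^sub>2 \<Longrightarrow> \<phi> ` K = K \<Longrightarrow> K = {\<one>\<^bsub>G\<^esub>}"
  shows "(\<exists>n k \<epsilon> \<psi>. gamma_params n k \<epsilon> \<and> Gnk_shift n k \<epsilon> \<psi> \<and>
            hnn_extension G H\<^sub>1 \<phi> \<cong> Gamma_ext n k \<epsilon> \<psi>)
         \<and> (\<forall>g\<in>carrier G. group.ord G g \<le> 4)"
proof -
  interpret P: partial_shift G H\<^sub>1 H\<^sub>2 \<phi>
    by (rule partial_shift.intro[OF assms(1) partial_shift_axioms.intro[OF assms(2-5,7,8)]])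
  obtain k \<epsilon> where k: "gamma_params P.n k \<epsilon>" "2 * k < P.n"
    and rel: "satisfies_relations G P.t P.n k \<epsilon>"
    using P.relations_exist by blast
  obtain n where n: "n = P.n" by simp
  let ?Q = "Gnk n k \<epsilon>" and ?s = "Gnk_gen n k \<epsilon>"
  have nk: "0 < n" "2 * k < n" "1 \<le> n" using P.n_pos k(2) n by auto
  interpret Q: group ?Q by (rule Gnk_group[OF nk(1,2)])
  obtain h where h: "h \<in> iso ?Q G" "\<forall>i\<in>{1..n}. h (?s i) = P.t i"
    using P.Gnk_iso[OF rel k(2)] unfolding n by blast
  define \<theta> where "\<theta> = inv_into (carrier ?Q) h"
  have \<theta>: "\<theta> \<in> iso G ?Q" unfolding \<theta>_def by (rule Q.iso_set_sym[OF h(1)])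
  have bij: "bij_betw h (carrier ?Q) (carrier G)" using h(1) by (simp add: iso_def)
  have h\<theta>: "h (\<theta> x) = x" if "x \<in> carrier G" for x
    using that bij unfolding \<theta>_def by (simp add: bij_betw_inv_into_right)
  have \<theta>h: "\<theta> (h x) = x" if "x \<in> carrier ?Q" for x
    using that bij unfolding \<theta>_def by (simp add: bij_betw_inv_into_left)
  interpret \<theta>: group_hom G ?Q \<theta>
    using \<theta> by (intro group_hom.intro[OF assms(1) Q.is_group group_hom_axioms.intro]) (simp add: iso_def)
  have s: "?s i \<in> carrier ?Q" if "1 \<le> i" "i \<le> n" for i using Gnk_gen_closed[OF nk(1,2) that] .
  have \<theta>t: "\<theta> (P.t i) = ?s i" if "1 \<le> i" "i \<le> n" for i
  proof -
    have "h (?s i) = P.t i" using h(2) that by simp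
    then show ?thesis using \<theta>h[OF s[OF that]] by simp
  qed
  have \<theta>_seg: "\<theta> ` P.S.seg a b = generate ?Q (?s ` {a..b})" if "1 \<le> a" "b \<le> n" for a b
  proof -
    have "\<theta> ` P.t ` {a..b} = ?s ` {a..b}"
      unfolding image_image using \<theta>t that by (intro image_cong) auto
    then show ?thesis
      unfolding P.S.seg_def using \<theta>.generate_img[OF P.S.image_carrier[of a b]] that n by simp
  qed
  have dom: "\<theta> ` H\<^sub>1 = Gnk_dom n k \<epsilon>"
  proof -
    have "{i. 1 \<le> i \<and> i \<le> n - 1} = {1..n - 1}" by auto
    then show ?thesis using \<theta>_seg[of 1 "n - 1"] P.seg_eq_H\<^sub>1 n by (simp add: Gnk_dom_def)
  qed
  have ran: "\<theta> ` H\<^sub>2 = Gnk_ran n k \<epsilon>"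
  proof -
    have "{i. 2 \<le> i \<and> i \<le> n} = {2..n}" by auto
    moreover have "H\<^sub>2 = P.S.seg 2 n"
    proof -
      have "\<phi> ` P.S.seg 1 (n - 1) = P.S.seg (Suc 1) (Suc (n - 1))"
        by (rule P.\<phi>_seg) (use nk n in auto)
      moreover have "\<phi> ` H\<^sub>1 = H\<^sub>2" using P.\<phi>_bij by (simp add: bij_betw_def)
      ultimately show ?thesis using P.seg_eq_H\<^sub>1 nk n by (simp add: numeral_2_eq_2)
    qed
    ultimately show ?thesis using \<theta>_seg[of 2 n] by (simp add: Gnk_ran_def)
  qed
  define \<psi> where "\<psi> = \<theta> \<circ> \<phi> \<circ> h"
  have \<psi>: "\<psi> (\<theta> u) = \<theta> (\<phi> u)" if "u \<in> H\<^sub>1" for u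
    using h\<theta>[OF P.H\<^sub>1_carrier[OF that]] by (simp add: \<psi>_def)
  have inj: "\<theta> x = \<theta> y \<longleftrightarrow> x = y" if "x \<in> carrier G" "y \<in> carrier G" for x y
    using h\<theta>[OF that(1)] h\<theta>[OF that(2)] by metis
  have "\<psi> \<in> iso (?Q\<lparr>carrier := Gnk_dom n k \<epsilon>\<rparr>) (?Q\<lparr>carrier := Gnk_ran n k \<epsilon>\<rparr>)"
    unfolding dom[symmetric] ran[symmetric]
  proof (rule isoI)
    show "\<psi> \<in> hom (?Q\<lparr>carrier := \<theta> ` H\<^sub>1\<rparr>) (?Q\<lparr>carrier := \<theta> ` H\<^sub>2\<rparr>)"
    proof (rule homI)
      fix a assume "a \<in> carrier (?Q\<lparr>carrier := \<theta> ` H\<^sub>1\<rparr>)"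
      then obtain u where u: "u \<in> H\<^sub>1" "a = \<theta> u" by auto
      then show "\<psi> a \<in> carrier (?Q\<lparr>carrier := \<theta> ` H\<^sub>2\<rparr>)" using \<psi> P.\<phi>_H\<^sub>2 by simp
      fix b assume "b \<in> carrier (?Q\<lparr>carrier := \<theta> ` H\<^sub>1\<rparr>)"
      then obtain v where v: "v \<in> H\<^sub>1" "b = \<theta> v" by auto
      have uv: "u \<otimes>\<^bsub>G\<^esub> v \<in> H\<^sub>1" using subgroup.m_closed[OF assms(3) u(1) v(1)] .
      have "\<theta> u \<otimes>\<^bsub>?Q\<^esub> \<theta> v = \<theta> (u \<otimes>\<^bsub>G\<^esub> v)" using u v P.H\<^sub>1_carrier by simp
      then have "\<psi> (a \<otimes>\<^bsub>?Q\<^esub> b) = \<theta> (\<phi> (u \<otimes>\<^bsub>G\<^esub> v))" using u v \<psi>[OF uv] by simp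
      also have "\<dots> = \<theta> (\<phi> u) \<otimes>\<^bsub>?Q\<^esub> \<theta> (\<phi> v)"
        using P.\<phi>_mult[OF u(1) v(1)] P.\<phi>_closed u v by simp
      finally show "\<psi> (a \<otimes>\<^bsub>?Q\<lparr>carrier := \<theta> ` H\<^sub>1\<rparr>\<^esub> b) = \<psi> a \<otimes>\<^bsub>?Q\<lparr>carrier := \<theta> ` H\<^sub>2\<rparr>\<^esub> \<psi> b"
        using u v \<psi> by simp
    qed
    have "inj_on \<psi> (\<theta> ` H\<^sub>1)"
    proof (rule inj_onI)
      fix a b assume ab: "a \<in> \<theta> ` H\<^sub>1" "b \<in> \<theta> ` H\<^sub>1" "\<psi> a = \<psi> b"
      then obtain u v where uv: "u \<in> H\<^sub>1" "a = \<theta> u" "v \<in> H\<^sub>1" "b = \<theta> v" by blast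
      then have "\<theta> (\<phi> u) = \<theta> (\<phi> v)" using ab(3) \<psi> by simp
      then have "u = v" using uv inj P.\<phi>_closed P.\<phi>_inj by simp
      then show "a = b" using uv by simp
    qed
    moreover have "\<psi> ` \<theta> ` H\<^sub>1 = \<theta> ` H\<^sub>2"
    proof -
      have "\<psi> ` \<theta> ` H\<^sub>1 = \<theta> ` \<phi> ` H\<^sub>1" unfolding image_image using \<psi> by (intro image_cong) auto
      then show ?thesis using P.\<phi>_bij by (simp add: bij_betw_def)
    qed
    ultimately show "bij_betw \<psi> (carrier (?Q\<lparr>carrier := \<theta> ` H\<^sub>1\<rparr>)) (carrier (?Q\<lparr>carrier := \<theta> ` H\<^sub>2\<rparr>))"
      by (simp add: bij_betw_def)
  qed
  moreover have "\<psi> (?s i) = ?s (i + 1)" if i: "1 \<le> i" "i \<le> n - 1" for i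
  proof -
    have "P.t i \<in> H\<^sub>1" using P.t_H\<^sub>1 i nk n by simp
    then have "\<psi> (\<theta> (P.t i)) = \<theta> (P.t (Suc i))" using \<psi> P.t_Suc i by simp
    then show ?thesis using \<theta>t[of i] \<theta>t[of "Suc i"] i nk by simp
  qed
  ultimately have shift: "Gnk_shift n k \<epsilon> \<psi>" unfolding Gnk_shift_def by blast
  have iso: "hnn_extension G H\<^sub>1 \<phi> \<cong> Gamma_ext n k \<epsilon> \<psi>"
    unfolding Gamma_ext_def
  proof (rule hnn_extension_iso[OF assms(1) Q.is_group \<theta>])
    show "H\<^sub>1 \<subseteq> carrier G" using P.H\<^sub>1_carrier by blast
    show "\<phi> ` H\<^sub>1 \<subseteq> carrier G" using P.\<phi>_closed by blast
    show "Gnk_dom n k \<epsilon> = \<theta> ` H\<^sub>1" by (rule dom[symmetric])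
  qed (rule \<psi>)
  have "P.ord g \<le> 4" if g: "g \<in> carrier G" for g
  proof -
    have "g [^]\<^bsub>G\<^esub> (4::nat) = \<one>\<^bsub>G\<^esub>" by (rule P.exponent_four[OF rel k(2) g])
    then have "P.ord g dvd 4" using P.pow_eq_id[OF g] by blast
    then show ?thesis by (rule dvd_imp_le) simp
  qed
  moreover have "gamma_params n k \<epsilon>" using k(1) n by simp
  ultimately show ?thesis using shift iso by blast
qed

end
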